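(* Let $S(t)$, $t\ge 0$, be a strongly continuous semigroup with generator $A$ on a complex Hilbert space $\mathcal H$. Assume that $\{\Re z\ge0\}$ is contained in the resolvent set of $A$, that $\|(z-A)^{-1}\|$ is uniformly bounded there, and that $\sup_{\Re z>0}\|(z-A)^{-1}\|=1$. Let $0<m\in C^1([0,+\infty[)$ satisfy $\|S(t)\|\le m(t)$ for all $t\ge0$. Let $a,b>0$. Then for $t\ge a+b$, $$\|S(t)\|\le e^{-(t-a-b)}\ \frac{\left(\inf_u\int_0^a m(s)^2\big(u'(s)^2-u(s)^2\big)_+\,ds\right)^{1/2}}{\left(\sup_\theta\int_0^b\frac1{m(s)^2}\big(\theta(s)^2-\theta'(s)^2\big)\,ds\right)^{1/2}},$$ where the infimum is over all real-valued $u\in H^1(]0,a[)$ with $u(0)=0$, $u(a)=1$, and the supremum is over all real-valued $\theta\in H^1(]0,b[)$ with $\theta(b)=1$ and $|\theta'|\le\theta$ (almost everywhere).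
   Context: For $x\in\mathbb R$, $x_+=\max(x,0)$. *)

theory Defs
  imports "HOL-Analysis.Analysis"
begin

class complex_hilbert = banach +
  fixes scaleC :: "complex \<Rightarrow> 'a \<Rightarrow> 'a" (infixr "*\<^sub>C" 75)
    and cinner :: "'a \<Rightarrow> 'a \<Rightarrow> complex"
  assumes scaleC_add_right: "c *\<^sub>C (x + y) = c *\<^sub>C x + c *\<^sub>C y"
    and scaleC_add_left: "(c + d) *\<^sub>C x = c *\<^sub>C x + d *\<^sub>C x"
    and scaleC_scaleC: "c *\<^sub>C d *\<^sub>C x = (c * d) *\<^sub>C x"
    and scaleC_one: "1 *\<^sub>C x = x"
    and scaleR_scaleC: "r *\<^sub>R x = complex_of_real r *\<^sub>C x"
    and cinner_commute: "cinner x y = cnj (cinner y x)"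
    and cinner_add_left: "cinner (x + y) w = cinner x w + cinner y w"
    and cinner_scaleC_left: "cinner (c *\<^sub>C x) y = c * cinner x y"
    and cinner_norm: "cinner x x = complex_of_real ((norm x)\<^sup>2)"

instantiation complex :: complex_hilbert
begin

definition scaleC_complex :: "complex \<Rightarrow> complex \<Rightarrow> complex"
  where "scaleC_complex c x = c * x"

definition cinner_complex :: "complex \<Rightarrow> complex \<Rightarrow> complex"
  where "cinner_complex x y = x * cnj y"

instance
  by standard
    (simp_all add: scaleC_complex_def cinner_complex_def algebra_simps scaleR_conv_of_real
      flip: complex_norm_square)

end

definition bounded_clinear :: "('a::complex_hilbert \<Rightarrow> 'a) \<Rightarrow> bool"
  where "bounded_clinear f \<longleftrightarrow> bounded_linear f \<and> (\<forall>c x. f (c *\<^sub>C x) = c *\<^sub>C f x)"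

definition strongly_continuous_semigroup :: "(real \<Rightarrow> 'a::complex_hilbert \<Rightarrow> 'a) \<Rightarrow> bool"
  where "strongly_continuous_semigroup S \<longleftrightarrow>
    (\<forall>t\<ge>0. bounded_clinear (S t)) \<and>
    (\<forall>x. S 0 x = x) \<and>
    (\<forall>s\<ge>0. \<forall>t\<ge>0. \<forall>x. S (s + t) x = S s (S t x)) \<and>
    (\<forall>x. continuous_on {0..} (\<lambda>t. S t x))"

text \<open>Unbounded operators are given by a domain together with a map, whose values
  outside the domain are irrelevant.\<close>

definition generator_dom :: "(real \<Rightarrow> 'a::complex_hilbert \<Rightarrow> 'a) \<Rightarrow> 'a set"
  where "generator_dom S = {x. \<exists>y. ((\<lambda>h. (1 / h) *\<^sub>R (S h x - x)) \<longlongrightarrow> y) (at_right 0)}"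

definition generator :: "(real \<Rightarrow> 'a::complex_hilbert \<Rightarrow> 'a) \<Rightarrow> 'a \<Rightarrow> 'a"
  where "generator S x = Lim (at_right 0) (\<lambda>h. (1 / h) *\<^sub>R (S h x - x))"

definition resolvent :: "'a::complex_hilbert set \<Rightarrow> ('a \<Rightarrow> 'a) \<Rightarrow> complex \<Rightarrow> 'a \<Rightarrow> 'a"
  where "resolvent D A z = the_inv_into D (\<lambda>x. z *\<^sub>C x - A x)"

definition resolvent_set :: "'a::complex_hilbert set \<Rightarrow> ('a \<Rightarrow> 'a) \<Rightarrow> complex set"
  where "resolvent_set D A =
    {z. bij_betw (\<lambda>x. z *\<^sub>C x - A x) D UNIV \<and> bounded_clinear (resolvent D A z)}"

text \<open>At the endpoint 0 the derivative is one-sided.\<close>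

definition C1_halfline :: "(real \<Rightarrow> real) \<Rightarrow> bool"
  where "C1_halfline m \<longleftrightarrow>
    (\<exists>m'. (\<forall>t\<ge>0. (m has_real_derivative m' t) (at t within {0..})) \<and> continuous_on {0..} m')"

definition test_function :: "real set \<Rightarrow> (real \<Rightarrow> real) \<Rightarrow> bool"
  where "test_function \<Omega> \<phi> \<longleftrightarrow>
    (\<forall>k x. (deriv ^^ k) \<phi> differentiable at x) \<and>
    (\<exists>K. compact K \<and> K \<subseteq> \<Omega> \<and> (\<forall>x. x \<notin> K \<longrightarrow> \<phi> x = 0))"

definition square_integrable_on :: "(real \<Rightarrow> real) \<Rightarrow> real set \<Rightarrow> bool"
  where "square_integrable_on f \<Omega> \<longleftrightarrow>
    set_borel_measurable lborel \<Omega> f \<and> set_integrable lborel \<Omega> (\<lambda>x. (f x)\<^sup>2)"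

definition weak_derivative_on :: "real set \<Rightarrow> (real \<Rightarrow> real) \<Rightarrow> (real \<Rightarrow> real) \<Rightarrow> bool"
  where "weak_derivative_on \<Omega> u u' \<longleftrightarrow>
    (\<forall>\<phi>. test_function \<Omega> \<phi> \<longrightarrow>
      (LINT x:\<Omega>|lborel. u x * deriv \<phi> x) = - (LINT x:\<Omega>|lborel. u' x * \<phi> x))"

text \<open>\<open>H1_deriv c u u'\<close>: the function \<open>u\<close> belongs to the Sobolev space \<open>H\<^sup>1(]0,c[)\<close> and \<open>u'\<close> is
  a representative of its weak derivative (which is unique almost everywhere). To give a
  meaning to boundary values, \<open>u\<close> is the representative that is continuous on \<open>[0,c]\<close>.\<close>

definition H1_deriv :: "real \<Rightarrow> (real \<Rightarrow> real) \<Rightarrow> (real \<Rightarrow> real) \<Rightarrow> bool"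
  where "H1_deriv c u u' \<longleftrightarrow>
    continuous_on {0..c} u \<and>
    square_integrable_on u {0<..<c} \<and> square_integrable_on u' {0<..<c} \<and>
    weak_derivative_on {0<..<c} u u'"

end

theory Submission
  imports Defs
begin

text \<open>
  Fix \<open>x\<close> and write \<open>f s = (norm (S s x))\<^sup>2\<close>. The estimate is the shadow of an energy inequality. Let \<open>\<psi>\<close>
  be a cut-off function that vanishes at \<open>0\<close> and for large times. Then \<open>v s = \<psi> s S(s) x\<close> solves
  \<open>v' = A v + w\<close> with \<open>w s = \<psi>' s S(s) x\<close>, so the Fourier-Laplace transforms satisfy \<open>v^(z) = R(z) w^(z)\<close>,
  where \<open>R(z)\<close> is the resolvent. Since \<open>R(z)\<close> is a contraction for \<open>Re z > 0\<close>, Parseval's identity gives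
  \<open>\<integral> (\<psi>\<^sup>2 - \<psi>'\<^sup>2) f \<le> 0\<close>.

  Now let \<open>\<psi>\<close> be \<open>u\<close> on \<open>[0, a]\<close>, then \<open>e\<close> to the power \<open>s - a\<close> up to time \<open>t - b\<close>, then
  \<open>c \<theta>(t - s)\<close> up to time \<open>t\<close>, with \<open>c = exp (t - a - b)\<close>, and then a decaying exponential. On both exponential
  pieces \<open>\<psi>\<^sup>2 = \<psi>'\<^sup>2\<close>. On the first piece \<open>f s \<le> (m s)\<^sup>2 (norm x)\<^sup>2\<close>; on the third \<open>S(t) = S(t - s) S(s)\<close> gives
  \<open>f s \<ge> (norm (S t x))\<^sup>2 / (m (t - s))\<^sup>2\<close>. What is left of the inequality is
  \<open>c\<^sup>2 (norm (S t x))\<^sup>2 J(\<theta>) \<le> I(u) (norm x)\<^sup>2\<close>, where \<open>I\<close> and \<open>J\<close> are the two integrals of the theorem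
  (lemma \<open>rising_and_falling_energy\<close>); an infimum over \<open>u\<close> and a supremum over \<open>\<theta>\<close> finish the proof.

  Four points need work.

  \<^item> Parseval's identity is only needed as an inequality between the mean squares of two continuous Hilbert space
  valued functions whose Fourier coefficients are ordered. It follows from averaging with the kernel
  \<open>((1 + cos t) / 2)\<close> to the power \<open>n\<close>, whose Fourier coefficients are nonnegative
  (lemma \<open>integral_norm_square_le_of_fourier\<close>).

  \<^item> The relation \<open>v^ = R w^\<close> holds for every \<open>x\<close>, and for all \<open>z\<close> in the half plane, because
  \<open>\<psi>\<close> has compact support: applying \<open>S(h)\<close> to \<open>v^(z)\<close> amounts to translating the scalar weight, so the generator acts
  by differentiating that weight (lemmas \<open>generator_smoothed_orbit\<close>, \<open>laplace_transform_le\<close>).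

  \<^item> The infinite exponential tail requires control of the orbit. The same inequality, with the weight
  \<open>exp (- 2 \<gamma> s)\<close> coming from the line \<open>Re z = \<gamma>\<close>, improves an exponential growth rate \<open>\<gamma> \<ge> 0\<close> to
  \<open>\<gamma> - 1/2\<close> (lemma \<open>growth_improvement\<close>). Finitely many steps show that every orbit is bounded.

  \<^item> The cut-off built from \<open>u\<close> and \<open>\<theta>\<close> merely has a square integrable slope. An approximation in the mean square
  sense extends the inequality to such cut-offs (lemma \<open>weighted_energy\<close>), and testing the weak derivative against
  smoothed indicator functions of intervals shows that Sobolev functions are of this kind
  (lemma \<open>H1_deriv_imp_L2_derivative\<close>).
\<close>

section \<open>Complex Hilbert spaces\<close>

lemma norm_scaleC: "norm (c *\<^sub>C x) = cmod c * norm (x::'a::complex_hilbert)"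
proof -
  have "complex_of_real ((norm (c *\<^sub>C x))\<^sup>2) = c * cinner x (c *\<^sub>C x)"
    by (metis cinner_norm cinner_scaleC_left)
  also have "cinner x (c *\<^sub>C x) = cnj c * cinner x x"
    by (metis cinner_commute cinner_scaleC_left complex_cnj_mult)
  also have "c * (cnj c * cinner x x) = complex_of_real ((cmod c * norm x)\<^sup>2)"
    by (simp add: cinner_norm power_mult_distrib complex_norm_square mult.assoc del: of_real_power)
  finally have "(norm (c *\<^sub>C x))\<^sup>2 = (cmod c * norm x)\<^sup>2"
    using of_real_eq_iff by blast
  then show ?thesis by (simp add: power2_eq_iff_nonneg)
qed

text \<open>Boundedness makes complex multiplication compatible with integrals and derivatives of vector-valued
  functions.\<close>
lemma bounded_bilinear_scaleC: "bounded_bilinear (scaleC :: complex \<Rightarrow> 'a::complex_hilbert \<Rightarrow> 'a)"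
proof (unfold_locales, goal_cases)
  case (3 r a b)
  then show ?case by (metis scaleR_scaleC scaleC_scaleC scaleR_conv_of_real)
next
  case (4 a r b)
  then show ?case by (simp add: scaleR_scaleC scaleC_scaleC mult.commute)
next
  case 5
  show ?case by (rule exI[of _ 1]) (simp add: norm_scaleC)
qed (auto simp: scaleC_add_left scaleC_add_right)

definition rinner :: "'a::complex_hilbert \<Rightarrow> 'a \<Rightarrow> real"
  where "rinner x y = Re (cinner x y)"

lemma rinner_commute: "rinner x y = rinner y x"
  unfolding rinner_def using cinner_commute[of x y] by simp

lemma rinner_self: "rinner x x = (norm x)\<^sup>2"
  by (simp add: rinner_def cinner_norm)

lemma rinner_add_left: "rinner (x + y) z = rinner x z + rinner y z"
  by (simp add: rinner_def cinner_add_left)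

lemma rinner_add_right: "rinner z (x + y) = rinner z x + rinner z y"
  by (metis rinner_add_left rinner_commute)

lemma rinner_scaleR_left: "rinner (r *\<^sub>R x) y = r * rinner x y"
  by (simp add: rinner_def scaleR_scaleC cinner_scaleC_left)

lemma rinner_scaleR_right: "rinner x (r *\<^sub>R y) = r * rinner x y"
  by (metis rinner_scaleR_left rinner_commute)

lemma polarization: "(norm (x - y))\<^sup>2 = (norm x)\<^sup>2 + (norm y)\<^sup>2 - 2 * rinner x y"
proof -
  have "(norm (x - y))\<^sup>2 = rinner (x + (-1) *\<^sub>R y) (x + (-1) *\<^sub>R y)"
    by (simp add: rinner_self)
  also have "\<dots> = rinner x x + rinner y y - 2 * rinner x y"
    unfolding rinner_add_left rinner_add_right rinner_scaleR_left rinner_scaleR_right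
    using rinner_commute[of x y] by simp
  finally show ?thesis by (simp add: rinner_self)
qed

text \<open>The Cauchy-Schwarz inequality: for unit vectors, \<open>polarization\<close> and \<open>0 \<le>
  (norm (x - y))\<^sup>2\<close> bound the inner product by 1; the rest is scaling.\<close>
lemma abs_rinner_le: "\<bar>rinner x y\<bar> \<le> norm x * norm y"
proof (cases "x = 0 \<or> y = 0")
  case True
  then show ?thesis
    using rinner_scaleR_left[of 0 x y] rinner_scaleR_right[of x 0 y] by auto
next
  case False
  have le: "rinner u v \<le> 1" if "norm u = 1" "norm v = 1" for u v :: 'a
    using polarization[of u v] that by (smt (verit) zero_le_power2 one_power2)
  define u v where "u = (1 / norm x) *\<^sub>R x" and "v = (1 / norm y) *\<^sub>R y"
  have 1: "rinner u v \<le> 1" "rinner (- u) v \<le> 1"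
    using False by (auto intro!: le simp: u_def v_def)
  have "\<bar>rinner u v\<bar> \<le> 1" using 1 rinner_scaleR_left[of "-1" u v] by simp
  moreover have "rinner u v = rinner x y / (norm x * norm y)"
    by (simp add: u_def v_def rinner_scaleR_left rinner_scaleR_right)
  ultimately show ?thesis using False by (simp add: field_simps abs_mult)
qed

lemma bounded_bilinear_rinner: "bounded_bilinear (rinner :: 'a::complex_hilbert \<Rightarrow> 'a \<Rightarrow> real)"
  by unfold_locales
    (auto simp: rinner_add_left rinner_add_right rinner_scaleR_left rinner_scaleR_right
      intro!: exI[of _ 1] abs_rinner_le)

lemma rinner_cis_left_right:
  "rinner (cis \<alpha> *\<^sub>C x) (cis \<beta> *\<^sub>C y) = Re (cis (\<alpha> - \<beta>) * cinner x y)"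
proof -
  have "cinner (cis \<alpha> *\<^sub>C x) (cis \<beta> *\<^sub>C y) = cis \<alpha> * cnj (cis \<beta>) * cinner x y"
    by (metis (no_types, opaque_lifting) cinner_commute cinner_scaleC_left complex_cnj_mult
        mult.assoc)
  also have "cis \<alpha> * cnj (cis \<beta>) = cis (\<alpha> - \<beta>)"
    by (simp add: cis_cnj cis_mult)
  finally show ?thesis by (simp add: rinner_def)
qed

section \<open>Integrals over intervals and continuity\<close>

lemmas integral_split = Henstock_Kurzweil_Integration.integral_combine
lemmas integrable_split = Henstock_Kurzweil_Integration.integrable_combine

lemma integral_pos_continuous:
  fixes f :: "real \<Rightarrow> real"
  assumes "a < b" and f: "continuous_on {a..b} f" "\<And>x. 0 \<le> f x" and c: "c \<in> {a..b}" "f c \<noteq> 0"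
  shows "0 < integral {a..b} f"
proof -
  have int: "f integrable_on {a..b}" by (rule integrable_continuous_real[OF f(1)])
  have "integral {a..b} f \<noteq> 0"
  proof
    assume "integral {a..b} f = 0"
    then have "(f has_integral 0) (cbox a b)" using integrable_integral[OF int] by simp
    then have "f c = 0"
      using f c(1) \<open>a < b\<close> by (intro has_integral_0_cbox_imp_0[of a b f]) auto
    then show False using c(2) by simp
  qed
  moreover have "0 \<le> integral {a..b} f" by (intro integral_nonneg int f(2))
  ultimately show ?thesis by simp
qed

lemma continuous_Icc_abs_bounded:
  fixes w :: "real \<Rightarrow> real"
  assumes "continuous_on {a..b} w"
  obtains C where "C > 0" "\<And>x. x \<in> {a..b} \<Longrightarrow> \<bar>w x\<bar> \<le> C"
  using compact_imp_bounded[OF compact_continuous_image[OF assms compact_Icc]]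
  unfolding bounded_pos by (metis image_eqI real_norm_def)

section \<open>An averaging kernel on the circle\<close>

text \<open>Up to normalization, a nonnegative trigonometric polynomial that for large \<open>n\<close>
  concentrates at the multiples of \<open>2 \<pi> / \<nu>\<close>.\<close>
definition kern :: "real \<Rightarrow> nat \<Rightarrow> real \<Rightarrow> real"
  where "kern \<nu> n t = ((1 + cos (\<nu> * t)) / 2) ^ n"

text \<open>The kernel is the square of the modulus of \<open>((1 + exp(- i \<nu> t)) / 2)\<close> to the power
  \<open>n\<close>, so the binomial theorem yields its Fourier coefficients; it matters that they are
  nonnegative.\<close>
lemma kern_expand:
  "complex_of_real (kern \<nu> n t) =
     (\<Sum>j\<le>2*n. of_real (real ((2*n) choose j) / 4^n) * cis (- (\<nu> * (real j - real n)) * t))"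
proof -
  define \<theta> where "\<theta> = \<nu> * t"
  have "(1 + cis (- \<theta>))\<^sup>2 * cis \<theta> = 2 * (1 + of_real (cos \<theta>))"
  proof -
    have inv: "cis (- \<theta>) * cis \<theta> = 1" by (simp add: cis_mult)
    have "(1 + cis (- \<theta>))\<^sup>2 * cis \<theta> =
        cis \<theta> + 2 * (cis (- \<theta>) * cis \<theta>) + cis (- \<theta>) * (cis (- \<theta>) * cis \<theta>)"
      by (simp add: power2_eq_square algebra_simps)
    also have "\<dots> = 2 * (1 + of_real (cos \<theta>))"
      unfolding inv by (simp add: complex_eq_iff)
    finally show ?thesis .
  qed
  then have "complex_of_real ((1 + cos \<theta>) / 2) = (1 + cis (- \<theta>))\<^sup>2 * cis \<theta> / 4"
    by (simp add: field_simps)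
  then have "complex_of_real (kern \<nu> n t) = ((1 + cis (- \<theta>))\<^sup>2 * cis \<theta> / 4) ^ n"
    unfolding kern_def \<theta>_def[symmetric] of_real_power by (rule arg_cong)
  also have "\<dots> = (cis (- \<theta>) + 1) ^ (2*n) * cis (real n * \<theta>) / 4 ^ n"
    by (simp add: power_divide power_mult_distrib power_mult Complex.DeMoivre add.commute)
  also have "\<dots> = (\<Sum>j\<le>2*n. of_real (real ((2*n) choose j) / 4^n) *
      (cis (- (real j * \<theta>)) * cis (real n * \<theta>)))"
    unfolding binomial_ring sum_distrib_right sum_divide_distrib
    by (intro sum.cong) (auto simp: Complex.DeMoivre field_simps)
  finally show ?thesis
    by (simp add: cis_mult \<theta>_def algebra_simps)
qed

lemma kern_nonneg: "0 \<le> kern \<nu> n t"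
proof -
  have "0 \<le> 1 + cos (\<nu> * t)" using cos_ge_minus_one[of "\<nu> * t"] by linarith
  then show ?thesis by (simp add: kern_def)
qed

lemma continuous_on_kern [continuous_intros]:
  fixes f :: "'a::t2_space \<Rightarrow> real"
  shows "continuous_on A f \<Longrightarrow> continuous_on A (\<lambda>x. kern \<nu> n (f x))"
  unfolding kern_def by (intro continuous_intros) auto

lemma kern_Suc: "kern \<nu> (Suc n) t = kern \<nu> n t * kern \<nu> 1 t"
  by (simp add: kern_def)

lemma kern_minus: "kern \<nu> n (- t) = kern \<nu> n t"
  by (simp add: kern_def)

text \<open>A Wallis recursion. The function \<open>sin (\<nu> (s - r))\<close> times the kernel is periodic in
  \<open>r\<close>, so the integral of its derivative vanishes, and that derivative is a combination of two
  consecutive kernels. The shift \<open>s\<close> is carried along, which later makes the integral visibly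
  independent of it.\<close>
lemma kern_integral_Suc:
  assumes L: "L > 0"
  shows "2 * real (Suc n) * integral {0..L} (\<lambda>r. kern (2 * pi / L) (Suc n) (s - r)) =
    (2 * real n + 1) * integral {0..L} (\<lambda>r. kern (2 * pi / L) n (s - r))"
proof -
  define \<nu> where "\<nu> = 2 * pi / L"
  define F where "F r = sin (\<nu> * (s - r)) * kern \<nu> n (s - r)" for r
  define G where "G r = 2 * real (Suc n) * kern \<nu> (Suc n) (s - r)
    - (2 * real n + 1) * kern \<nu> n (s - r)" for r
  have F': "(F has_real_derivative (- \<nu> * G r)) (at r within {0..L})" for r
  proof -
    define c where "c = (1 + cos (\<nu> * (s - r))) / 2"
    have "(F has_real_derivative
       (cos (\<nu> * (s - r)) * (- \<nu>) * c ^ n + real n * c ^ (n - 1) * (- sin (\<nu> * (s - r)) * (- \<nu>) / 2) * sin (\<nu> * (s - r)))) (at r within {0..L})"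
    proof -
      have "((\<lambda>r. (1 + cos (\<nu> * (s - r))) / 2) has_real_derivative
          (- sin (\<nu> * (s - r)) * (- \<nu>) / 2)) (at r within {0..L})"
        by (auto intro!: derivative_eq_intros)
      then have "((\<lambda>r. ((1 + cos (\<nu> * (s - r))) / 2) ^ n) has_real_derivative
          (real n * c ^ (n - 1) * (- sin (\<nu> * (s - r)) * (- \<nu>) / 2))) (at r within {0..L})"
        unfolding c_def by (rule DERIV_power[THEN DERIV_cong]) simp
      moreover have "((\<lambda>r. sin (\<nu> * (s - r))) has_real_derivative
          (cos (\<nu> * (s - r)) * (- \<nu>))) (at r within {0..L})"
        by (auto intro!: derivative_eq_intros)
      ultimately show ?thesis
        unfolding F_def[abs_def] kern_def
        by (intro DERIV_mult[THEN DERIV_cong]) (auto simp: c_def)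
    qed
    moreover have "cos (\<nu> * (s - r)) * (- \<nu>) * c ^ n + real n * c ^ (n - 1) * (- sin (\<nu> * (s - r)) * (- \<nu>) / 2) * sin (\<nu> * (s - r))
        = - \<nu> * G r"
    proof -
      have sin2: "sin (\<nu> * (s - r)) * sin (\<nu> * (s - r)) = 4 * c * (1 - c)"
      proof -
        have "sin (\<nu> * (s - r)) * sin (\<nu> * (s - r)) =
            1 - cos (\<nu> * (s - r)) * cos (\<nu> * (s - r))"
          using sin_cos_squared_add[of "\<nu> * (s - r)"] by (simp add: power2_eq_square)
        moreover have "1 - C * C = 4 * ((1 + C) / 2) * (1 - (1 + C) / 2)" for C :: real
          by (simp add: field_simps)
        ultimately show ?thesis unfolding c_def by simp
      qed
      have cs: "cos (\<nu> * (s - r)) = 2 * c - 1" by (simp add: c_def field_simps)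
      have pw: "real n * c ^ (n - 1) * c = real n * c ^ n"
        by (cases n) auto
      have "real n * c ^ (n - 1) * (- sin (\<nu> * (s - r)) * (- \<nu>) / 2) * sin (\<nu> * (s - r))
        = \<nu> / 2 * (real n * c ^ (n - 1)) * (sin (\<nu> * (s - r)) * sin (\<nu> * (s - r)))"
        by simp
      also have "\<dots> = 2 * \<nu> * (real n * c ^ (n - 1) * c) * (1 - c)"
        unfolding sin2 by (simp add: field_simps)
      finally show ?thesis
        unfolding pw cs G_def kern_def c_def[symmetric] by (simp add: algebra_simps)
    qed
    ultimately show ?thesis by simp
  qed
  have "((\<lambda>r. - \<nu> * G r) has_integral (F L - F 0)) {0..L}"
    by (rule fundamental_theorem_of_calculus)
       (use L F' in \<open>auto simp: has_real_derivative_iff_has_vector_derivative[symmetric]\<close>)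
  moreover have "F L = F 0"
  proof -
    have "\<nu> * (s - L) = \<nu> * s - 2 * pi" using L by (simp add: \<nu>_def field_simps)
    then show ?thesis by (simp add: F_def kern_def sin_diff cos_diff)
  qed
  ultimately have "integral {0..L} (\<lambda>r. - \<nu> * G r) = 0"
    by (metis diff_self integral_unique)
  then have "integral {0..L} G = 0" using L by (simp add: \<nu>_def)
  moreover have "integral {0..L} G =
    2 * real (Suc n) * integral {0..L} (\<lambda>r. kern \<nu> (Suc n) (s - r))
    - (2 * real n + 1) * integral {0..L} (\<lambda>r. kern \<nu> n (s - r))"
    unfolding G_def
    by (subst integral_diff) (auto intro!: integrable_continuous_real continuous_intros)
  ultimately show ?thesis by (simp add: \<nu>_def)
qed

lemma kern_integral:
  assumes L: "L > 0"
  shows "integral {0..L} (\<lambda>r. kern (2 * pi / L) n (s - r)) =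
    L * (\<Prod>i<n. (2 * real i + 1) / (2 * real i + 2))"
proof (induction n)
  case 0
  then show ?case using L by (simp add: kern_def)
next
  case (Suc n)
  have "integral {0..L} (\<lambda>r. kern (2 * pi / L) (Suc n) (s - r)) =
    (2 * real n + 1) * integral {0..L} (\<lambda>r. kern (2 * pi / L) n (s - r)) / (2 * real n + 2)"
    using kern_integral_Suc[OF L, of n s] by (simp add: field_simps)
  then show ?case unfolding Suc.IH by simp
qed

lemma kern_integral_shift:
  assumes "L > 0"
  shows "integral {0..L} (\<lambda>r. kern (2 * pi / L) n (s - r)) = integral {0..L} (\<lambda>r. kern (2 * pi / L) n r)"
  using kern_integral[OF assms, of n s] kern_integral[OF assms, of n 0] by (simp add: kern_minus)

text \<open>Uniform continuity on the circle, in the form needed for averaging: away from the diagonal the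
  difference is absorbed by a multiple of \<open>1 - kern \<nu> 1\<close>, which is positive there and whose
  average against the \<open>n\<close>-th kernel tends to \<open>0\<close>.\<close>
lemma periodic_modulus:
  fixes v :: "real \<Rightarrow> 'a::real_normed_vector"
  assumes L: "L > 0" and v: "continuous_on {0..L} v" and per: "v 0 = v L" and \<epsilon>: "\<epsilon> > 0"
  shows "\<exists>C\<ge>0. \<forall>s\<in>{0..L}. \<forall>r\<in>{0..L}.
    (norm (v s - v r))\<^sup>2 \<le> \<epsilon> + C * (1 - kern (2 * pi / L) 1 (s - r))"
proof -
  \<comment> \<open>Half of the allowed distance, since pairs near opposite ends are joined through \<open>v 0 = v L\<close>.\<close>
  define e where "e = sqrt \<epsilon> / 2"
  have e: "e > 0" "(2 * e)\<^sup>2 = \<epsilon>" using \<epsilon> by (auto simp: e_def)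
  have "uniformly_continuous_on {0..L} v"
    using v by (simp add: compact_uniformly_continuous)
  then obtain d where d: "d > 0"
    "\<And>s r. s \<in> {0..L} \<Longrightarrow> r \<in> {0..L} \<Longrightarrow> \<bar>s - r\<bar> < d \<Longrightarrow> norm (v s - v r) < e"
    using e(1) unfolding uniformly_continuous_on_def dist_norm by (metis real_norm_def)
  define \<delta> where "\<delta> = min d (L / 2)"
  have \<delta>: "\<delta> > 0" "\<delta> \<le> L / 2" "\<delta> \<le> d" using d L by (auto simp: \<delta>_def)
  define q where "q x = 1 - kern (2 * pi / L) 1 x" for x
  have q_nonneg: "q x \<ge> 0" for x
    unfolding q_def kern_def using cos_le_one[of "2 * pi / L * x"] by simp
  have q_even: "q (- x) = q x" for x by (simp add: q_def kern_minus)
  obtain x0 where x0: "x0 \<in> {\<delta>..L - \<delta>}" "\<And>x. x \<in> {\<delta>..L - \<delta>} \<Longrightarrow> q x0 \<le> q x"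
  proof -
    have "continuous_on {\<delta>..L - \<delta>} q"
      unfolding q_def by (intro continuous_intros)
    then show ?thesis
      using continuous_attains_inf[of "{\<delta>..L - \<delta>}" q] \<delta> that by auto
  qed
  have "q x0 > 0"
  proof -
    have x: "0 < 2 * pi / L * x0" "2 * pi / L * x0 < 2 * pi"
      using x0(1) \<delta> L by (auto simp: field_simps)
    have "cos (2 * pi / L * x0) \<noteq> 1"
    proof
      assume "cos (2 * pi / L * x0) = 1"
      then obtain k :: int where "2 * pi / L * x0 = real_of_int k * 2 * pi"
        using cos_one_2pi_int by auto
      with x have "0 < real_of_int k" "real_of_int k < 1" by (auto simp: zero_less_mult_iff)
      then show False by auto
    qed
    then have "cos (2 * pi / L * x0) < 1" using cos_le_one[of "2 * pi / L * x0"] by linarith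
    then show ?thesis by (simp add: q_def kern_def)
  qed
  obtain B where B: "\<And>s. s \<in> {0..L} \<Longrightarrow> norm (v s) \<le> B" "B > 0"
    using compact_imp_bounded[OF compact_continuous_image[OF v compact_Icc]]
    unfolding bounded_pos by (auto intro: that)
  define C where "C = (2 * B)\<^sup>2 / q x0"
  have "C \<ge> 0" using \<open>q x0 > 0\<close> by (simp add: C_def)
  have main: "(norm (v s - v r))\<^sup>2 \<le> \<epsilon> + C * q (s - r)"
    if sr: "s \<in> {0..L}" "r \<in> {0..L}" "r \<le> s" for s r
  proof -
    consider "s - r < \<delta>" | "s - r > L - \<delta>" | "s - r \<in> {\<delta>..L - \<delta>}" by force
    then show ?thesis
    proof cases
      case 1
      then have "norm (v s - v r) \<le> 2 * e" using d(2)[of s r] sr \<delta> e by auto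
      then have "(norm (v s - v r))\<^sup>2 \<le> (2 * e)\<^sup>2" by (intro power_mono) auto
      then show ?thesis using e(2) \<open>C \<ge> 0\<close> q_nonneg[of "s - r"]
        by (smt (verit) mult_nonneg_nonneg)
    next
      case 2
      then have "norm (v s - v L) < e" "norm (v 0 - v r) < e"
        using d(2)[of s L] d(2)[of 0 r] sr \<delta> by auto
      then have "norm (v s - v r) \<le> 2 * e"
        using norm_triangle_ineq[of "v s - v L" "v 0 - v r"] per by simp
      then have "(norm (v s - v r))\<^sup>2 \<le> (2 * e)\<^sup>2" by (intro power_mono) auto
      then show ?thesis using e(2) \<open>C \<ge> 0\<close> q_nonneg[of "s - r"]
        by (smt (verit) mult_nonneg_nonneg)
    next
      case 3
      have "norm (v s - v r) \<le> 2 * B"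
        using norm_triangle_ineq4[of "v s" "v r"] B(1)[OF sr(1)] B(1)[OF sr(2)] by simp
      then have "(norm (v s - v r))\<^sup>2 \<le> (2 * B)\<^sup>2" by (intro power_mono) auto
      also have "\<dots> = C * q x0" using \<open>q x0 > 0\<close> by (simp add: C_def)
      also have "\<dots> \<le> C * q (s - r)" using x0(2)[OF 3] \<open>C \<ge> 0\<close> by (intro mult_left_mono)
      finally show ?thesis using \<epsilon> by simp
    qed
  qed
  have "(norm (v s - v r))\<^sup>2 \<le> \<epsilon> + C * q (s - r)"
    if "s \<in> {0..L}" "r \<in> {0..L}" for s r
    using main[of s r] main[of r s] that q_even[of "s - r"]
    by (cases "r \<le> s") (auto simp: norm_minus_commute)
  then show ?thesis using \<open>C \<ge> 0\<close> unfolding q_def by blast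
qed

definition dint :: "real \<Rightarrow> (real \<Rightarrow> real \<Rightarrow> real) \<Rightarrow> real"
  where "dint L f = integral {0..L} (\<lambda>s. integral {0..L} (f s))"

abbreviation cont2 :: "real \<Rightarrow> (real \<Rightarrow> real \<Rightarrow> real) \<Rightarrow> bool"
  where "cont2 L f \<equiv> continuous_on ({0..L} \<times> {0..L}) (\<lambda>(s, r). f s r)"

lemma cont2_integrable:
  assumes "cont2 L f"
  shows "s \<in> {0..L} \<Longrightarrow> f s integrable_on {0..L}"
    and "(\<lambda>s. integral {0..L} (f s)) integrable_on {0..L}"
proof -
  show "f s integrable_on {0..L}" if "s \<in> {0..L}"
  proof (rule integrable_continuous_real)
    have "continuous_on {0..L} ((\<lambda>(s, r). f s r) \<circ> (\<lambda>r. (s, r)))"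
      by (rule continuous_on_compose)
         (use that in \<open>auto intro!: continuous_intros continuous_on_subset[OF assms]\<close>)
    then show "continuous_on {0..L} (f s)" by (simp add: o_def)
  qed
  show "(\<lambda>s. integral {0..L} (f s)) integrable_on {0..L}"
    using integral_continuous_on_param[of "{0..L}" 0 L f] assms
    by (intro integrable_continuous_real) auto
qed

lemma dint_add: "cont2 L f \<Longrightarrow> cont2 L g \<Longrightarrow> dint L (\<lambda>s r. f s r + g s r) = dint L f + dint L g"
proof -
  assume f: "cont2 L f" and g: "cont2 L g"
  have "dint L (\<lambda>s r. f s r + g s r) =
      integral {0..L} (\<lambda>s. integral {0..L} (f s) + integral {0..L} (g s))"
    unfolding dint_def using f g by (intro integral_cong integral_add cont2_integrable(1))
  also have "\<dots> = dint L f + dint L g"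
    unfolding dint_def using f g by (intro integral_add cont2_integrable(2))
  finally show ?thesis .
qed

lemma dint_cmult: "dint L (\<lambda>s r. c * f s r) = c * dint L f"
  unfolding dint_def by simp

lemma dint_diff: "cont2 L f \<Longrightarrow> cont2 L g \<Longrightarrow> dint L (\<lambda>s r. f s r - g s r) = dint L f - dint L g"
proof -
  assume f: "cont2 L f" and g: "cont2 L g"
  have "dint L (\<lambda>s r. f s r - g s r) =
      integral {0..L} (\<lambda>s. integral {0..L} (f s) - integral {0..L} (g s))"
    unfolding dint_def using f g by (intro integral_cong integral_diff cont2_integrable(1))
  also have "\<dots> = dint L f - dint L g"
    unfolding dint_def using f g by (intro integral_diff cont2_integrable(2))
  finally show ?thesis .
qed

lemma dint_mono:
  "cont2 L f \<Longrightarrow> cont2 L g \<Longrightarrow> (\<And>s r. s \<in> {0..L} \<Longrightarrow> r \<in> {0..L} \<Longrightarrow> f s r \<le> g s r) \<Longrightarrow>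
    dint L f \<le> dint L g"
  unfolding dint_def
  by (intro integral_le cont2_integrable) auto

lemma cont2_sum: "finite I \<Longrightarrow> (\<And>i. i \<in> I \<Longrightarrow> cont2 L (f i)) \<Longrightarrow> cont2 L (\<lambda>s r. \<Sum>i\<in>I. f i s r)"
  by (simp add: case_prod_unfold continuous_on_sum)

lemma dint_sum:
  "finite I \<Longrightarrow> (\<And>i. i \<in> I \<Longrightarrow> cont2 L (f i)) \<Longrightarrow>
    dint L (\<lambda>s r. \<Sum>i\<in>I. f i s r) = (\<Sum>i\<in>I. dint L (f i))"
proof (induction I rule: finite_induct)
  case empty
  then show ?case by (simp add: dint_def)
next
  case (insert i I)
  then show ?case
    using dint_add[of L "f i" "\<lambda>s r. \<Sum>i\<in>I. f i s r"] cont2_sum[of I L f] by simp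
qed

section \<open>Comparing mean squares through Fourier coefficients\<close>

lemma cont2I [continuous_intros]:
  "continuous_on ({0..L} \<times> {0..L}) (\<lambda>p. f (fst p) (snd p)) \<Longrightarrow> cont2 L f"
  by (simp add: case_prod_unfold)

lemma cont_fst: "continuous_on {0..L} v \<Longrightarrow> continuous_on ({0..L} \<times> {0..L}) (\<lambda>p. v (fst p))"
  by (rule continuous_on_compose2[of _ v]) (auto intro!: continuous_intros)

lemma cont_snd: "continuous_on {0..L} v \<Longrightarrow> continuous_on ({0..L} \<times> {0..L}) (\<lambda>p. v (snd p))"
  by (rule continuous_on_compose2[of _ v]) (auto intro!: continuous_intros)

lemmas continuous_on_rinner [continuous_intros] =
  bounded_bilinear.continuous_on[OF bounded_bilinear_rinner]
lemmas continuous_on_scaleC [continuous_intros] =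
  bounded_bilinear.continuous_on[OF bounded_bilinear_scaleC]

definition fourier :: "real \<Rightarrow> (real \<Rightarrow> 'a::complex_hilbert) \<Rightarrow> real \<Rightarrow> 'a"
  where "fourier L v \<xi> = integral {0..L} (\<lambda>s. cis (- (\<xi> * s)) *\<^sub>C v s)"

lemma continuous_on_cis_lin [continuous_intros]:
  "continuous_on A f \<Longrightarrow> continuous_on A (\<lambda>x. cis (f x))"
  by (simp add: cis_conv_exp continuous_intros)

lemma rinner_integral_left:
  "f integrable_on A \<Longrightarrow> rinner (integral A f) y = integral A (\<lambda>s. rinner (f s) y)"
  using integral_linear[OF _ bounded_bilinear.bounded_linear_left[OF bounded_bilinear_rinner], of f A y]
  by (simp add: o_def)

lemma rinner_integral_right:
  "f integrable_on A \<Longrightarrow> rinner y (integral A f) = integral A (\<lambda>s. rinner y (f s))"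
  using integral_linear[OF _ bounded_bilinear.bounded_linear_right[OF bounded_bilinear_rinner], of f A y]
  by (simp add: o_def)

lemma norm_fourier_square:
  assumes v: "continuous_on {0..L} v"
  shows "(norm (fourier L v \<xi>))\<^sup>2 =
    dint L (\<lambda>s r. Re (cis (- \<xi> * (s - r)) * cinner (v s) (v r)))"
proof -
  define e where "e s = cis (- (\<xi> * s)) *\<^sub>C v s" for s
  have e: "e integrable_on {0..L}"
    unfolding e_def by (intro integrable_continuous_real continuous_intros v)
  have "(norm (fourier L v \<xi>))\<^sup>2 = rinner (integral {0..L} e) (integral {0..L} e)"
    by (simp add: rinner_self fourier_def e_def[abs_def])
  also have "\<dots> = dint L (\<lambda>s r. rinner (e s) (e r))"
    unfolding dint_def rinner_integral_left[OF e]
    by (intro integral_cong) (simp add: rinner_integral_right[OF e])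
  also have "(\<lambda>s r. rinner (e s) (e r)) = (\<lambda>s r. Re (cis (- \<xi> * (s - r)) * cinner (v s) (v r)))"
    by (simp add: fun_eq_iff e_def rinner_cis_left_right algebra_simps)
  finally show ?thesis .
qed

lemma cont2_fourier:
  assumes v: "continuous_on {0..L} v"
  shows "cont2 L (\<lambda>s r. Re (cis (\<alpha> * (s - r)) * cinner (v s) (v r)))"
proof -
  have "Re (cis (\<alpha> * (s - r)) * cinner (v s) (v r)) =
      rinner (cis (\<alpha> * s) *\<^sub>C v s) (cis (\<alpha> * r) *\<^sub>C v r)" for s r
    by (simp add: rinner_cis_left_right algebra_simps)
  then show ?thesis
    by simp (intro continuous_intros cont2I cont_fst[OF v] cont_snd[OF v])
qed

text \<open>The averaged autocorrelation of \<open>v\<close> is a combination, with nonnegative weights, of the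
  squared norms of its Fourier coefficients. Hence it is monotone in those norms.\<close>
lemma dint_kern_rinner:
  assumes v: "continuous_on {0..L} v"
  shows "dint L (\<lambda>s r. kern \<nu> n (s - r) * rinner (v s) (v r)) =
    (\<Sum>j\<le>2*n. (real ((2*n) choose j) / 4^n) * (norm (fourier L v (\<nu> * (real j - real n))))\<^sup>2)"
proof -
  have "kern \<nu> n (s - r) * rinner (v s) (v r) =
      (\<Sum>j\<le>2*n. (real ((2*n) choose j) / 4^n) *
        Re (cis (- (\<nu> * (real j - real n)) * (s - r)) * cinner (v s) (v r)))" for s r
  proof -
    have "kern \<nu> n (s - r) * rinner (v s) (v r) =
        Re (complex_of_real (kern \<nu> n (s - r)) * cinner (v s) (v r))"
      by (simp add: rinner_def)
    also have "\<dots> = (\<Sum>j\<le>2*n. Re (of_real (real ((2*n) choose j) / 4^n) *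
        (cis (- (\<nu> * (real j - real n)) * (s - r)) * cinner (v s) (v r))))"
      unfolding kern_expand sum_distrib_right Re_sum mult.assoc ..
    also have "\<dots> = (\<Sum>j\<le>2*n. (real ((2*n) choose j) / 4^n) *
        Re (cis (- (\<nu> * (real j - real n)) * (s - r)) * cinner (v s) (v r)))"
      by (intro sum.cong refl) (simp only: Re_complex_of_real Im_complex_of_real times_complex.sel)
    finally show ?thesis .
  qed
  then have "dint L (\<lambda>s r. kern \<nu> n (s - r) * rinner (v s) (v r)) =
      dint L (\<lambda>s r. \<Sum>j\<le>2*n. (real ((2*n) choose j) / 4^n) *
        Re (cis (- (\<nu> * (real j - real n)) * (s - r)) * cinner (v s) (v r)))"
    by simp
  also have "\<dots> = (\<Sum>j\<le>2*n. dint L (\<lambda>s r. (real ((2*n) choose j) / 4^n) *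
        Re (cis (- (\<nu> * (real j - real n)) * (s - r)) * cinner (v s) (v r))))"
  proof (rule dint_sum)
    show "cont2 L (\<lambda>s r. (real ((2*n) choose j) / 4^n) *
        Re (cis (- (\<nu> * (real j - real n)) * (s - r)) * cinner (v s) (v r)))" for j
      using continuous_on_mult[OF continuous_on_const[of _ "real ((2*n) choose j) / 4^n"]
          cont2_fourier[OF v, of "- (\<nu> * (real j - real n))"]]
      by (simp add: case_prod_unfold)
  qed simp
  finally show ?thesis
    unfolding dint_cmult norm_fourier_square[OF v] by simp
qed

text \<open>Polarization turns the averaged autocorrelation into the mean square, up to an error that is
  nonnegative. Dropping the error gives Bessel's inequality; showing that it becomes negligible for large
  \<open>n\<close> gives completeness.\<close>
lemma dint_kern_polarize:
  fixes v :: "real \<Rightarrow> 'a::complex_hilbert"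
  assumes L: "L > 0" and v: "continuous_on {0..L} v"
  defines "K \<equiv> kern (2 * pi / L)"
  shows "dint L (\<lambda>s r. K n (s - r) * rinner (v s) (v r)) =
    integral {0..L} (\<lambda>r. K n r) * integral {0..L} (\<lambda>s. (norm (v s))\<^sup>2)
    - dint L (\<lambda>s r. K n (s - r) * (norm (v s - v r))\<^sup>2) / 2"
proof -
  define \<kappa> where "\<kappa> = integral {0..L} (\<lambda>r. K n r)"
  have \<kappa>: "integral {0..L} (\<lambda>r. K n (s - r)) = \<kappa>" for s
    unfolding K_def \<kappa>_def by (rule kern_integral_shift[OF L])
  have 1: "dint L (\<lambda>s r. K n (s - r) * (norm (v s))\<^sup>2) = \<kappa> * integral {0..L} (\<lambda>s. (norm (v s))\<^sup>2)"
    unfolding dint_def by (simp add: \<kappa>)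
  have c1: "cont2 L (\<lambda>s r. K n (s - r) * (norm (v s))\<^sup>2)"
    and c2: "cont2 L (\<lambda>s r. K n (s - r) * (norm (v r))\<^sup>2)"
    and c3: "cont2 L (\<lambda>s r. K n (s - r) * rinner (v s) (v r))"
    unfolding K_def by (intro continuous_intros cont2I cont_fst[OF v] cont_snd[OF v])+
  have "dint L (\<lambda>s r. K n (s - r) * (norm (v r))\<^sup>2) =
      dint L (\<lambda>r s. K n (s - r) * (norm (v r))\<^sup>2)"
    unfolding dint_def
    using integral_swap_continuous[of 0 0 L L "\<lambda>s r. K n (s - r) * (norm (v r))\<^sup>2"] c2
    by (simp add: cbox_Pair_eq)
  also have "\<dots> = dint L (\<lambda>s r. K n (s - r) * (norm (v s))\<^sup>2)"
    using kern_minus[of "2 * pi / L" n] unfolding K_def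
    by (intro arg_cong[where f = "dint L"] ext) (metis minus_diff_eq)
  finally have 2: "dint L (\<lambda>s r. K n (s - r) * (norm (v r))\<^sup>2) = \<kappa> * integral {0..L} (\<lambda>s. (norm (v s))\<^sup>2)"
    using 1 by simp
  have "dint L (\<lambda>s r. K n (s - r) * (norm (v s - v r))\<^sup>2) =
      dint L (\<lambda>s r. (K n (s - r) * (norm (v s))\<^sup>2 + K n (s - r) * (norm (v r))\<^sup>2)
        - 2 * (K n (s - r) * rinner (v s) (v r)))"
    by (simp add: polarization algebra_simps)
  also have "\<dots> = 2 * \<kappa> * integral {0..L} (\<lambda>s. (norm (v s))\<^sup>2)
      - 2 * dint L (\<lambda>s r. K n (s - r) * rinner (v s) (v r))"
  proof (subst dint_diff)
    show "cont2 L (\<lambda>s r. K n (s - r) * (norm (v s))\<^sup>2 + K n (s - r) * (norm (v r))\<^sup>2)"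
      using continuous_on_add[OF c1 c2] by (simp add: case_prod_unfold)
    show "cont2 L (\<lambda>s r. 2 * (K n (s - r) * rinner (v s) (v r)))"
      using continuous_on_mult[OF continuous_on_const[of _ "2::real"] c3]
      by (simp add: case_prod_unfold)
  qed (simp only: dint_add[OF c1 c2] dint_cmult 1 2)
  finally show ?thesis by (simp add: \<kappa>_def field_simps)
qed

text \<open>For \<open>w\<close> the error term of \<open>dint_kern_polarize\<close> can be dropped. For
  \<open>v\<close> it is estimated by \<open>periodic_modulus\<close>: relative to the total mass of the kernel
  it is at most a multiple of \<open>\<epsilon>\<close> plus a multiple of \<open>1 / (2 n + 2)\<close>, since
  multiplication by \<open>kern \<nu> 1\<close> leads from one kernel to the next.\<close>
lemma integral_norm_square_le_of_fourier:
  fixes v w :: "real \<Rightarrow> 'a::complex_hilbert"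
  assumes L: "L > 0" and v: "continuous_on {0..L} v" and w: "continuous_on {0..L} w"
    and per: "v 0 = v L"
    and le: "\<And>\<xi>. norm (fourier L v \<xi>) \<le> norm (fourier L w \<xi>)"
  shows "integral {0..L} (\<lambda>s. (norm (v s))\<^sup>2) \<le> integral {0..L} (\<lambda>s. (norm (w s))\<^sup>2)"
proof (rule field_le_epsilon)
  fix \<epsilon> :: real assume "\<epsilon> > 0"
  define K where "K = kern (2 * pi / L)"
  define \<kappa> where "\<kappa> n = integral {0..L} (\<lambda>r. K n r)" for n
  have \<kappa>_shift: "integral {0..L} (\<lambda>r. K n (s - r)) = \<kappa> n" for s n
    unfolding K_def \<kappa>_def by (rule kern_integral_shift[OF L])
  have \<kappa>_Suc: "\<kappa> (Suc n) = (2 * real n + 1) / (2 * real n + 2) * \<kappa> n" and \<kappa>_pos: "\<kappa> n > 0" for n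
    using \<kappa>_shift[of _ 0] kern_integral[OF L, of _ 0] L
    by (auto simp: K_def intro!: mult_pos_pos prod_pos)
  obtain C where C: "C \<ge> 0" "\<And>s r. s \<in> {0..L} \<Longrightarrow> r \<in> {0..L} \<Longrightarrow>
      (norm (v s - v r))\<^sup>2 \<le> \<epsilon> / L + C * (1 - K 1 (s - r))"
    using periodic_modulus[OF L v per, of "\<epsilon> / L"] \<open>\<epsilon> > 0\<close> L unfolding K_def by auto
  have bound: "integral {0..L} (\<lambda>s. (norm (v s))\<^sup>2) \<le> integral {0..L} (\<lambda>s. (norm (w s))\<^sup>2)
      + (\<epsilon> / L + C * (1 / (2 * real n + 2))) * L / 2" for n
  proof -
    define D where "D u = dint L (\<lambda>s r. K n (s - r) * (norm (u s - u r))\<^sup>2)" for u :: "real \<Rightarrow> 'a"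
    have "dint L (\<lambda>s r. K n (s - r) * rinner (v s) (v r)) \<le>
        dint L (\<lambda>s r. K n (s - r) * rinner (w s) (w r))"
      unfolding K_def dint_kern_rinner[OF v] dint_kern_rinner[OF w]
      by (intro sum_mono mult_left_mono power_mono le) auto
    then have "\<kappa> n * integral {0..L} (\<lambda>s. (norm (v s))\<^sup>2) \<le>
        \<kappa> n * integral {0..L} (\<lambda>s. (norm (w s))\<^sup>2) + D v / 2 - D w / 2"
      using dint_kern_polarize[OF L v, of n] dint_kern_polarize[OF L w, of n]
      unfolding K_def \<kappa>_def D_def by linarith
    moreover have "D w \<ge> 0"
      unfolding D_def dint_def K_def
      by (intro integral_nonneg cont2_integrable mult_nonneg_nonneg kern_nonneg
          continuous_intros cont2I cont_fst[OF w] cont_snd[OF w]) auto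
    moreover have Dv: "D v \<le> \<kappa> n * (\<epsilon> / L + C * (1 / (2 * real n + 2))) * L"
    proof -
      have "D v \<le> dint L (\<lambda>s r. (\<epsilon> / L + C) * K n (s - r) - C * K (Suc n) (s - r))"
        unfolding D_def
      proof (rule dint_mono)
        show "cont2 L (\<lambda>s r. K n (s - r) * (norm (v s - v r))\<^sup>2)"
          "cont2 L (\<lambda>s r. (\<epsilon> / L + C) * K n (s - r) - C * K (Suc n) (s - r))"
          unfolding K_def by (intro continuous_intros cont2I cont_fst[OF v] cont_snd[OF v])+
        fix s r assume "s \<in> {0..L}" "r \<in> {0..L}"
        then have "K n (s - r) * (norm (v s - v r))\<^sup>2 \<le>
            K n (s - r) * (\<epsilon> / L + C * (1 - K 1 (s - r)))"
          unfolding K_def by (intro mult_left_mono C(2)[unfolded K_def] kern_nonneg)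
        also have "\<dots> = (\<epsilon> / L + C) * K n (s - r) - C * K (Suc n) (s - r)"
          unfolding K_def kern_Suc[of _ n] by (simp add: algebra_simps)
        finally show "K n (s - r) * (norm (v s - v r))\<^sup>2 \<le> \<dots>" .
      qed
      also have "\<dots> = ((\<epsilon> / L + C) * \<kappa> n - C * \<kappa> (Suc n)) * L"
      proof -
        have c: "cont2 L (\<lambda>s r. c * K k (s - r))" for c k
          unfolding K_def by (intro continuous_intros cont2I)
        have "dint L (\<lambda>s r. K k (s - r)) = \<kappa> k * L" for k
          unfolding dint_def \<kappa>_shift using L by simp
        then show ?thesis
          unfolding dint_diff[OF c c] dint_cmult by (simp add: algebra_simps)
      qed
      also have "\<dots> = \<kappa> n * (\<epsilon> / L + C * (1 / (2 * real n + 2))) * L"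
        unfolding \<kappa>_Suc by (simp add: divide_simps) (simp add: algebra_simps)
      finally show ?thesis .
    qed
    ultimately have "\<kappa> n * integral {0..L} (\<lambda>s. (norm (v s))\<^sup>2) \<le>
        \<kappa> n * integral {0..L} (\<lambda>s. (norm (w s))\<^sup>2) + D v / 2"
      by linarith
    also have "\<dots> \<le> \<kappa> n * integral {0..L} (\<lambda>s. (norm (w s))\<^sup>2) +
        \<kappa> n * (\<epsilon> / L + C * (1 / (2 * real n + 2))) * L / 2"
      by (intro add_left_mono divide_right_mono Dv) simp
    also have "\<dots> = \<kappa> n * (integral {0..L} (\<lambda>s. (norm (w s))\<^sup>2) + (\<epsilon> / L + C * (1 / (2 * real n + 2))) * L / 2)"
    proof -
      have "k * x + k * y * L / 2 = k * (x + y * L / 2)" for k x y :: real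
        by (simp add: algebra_simps)
      then show ?thesis .
    qed
    finally have "\<kappa> n * integral {0..L} (\<lambda>s. (norm (v s))\<^sup>2) \<le> \<dots>" .
    then show ?thesis using \<kappa>_pos[of n] by simp
  qed
  have "(\<lambda>n. integral {0..L} (\<lambda>s. (norm (w s))\<^sup>2)
      + (\<epsilon> / L + C * (1 / (2 * real n + 2))) * L / 2)
    \<longlonglongrightarrow> integral {0..L} (\<lambda>s. (norm (w s))\<^sup>2) + (\<epsilon> / L + C * 0) * L / 2"
  proof (intro tendsto_intros)
    have "(\<lambda>n. (1 / 2) * (1 / real (Suc n))) \<longlonglongrightarrow> (1 / 2) * 0"
      using LIMSEQ_inverse_real_of_nat by (intro tendsto_intros) (simp add: divide_inverse)
    then show "(\<lambda>n. 1 / (2 * real n + 2)) \<longlonglongrightarrow> 0"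
      by (simp add: field_simps)
  qed simp_all
  then have "integral {0..L} (\<lambda>s. (norm (v s))\<^sup>2) \<le>
      integral {0..L} (\<lambda>s. (norm (w s))\<^sup>2) + (\<epsilon> / L + C * 0) * L / 2"
    by (rule Lim_bounded2) (use bound in blast)
  then show "integral {0..L} (\<lambda>s. (norm (v s))\<^sup>2) \<le> integral {0..L} (\<lambda>s. (norm (w s))\<^sup>2) + \<epsilon>"
    using L \<open>\<epsilon> > 0\<close> by simp
qed

section \<open>The energy inequality for smooth cut-offs\<close>

lemma scaleC_diff_left: "(c - d) *\<^sub>C x = c *\<^sub>C x - d *\<^sub>C (x::'a::complex_hilbert)"
  using bounded_bilinear.diff_left[OF bounded_bilinear_scaleC] .

lemma right_derivative_quotient:
  fixes \<Phi> :: "real \<Rightarrow> 'a::real_normed_vector"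
  assumes "(\<Phi> has_vector_derivative d) (at 0 within {0..1})"
  shows "((\<lambda>h. (1 / h) *\<^sub>R (\<Phi> h - \<Phi> 0)) \<longlongrightarrow> d) (at_right 0)"
proof -
  have "((\<lambda>h. (1 / norm (h - 0)) *\<^sub>R (\<Phi> h - (\<Phi> 0 + (h - 0) *\<^sub>R d))) \<longlongrightarrow> 0) (at_right 0)"
    using assms unfolding has_vector_derivative_def has_derivative_within
    by (simp add: at_within_Icc_at_right)
  then have "((\<lambda>h. (1 / norm (h - 0)) *\<^sub>R (\<Phi> h - (\<Phi> 0 + (h - 0) *\<^sub>R d)) + d) \<longlongrightarrow> 0 + d) (at_right 0)"
    by (intro tendsto_intros)
  then have "((\<lambda>h. (1 / norm (h - 0)) *\<^sub>R (\<Phi> h - (\<Phi> 0 + (h - 0) *\<^sub>R d)) + d) \<longlongrightarrow> d) (at_right 0)"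
    by simp
  moreover have "\<forall>\<^sub>F h in at_right 0. (1 / norm (h - 0)) *\<^sub>R (\<Phi> h - (\<Phi> 0 + (h - 0) *\<^sub>R d)) + d
      = (1 / h) *\<^sub>R (\<Phi> h - \<Phi> 0)"
    by (rule eventually_at_right_less[THEN eventually_mono])
       (simp add: scaleR_diff_right scaleR_add_right)
  ultimately show ?thesis
    by (rule Lim_transform_eventually)
qed

text \<open>The analytic content of the hypotheses of the theorem: on the open right half plane the resolvent
  exists and is a contraction.\<close>
locale contractive_resolvent =
  fixes S :: "real \<Rightarrow> 'a::complex_hilbert \<Rightarrow> 'a"
  assumes semigroup: "strongly_continuous_semigroup S"
    and resolvent_set: "Re z > 0 \<Longrightarrow> z \<in> resolvent_set (generator_dom S) (generator S)"
    and resolvent_le_1: "Re z > 0 \<Longrightarrow> onorm (resolvent (generator_dom S) (generator S) z) \<le> 1"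
begin

lemma bounded_linear_S: "t \<ge> 0 \<Longrightarrow> bounded_linear (S t)"
  and S_scaleC: "t \<ge> 0 \<Longrightarrow> S t (c *\<^sub>C x) = c *\<^sub>C S t x"
  and S_0: "S 0 x = x"
  and S_add: "s \<ge> 0 \<Longrightarrow> t \<ge> 0 \<Longrightarrow> S (s + t) x = S s (S t x)"
  and continuous_on_S: "continuous_on {0..} (\<lambda>t. S t x)"
  using semigroup unfolding strongly_continuous_semigroup_def bounded_clinear_def by auto

lemma continuous_on_S_Icc: "0 \<le> a \<Longrightarrow> continuous_on {a..b} (\<lambda>t. S t x)"
  by (rule continuous_on_subset[OF continuous_on_S]) auto

text \<open>A smeared orbit lies in the domain of the generator even if \<open>x\<close> does not: \<open>S
  h\<close> translates the orbit, which is the same as translating the weight \<open>p\<close>, and the weight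
  is differentiable.\<close>
lemma generator_smoothed_orbit:
  fixes p p' :: "real \<Rightarrow> complex" and x :: 'a
  assumes L: "L > 0"
    and p: "\<And>s. (p has_vector_derivative p' s) (at s)" and p': "continuous_on UNIV p'"
    and supp: "\<And>s. s \<le> 0 \<or> L \<le> s \<Longrightarrow> p s = 0"
  defines "I \<equiv> integral {0..L} (\<lambda>s. p s *\<^sub>C S s x)"
  shows "((\<lambda>h. (1 / h) *\<^sub>R (S h I - I)) \<longlongrightarrow> - integral {0..L} (\<lambda>s. p' s *\<^sub>C S s x)) (at_right 0)"
proof -
  define F where "F s = S (max s 0) x" for s
  have contF: "continuous_on A F" for A
    unfolding F_def
    by (rule continuous_on_compose2[OF continuous_on_S]) (auto intro!: continuous_intros)
  have contp: "continuous_on A p" for A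
    using p by (meson continuous_at_imp_continuous_on has_vector_derivative_continuous)
  have p'0: "p' s = 0" if "L \<le> s" for s
  proof -
    have "(p has_vector_derivative p' s) (at s within {s..s+1})"
      using p by (rule has_vector_derivative_at_within)
    moreover have "(p has_vector_derivative 0) (at s within {s..s+1})"
      by (rule has_vector_derivative_transform[where f = "\<lambda>_. 0", OF _ _ has_vector_derivative_const])
         (use supp that in auto)
    ultimately show ?thesis
      by (rule vector_derivative_unique_within[rotated])
         (simp add: at_within_Icc_at_right)
  qed
  \<comment> \<open>One interval that contains the support of the translated weight for all \<open>h \<le> 1\<close>.\<close>
  define \<Phi> where "\<Phi> h = integral {0..L+1} (\<lambda>s. p (s - h) *\<^sub>C F s)" for h
  have \<Phi>: "S h I = \<Phi> h" if h: "0 \<le> h" "h \<le> 1" for h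
  proof -
    have int: "(\<lambda>s. p s *\<^sub>C S s x) integrable_on {0..L}"
      by (intro integrable_continuous_real continuous_on_scaleC contp continuous_on_S_Icc) auto
    have "S h I = integral {0..L} (S h \<circ> (\<lambda>s. p s *\<^sub>C S s x))"
      unfolding I_def using integral_linear[OF int bounded_linear_S[OF h(1)]] by simp
    also have "\<dots> = integral {0..L} (\<lambda>s. p s *\<^sub>C F (s + h))"
      using h by (intro integral_cong) (simp add: S_scaleC F_def S_add[symmetric] add.commute)
    also have "\<dots> = integral {h..L+h} (\<lambda>s. p (s - h) *\<^sub>C F s)"
      using integral_shift_real_ivl[of h h "L + h" "\<lambda>s. p (s - h) *\<^sub>C F s"] by simp
    also have "\<dots> = \<Phi> h"
    proof -
      have "((\<lambda>s. p (s - h) *\<^sub>C F s) has_integral integral {h..L+h} (\<lambda>s. p (s - h) *\<^sub>C F s)) {h..L+h}"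
        by (intro integrable_integral integrable_continuous_real continuous_on_scaleC contF
            continuous_on_compose2[OF contp[of UNIV]] continuous_intros) auto
      then have "((\<lambda>s. p (s - h) *\<^sub>C F s) has_integral integral {h..L+h} (\<lambda>s. p (s - h) *\<^sub>C F s)) {0..L+1}"
        by (rule has_integral_on_superset)
           (use h L supp bounded_bilinear.zero_left[OF bounded_bilinear_scaleC] in auto)
      then show ?thesis unfolding \<Phi>_def by (simp add: integral_unique)
    qed
    finally show ?thesis .
  qed
  have "((\<lambda>h. integral (cbox 0 (L+1)) (\<lambda>s. p (s - h) *\<^sub>C F s)) has_vector_derivative
      integral (cbox 0 (L+1)) (\<lambda>s. (- p' (s - 0)) *\<^sub>C F s)) (at 0 within {0..1})"
  proof (rule leibniz_rule_vector_derivative)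
    fix h s :: real assume "h \<in> {0..1}" "s \<in> cbox 0 (L+1)"
    have "((\<lambda>h. p (s - h)) has_vector_derivative (-1) *\<^sub>R p' (s - h)) (at h within {0..1})"
    proof -
      have "((\<lambda>h. s - h) has_vector_derivative -1) (at h within {0..1})"
        unfolding has_real_derivative_iff_has_vector_derivative[symmetric]
        by (auto intro!: derivative_eq_intros)
      from vector_diff_chain_within[OF this has_vector_derivative_at_within[OF p]]
      show ?thesis by (simp add: o_def)
    qed
    then show "((\<lambda>h. p (s - h) *\<^sub>C F s) has_vector_derivative (- p' (s - h)) *\<^sub>C F s) (at h within {0..1})"
      using bounded_linear.has_vector_derivative[OF bounded_bilinear.bounded_linear_left[OF bounded_bilinear_scaleC]]
      by fastforce
  next
    fix h :: real
    show "(\<lambda>s. p (s - h) *\<^sub>C F s) integrable_on cbox 0 (L+1)"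
      by (intro integrable_continuous continuous_on_scaleC contF
            continuous_on_compose2[OF contp[of UNIV]] continuous_intros) auto
  next
    show "continuous_on ({0..1} \<times> cbox 0 (L + 1)) (\<lambda>(h, s). (- p' (s - h)) *\<^sub>C F s)"
      unfolding case_prod_unfold
      by (intro continuous_on_scaleC continuous_on_minus continuous_on_compose2[OF contF[of UNIV]]
            continuous_on_compose2[OF p'] continuous_intros) auto
  qed auto
  then have "(\<Phi> has_vector_derivative integral {0..L+1} (\<lambda>s. (- p' s) *\<^sub>C F s)) (at 0 within {0..1})"
    unfolding \<Phi>_def[abs_def] by simp
  then have "((\<lambda>h. (1 / h) *\<^sub>R (\<Phi> h - \<Phi> 0)) \<longlongrightarrow> integral {0..L+1} (\<lambda>s. (- p' s) *\<^sub>C F s)) (at_right 0)"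
    by (rule right_derivative_quotient)
  moreover have "\<forall>\<^sub>F h in at_right 0. (1 / h) *\<^sub>R (\<Phi> h - \<Phi> 0) = (1 / h) *\<^sub>R (S h I - I)"
  proof -
    have "\<forall>\<^sub>F h in at_right (0::real). h \<in> {0<..<1}"
      by (rule eventually_at_right_real) simp
    then show ?thesis
    proof (rule eventually_mono)
      fix h :: real assume "h \<in> {0<..<1}"
      then show "(1 / h) *\<^sub>R (\<Phi> h - \<Phi> 0) = (1 / h) *\<^sub>R (S h I - I)"
        using \<Phi>[of 0] \<Phi>[of h] S_0[of I] by simp
    qed
  qed
  moreover have "integral {0..L+1} (\<lambda>s. (- p' s) *\<^sub>C F s) = - integral {0..L} (\<lambda>s. p' s *\<^sub>C S s x)"
  proof -
    have "((\<lambda>s. p' s *\<^sub>C F s) has_integral integral {0..L} (\<lambda>s. p' s *\<^sub>C F s)) {0..L}"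
      by (intro integrable_integral integrable_continuous_real continuous_on_scaleC contF
          continuous_on_subset[OF p']) auto
    moreover have "((\<lambda>s. p' s *\<^sub>C F s) has_integral 0) {L..L+1}"
      by (rule has_integral_is_0) (simp add: p'0 bounded_bilinear.zero_left[OF bounded_bilinear_scaleC])
    ultimately have "((\<lambda>s. p' s *\<^sub>C F s) has_integral integral {0..L} (\<lambda>s. p' s *\<^sub>C F s) + 0) {0..L+1}"
      by (rule has_integral_combine[rotated 2]) (use L in auto)
    then have "integral {0..L+1} (\<lambda>s. p' s *\<^sub>C F s) = integral {0..L} (\<lambda>s. p' s *\<^sub>C F s)"
      by (simp add: integral_unique)
    also have "\<dots> = integral {0..L} (\<lambda>s. p' s *\<^sub>C S s x)"
      by (intro integral_cong) (simp add: F_def)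
    finally show ?thesis
      by (simp add: bounded_bilinear.minus_left[OF bounded_bilinear_scaleC])
  qed
  ultimately show ?thesis using Lim_transform_eventually by force
qed

text \<open>The two integrals are related by \<open>(z - A) v = w\<close>: this is
  \<open>generator_smoothed_orbit\<close> for the weight \<open>exp (- z s) \<psi> s\<close>.\<close>
lemma laplace_transform_le:
  fixes \<psi> g :: "real \<Rightarrow> real"
  assumes L: "L > 0" and z: "Re z > 0"
    and \<psi>: "\<And>s. (\<psi> has_real_derivative g s) (at s)" and g: "continuous_on UNIV g"
    and supp: "\<And>s. s \<le> 0 \<or> L \<le> s \<Longrightarrow> \<psi> s = 0"
  shows "norm (integral {0..L} (\<lambda>s. (exp (- z * of_real s) * of_real (\<psi> s)) *\<^sub>C S s x)) \<le>
    norm (integral {0..L} (\<lambda>s. (exp (- z * of_real s) * of_real (g s)) *\<^sub>C S s x))"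
proof -
  define D where "D = generator_dom S"
  define A where "A = generator S"
  define v where "v = integral {0..L} (\<lambda>s. (exp (- z * of_real s) * of_real (\<psi> s)) *\<^sub>C S s x)"
  define w where "w = integral {0..L} (\<lambda>s. (exp (- z * of_real s) * of_real (g s)) *\<^sub>C S s x)"
  define p where "p s = exp (- z * of_real s) * of_real (\<psi> s)" for s
  define p' where "p' s = exp (- z * of_real s) * of_real (g s) - z * p s" for s
  have cont\<psi>: "continuous_on A \<psi>" for A
    by (rule DERIV_continuous_on[OF has_field_derivative_at_within[OF \<psi>]])
  have dp: "(p has_vector_derivative p' s) (at s)" for s
  proof -
    have 1: "((\<lambda>s. exp (- z * of_real s)) has_vector_derivative (- z * exp (- z * of_real s))) (at s)"
      by (rule has_vector_derivative_real_field[of "\<lambda>u. exp (- z * u)"])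
         (auto intro!: derivative_eq_intros)
    have 2: "((\<lambda>s. complex_of_real (\<psi> s)) has_vector_derivative of_real (g s)) (at s)"
      using \<psi>[of s] by (simp add: has_vector_derivative_of_real has_real_derivative_iff_has_vector_derivative)
    show ?thesis
      unfolding p_def[abs_def] p'_def
      by (rule has_vector_derivative_eq_rhs[OF has_vector_derivative_mult[OF 1 2]])
         (simp add: algebra_simps)
  qed
  have contp: "continuous_on A p" for A
    unfolding p_def by (intro continuous_intros cont\<psi>)
  have contp': "continuous_on UNIV p'"
    unfolding p'_def by (intro continuous_intros contp g)
  have lim: "((\<lambda>h. (1 / h) *\<^sub>R (S h v - v)) \<longlongrightarrow> - integral {0..L} (\<lambda>s. p' s *\<^sub>C S s x)) (at_right 0)"
    using generator_smoothed_orbit[OF L dp contp', of x] supp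
    unfolding v_def p_def by auto
  have "integral {0..L} (\<lambda>s. p' s *\<^sub>C S s x) = w - z *\<^sub>C v"
  proof -
    have i: "(\<lambda>s. (exp (- z * of_real s) * of_real (g s)) *\<^sub>C S s x) integrable_on {0..L}"
      "(\<lambda>s. p s *\<^sub>C S s x) integrable_on {0..L}"
      by (intro integrable_continuous_real continuous_on_scaleC continuous_intros contp
          continuous_on_S_Icc continuous_on_subset[OF g]; simp)+
    have "integral {0..L} (\<lambda>s. p' s *\<^sub>C S s x) =
        integral {0..L} (\<lambda>s. (exp (- z * of_real s) * of_real (g s)) *\<^sub>C S s x - z *\<^sub>C (p s *\<^sub>C S s x))"
      by (simp add: p'_def scaleC_diff_left scaleC_scaleC)
    also have "\<dots> = w - integral {0..L} (\<lambda>s. z *\<^sub>C (p s *\<^sub>C S s x))"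
      unfolding w_def
      by (intro integral_diff i
          integrable_linear[OF i(2) bounded_bilinear.bounded_linear_right[OF bounded_bilinear_scaleC], unfolded o_def])
    also have "integral {0..L} (\<lambda>s. z *\<^sub>C (p s *\<^sub>C S s x)) = z *\<^sub>C v"
      using integral_linear[OF i(2) bounded_bilinear.bounded_linear_right[OF bounded_bilinear_scaleC], of z]
      by (simp add: o_def v_def p_def)
    finally show ?thesis .
  qed
  with lim have lim: "((\<lambda>h. (1 / h) *\<^sub>R (S h v - v)) \<longlongrightarrow> z *\<^sub>C v - w) (at_right 0)"
    by simp
  then have vD: "v \<in> D" unfolding D_def generator_dom_def by blast
  have "A v = z *\<^sub>C v - w"
    unfolding A_def generator_def by (rule tendsto_Lim[OF _ lim]) simp
  then have eq: "z *\<^sub>C v - A v = w" by simp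
  have res: "bij_betw (\<lambda>x. z *\<^sub>C x - A x) D UNIV" "bounded_linear (resolvent D A z)"
    using resolvent_set[OF z] unfolding resolvent_set_def D_def A_def bounded_clinear_def by auto
  have "v = resolvent D A z w"
    unfolding resolvent_def eq[symmetric]
    using the_inv_into_f_f[OF bij_betw_imp_inj_on[OF res(1)] vD] by simp
  then have "norm v \<le> onorm (resolvent D A z) * norm w"
    using onorm[OF res(2), of w] by simp
  also have "\<dots> \<le> 1 * norm w"
    unfolding D_def A_def by (intro mult_right_mono resolvent_le_1 z norm_ge_zero)
  finally show ?thesis unfolding v_def w_def by simp
qed

text \<open>The Fourier transform of \<open>exp (- \<gamma> s) \<psi> s S(s) x\<close> is the Laplace transform
  on the line \<open>Re z = \<gamma>\<close>, so the preceding estimate is a comparison of Fourier coefficients.\<close>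
lemma weighted_energy_C1_pos:
  fixes \<psi> g :: "real \<Rightarrow> real"
  assumes L: "L > 0" and \<gamma>: "\<gamma> > 0"
    and \<psi>: "\<And>s. (\<psi> has_real_derivative g s) (at s)" and g: "continuous_on UNIV g"
    and supp: "\<And>s. s \<le> 0 \<or> L \<le> s \<Longrightarrow> \<psi> s = 0"
  shows "integral {0..L} (\<lambda>s. exp (- 2 * \<gamma> * s) * ((\<psi> s)\<^sup>2 - (g s)\<^sup>2) * (norm (S s x))\<^sup>2) \<le> 0"
proof -
  define v where "v h s = complex_of_real (exp (- \<gamma> * s) * h s) *\<^sub>C S s x" for h s
  have cont\<psi>: "continuous_on A \<psi>" for A
    by (rule DERIV_continuous_on[OF has_field_derivative_at_within[OF \<psi>]])
  have contv: "continuous_on {0..L} (v h)" if "continuous_on UNIV h" for h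
    unfolding v_def
    by (intro continuous_on_scaleC continuous_intros continuous_on_S_Icc
        continuous_on_subset[OF that]) auto
  have fourier: "fourier L (v h) \<xi> =
      integral {0..L} (\<lambda>s. (exp (- Complex \<gamma> \<xi> * of_real s) * of_real (h s)) *\<^sub>C S s x)" for h \<xi>
  proof -
    have "cis (- (\<xi> * s)) * complex_of_real (exp (- \<gamma> * s) * h s) =
        exp (- Complex \<gamma> \<xi> * of_real s) * of_real (h s)" for s
    proof -
      have "- Complex \<gamma> \<xi> * of_real s = of_real (- \<gamma> * s) + \<i> * of_real (- (\<xi> * s))"
        by (simp add: complex_eq_iff)
      then have "exp (- Complex \<gamma> \<xi> * of_real s) = of_real (exp (- \<gamma> * s)) * cis (- (\<xi> * s))"
        by (simp only: exp_add cis_conv_exp exp_of_real)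
      then show ?thesis by simp
    qed
    then show ?thesis unfolding fourier_def v_def scaleC_scaleC by (simp only:)
  qed
  have "integral {0..L} (\<lambda>s. (norm (v \<psi> s))\<^sup>2) \<le> integral {0..L} (\<lambda>s. (norm (v g s))\<^sup>2)"
  proof (rule integral_norm_square_le_of_fourier[OF L contv[OF cont\<psi>] contv[OF g]])
    show "v \<psi> 0 = v \<psi> L" using supp[of 0] supp[of L]
      by (simp add: v_def bounded_bilinear.zero_left[OF bounded_bilinear_scaleC])
    show "norm (fourier L (v \<psi>) \<xi>) \<le> norm (fourier L (v g) \<xi>)" for \<xi>
      unfolding fourier using \<gamma> by (intro laplace_transform_le L \<psi> g supp) auto
  qed
  moreover have n: "(norm (v h s))\<^sup>2 = exp (- 2 * \<gamma> * s) * (h s)\<^sup>2 * (norm (S s x))\<^sup>2" for h s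
    unfolding v_def norm_scaleC norm_of_real
    by (simp add: power_mult_distrib abs_mult exp_double[symmetric] mult.assoc)
  moreover have "integral {0..L} (\<lambda>s. exp (- 2 * \<gamma> * s) * ((\<psi> s)\<^sup>2 - (g s)\<^sup>2) * (norm (S s x))\<^sup>2) =
      integral {0..L} (\<lambda>s. (norm (v \<psi> s))\<^sup>2) - integral {0..L} (\<lambda>s. (norm (v g s))\<^sup>2)"
  proof (subst integral_diff[symmetric])
    show "(\<lambda>s. (norm (v \<psi> s))\<^sup>2) integrable_on {0..L}" "(\<lambda>s. (norm (v g s))\<^sup>2) integrable_on {0..L}"
      by (intro integrable_continuous_real continuous_intros contv g cont\<psi>)+
  qed (simp add: n algebra_simps)
  ultimately show ?thesis by linarith
qed

text \<open>The case \<open>\<gamma> = 0\<close> follows by continuity in \<open>\<gamma>\<close>, as the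
  integral extends over a bounded interval.\<close>
lemma weighted_energy_C1:
  fixes \<psi> g :: "real \<Rightarrow> real"
  assumes L: "L > 0" and \<gamma>: "\<gamma> \<ge> 0"
    and \<psi>: "\<And>s. (\<psi> has_real_derivative g s) (at s)" and g: "continuous_on UNIV g"
    and supp: "\<And>s. s \<le> 0 \<or> L \<le> s \<Longrightarrow> \<psi> s = 0"
  shows "integral {0..L} (\<lambda>s. exp (- 2 * \<gamma> * s) * ((\<psi> s)\<^sup>2 - (g s)\<^sup>2) * (norm (S s x))\<^sup>2) \<le> 0"
proof -
  have cont\<psi>: "continuous_on A \<psi>" for A
    by (rule DERIV_continuous_on[OF has_field_derivative_at_within[OF \<psi>]])
  define J where "J \<mu> = integral (cbox 0 L) (\<lambda>s. exp (- 2 * \<mu> * s) * ((\<psi> s)\<^sup>2 - (g s)\<^sup>2) * (norm (S s x))\<^sup>2)" for \<mu>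
  have "continuous_on UNIV J"
    unfolding J_def
    by (intro integral_continuous_on_param, unfold case_prod_unfold,
        intro continuous_intros continuous_on_compose2[OF cont\<psi>[of UNIV]]
          continuous_on_compose2[OF g] continuous_on_compose2[OF continuous_on_S[of x]]) auto
  then have "(J \<longlongrightarrow> J \<gamma>) (at_right \<gamma>)"
    by (metis UNIV_I continuous_on_def tendsto_within_subset subset_UNIV)
  moreover have "\<forall>\<^sub>F \<mu> in at_right \<gamma>. J \<mu> \<le> 0"
    using eventually_at_right_less
    by (rule eventually_mono)
       (use \<gamma> weighted_energy_C1_pos[OF L _ \<psi> g supp] in \<open>auto simp: J_def\<close>)
  ultimately have "J \<gamma> \<le> 0"
    by (intro tendsto_upperbound[of J _ "at_right \<gamma>"]) auto
  then show ?thesis by (simp add: J_def)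
qed

end

section \<open>Square integrable functions as limits of continuous functions\<close>

text \<open>A measurable function is almost everywhere a limit of continuous functions. Clipping these to the
  bound of \<open>g\<close> and multiplying by plateau functions allows dominated convergence and produces the
  support condition.\<close>
lemma continuous_L2_dense_bounded:
  fixes g :: "real \<Rightarrow> real"
  assumes L: "L > 0" and g: "g \<in> borel_measurable (lebesgue_on {0..L})"
    and bd: "\<And>x. x \<in> {0..L} \<Longrightarrow> \<bar>g x\<bar> \<le> K" and \<epsilon>: "\<epsilon> > 0"
  shows "\<exists>h. continuous_on UNIV h \<and> (\<forall>x. x \<le> 0 \<or> L \<le> x \<longrightarrow> h x = 0) \<and>
    integral {0..L} (\<lambda>x. (h x - g x)\<^sup>2) < \<epsilon>"
proof -
  have "K \<ge> 0" using bd[of 0] L by auto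
  have "g measurable_on {0..L}"
    using g by (simp add: measurable_on_iff_borel_measurable)
  then obtain N f where N: "negligible N" and f: "\<forall>n::nat. continuous_on UNIV (f n)"
    and lim: "\<forall>x. x \<notin> N \<longrightarrow> (\<lambda>n. f n x) \<longlonglongrightarrow> (if x \<in> {0..L} then g x else 0)"
    unfolding measurable_on_def by (elim exE conjE)
  define \<rho> where "\<rho> n x = min 1 (real n * max 0 (min x (L - x)))" for n x
  define h where "h n x = max (- K) (min K (f n x)) * \<rho> n x" for n x
  have conth: "continuous_on UNIV (h n)" for n
    unfolding h_def \<rho>_def by (intro continuous_intros f[rule_format])
  have supp: "h n x = 0" if "x \<le> 0 \<or> L \<le> x" for n x
    using that by (auto simp: h_def \<rho>_def)
  have \<rho>01: "0 \<le> \<rho> n x" "\<rho> n x \<le> 1" for n x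
    by (auto simp: \<rho>_def)
  have hK: "\<bar>h n x\<bar> \<le> K" for n x
  proof -
    have "\<bar>h n x\<bar> \<le> K * 1"
      unfolding h_def abs_mult using \<rho>01[of n x] \<open>K \<ge> 0\<close> by (intro mult_mono) auto
    then show ?thesis by simp
  qed
  have limh: "(\<lambda>n. h n x) \<longlonglongrightarrow> g x" if "x \<in> {0..L}" "x \<notin> N \<union> {0, L}" for x
  proof -
    define d where "d = min x (L - x)"
    have "d > 0" using that by (auto simp: d_def)
    have "\<forall>\<^sub>F n in sequentially. \<rho> n x = 1"
    proof -
      obtain n0 :: nat where "1 / d < real n0" using reals_Archimedean2 by blast
      then show ?thesis
      proof (intro eventually_sequentiallyI[of n0])
        fix n assume "n0 \<le> n"
        then have "1 / d \<le> real n" using \<open>1 / d < real n0\<close> by linarith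
        then have "1 \<le> real n * d" using \<open>d > 0\<close> by (simp add: field_simps)
        then show "\<rho> n x = 1" using \<open>d > 0\<close> by (simp add: \<rho>_def d_def[symmetric])
      qed
    qed
    then have "(\<lambda>n. \<rho> n x) \<longlonglongrightarrow> 1" by (rule tendsto_eventually)
    moreover have "(\<lambda>n. f n x) \<longlonglongrightarrow> g x" using lim[rule_format, of x] that by auto
    ultimately have "(\<lambda>n. h n x) \<longlonglongrightarrow> max (- K) (min K (g x)) * 1"
      unfolding h_def by (intro tendsto_intros)
    then show ?thesis using bd[OF that(1)] by (simp add: min_def max_def split: if_splits)
  qed
  define q where "q n x = (if x \<in> N \<union> {0, L} then 0 else (h n x - g x)\<^sup>2)" for n x
  have neg: "negligible (N \<union> {0, L})" using N by (auto intro!: negligible_insert[THEN iffD2])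
  have int: "(\<lambda>x. (h n x - g x)\<^sup>2) integrable_on {0..L}" for n
  proof (rule measurable_bounded_by_integrable_imp_integrable[where g = "\<lambda>_. (2 * K)\<^sup>2"])
    have "h n \<in> borel_measurable (lebesgue_on {0..L})"
      by (intro continuous_imp_measurable_on_sets_lebesgue continuous_on_subset[OF conth]) auto
    then show "(\<lambda>x. (h n x - g x)\<^sup>2) \<in> borel_measurable (lebesgue_on {0..L})"
      using g by (intro borel_measurable_power borel_measurable_diff)
    fix x assume "x \<in> {0..L}"
    then have "\<bar>h n x - g x\<bar> \<le> 2 * K" using hK[of n x] bd[of x] by linarith
    then have "\<bar>h n x - g x\<bar>\<^sup>2 \<le> (2 * K)\<^sup>2" by (intro power_mono) auto
    then show "norm ((h n x - g x)\<^sup>2) \<le> (2 * K)\<^sup>2" by simp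
  qed auto
  have q_int: "q n integrable_on {0..L}" for n
    by (rule integrable_spike[OF int[of n] neg]) (auto simp: q_def)
  have "(\<lambda>n. integral {0..L} (q n)) \<longlonglongrightarrow> integral {0..L} (\<lambda>_. 0)"
  proof (rule dominated_convergence(2)[where h = "\<lambda>_. (2 * K)\<^sup>2"])
    show "q n integrable_on {0..L}" for n by (rule q_int)
    fix n x assume x: "x \<in> {0..L}"
    then have "\<bar>h n x - g x\<bar> \<le> 2 * K" using hK[of n x] bd[of x] by linarith
    then have "\<bar>h n x - g x\<bar>\<^sup>2 \<le> (2 * K)\<^sup>2" by (intro power_mono) auto
    then show "norm (q n x) \<le> (2 * K)\<^sup>2" by (simp add: q_def)
  next
    fix x assume x: "x \<in> {0..L}"
    show "(\<lambda>n. q n x) \<longlonglongrightarrow> 0"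
    proof (cases "x \<in> N \<union> {0, L}")
      case False
      then have "(\<lambda>n. (h n x - g x)\<^sup>2) \<longlonglongrightarrow> (g x - g x)\<^sup>2"
        by (intro tendsto_intros limh x)
      then show ?thesis using False by (simp add: q_def)
    qed (simp add: q_def)
  qed auto
  then have "\<forall>\<^sub>F n in sequentially. integral {0..L} (q n) < \<epsilon>"
    using \<epsilon> by (intro order_tendstoD) auto
  then obtain n where "integral {0..L} (q n) < \<epsilon>"
    by (auto dest: eventually_happens'[OF sequentially_bot])
  moreover have "integral {0..L} (q n) = integral {0..L} (\<lambda>x. (h n x - g x)\<^sup>2)"
    by (rule integral_spike[OF neg]) (auto simp: q_def)
  ultimately show ?thesis using conth supp by metis
qed

lemma square_integrable_imp_integrable_mult:
  fixes f g :: "real \<Rightarrow> real"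
  assumes "f \<in> borel_measurable (lebesgue_on {a..b})" "g \<in> borel_measurable (lebesgue_on {a..b})"
    and "(\<lambda>x. (f x)\<^sup>2) integrable_on {a..b}" "(\<lambda>x. (g x)\<^sup>2) integrable_on {a..b}"
  shows "(\<lambda>x. f x * g x) integrable_on {a..b}"
proof (rule measurable_bounded_by_integrable_imp_integrable[where g = "\<lambda>x. (f x)\<^sup>2 + (g x)\<^sup>2"])
  show "(\<lambda>x. f x * g x) \<in> borel_measurable (lebesgue_on {a..b})"
    using assms by (intro borel_measurable_times)
  show "(\<lambda>x. (f x)\<^sup>2 + (g x)\<^sup>2) integrable_on {a..b}"
    using assms by (intro integrable_add)
  fix x
  have "2 * (\<bar>f x\<bar> * \<bar>g x\<bar>) \<le> (f x)\<^sup>2 + (g x)\<^sup>2"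
    using sum_squares_bound[of "\<bar>f x\<bar>" "\<bar>g x\<bar>"] by (simp add: mult.assoc)
  moreover have "0 \<le> \<bar>f x\<bar> * \<bar>g x\<bar>" by simp
  ultimately have "\<bar>f x\<bar> * \<bar>g x\<bar> \<le> (f x)\<^sup>2 + (g x)\<^sup>2" by linarith
  then show "norm (f x * g x) \<le> (f x)\<^sup>2 + (g x)\<^sup>2" by (simp add: abs_mult)
qed auto

lemma square_integrable_diff:
  fixes f g :: "real \<Rightarrow> real"
  assumes "f \<in> borel_measurable (lebesgue_on {a..b})" "g \<in> borel_measurable (lebesgue_on {a..b})"
    and "(\<lambda>x. (f x)\<^sup>2) integrable_on {a..b}" "(\<lambda>x. (g x)\<^sup>2) integrable_on {a..b}"
  shows "(\<lambda>x. (f x - g x)\<^sup>2) integrable_on {a..b}"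
proof -
  have "(\<lambda>x. (f x - g x)\<^sup>2) = (\<lambda>x. (f x)\<^sup>2 + (g x)\<^sup>2 - 2 * (f x * g x))"
    by (simp add: fun_eq_iff power2_eq_square algebra_simps)
  then show ?thesis
    by (simp only:) (intro integrable_diff integrable_add integrable_on_mult_right
        square_integrable_imp_integrable_mult assms)
qed

lemma square_integral_sum_le:
  fixes f g :: "real \<Rightarrow> real"
  assumes "(\<lambda>x. (f x - g x)\<^sup>2) integrable_on {a..b}" "(\<lambda>x. (g x - h x)\<^sup>2) integrable_on {a..b}"
    "(\<lambda>x. (f x - h x)\<^sup>2) integrable_on {a..b}"
  shows "integral {a..b} (\<lambda>x. (f x - h x)\<^sup>2) \<le>
    2 * integral {a..b} (\<lambda>x. (f x - g x)\<^sup>2) + 2 * integral {a..b} (\<lambda>x. (g x - h x)\<^sup>2)"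
proof -
  have "integral {a..b} (\<lambda>x. (f x - h x)\<^sup>2) \<le>
      integral {a..b} (\<lambda>x. 2 * (f x - g x)\<^sup>2 + 2 * (g x - h x)\<^sup>2)"
  proof (rule integral_le)
    fix x
    have "0 \<le> ((f x - g x) - (g x - h x))\<^sup>2" by simp
    then show "(f x - h x)\<^sup>2 \<le> 2 * (f x - g x)\<^sup>2 + 2 * (g x - h x)\<^sup>2"
      by (simp add: power2_eq_square algebra_simps)
  qed (intro assms integrable_add integrable_on_mult_right)+
  also have "\<dots> = 2 * integral {a..b} (\<lambda>x. (f x - g x)\<^sup>2) + 2 * integral {a..b} (\<lambda>x. (g x - h x)\<^sup>2)"
    by (subst integral_add) (auto intro!: assms integrable_on_mult_right)
  finally show ?thesis .
qed

text \<open>The variance of \<open>f\<close> is nonnegative.\<close>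
lemma square_integral_le_integral_square:
  fixes f :: "real \<Rightarrow> real"
  assumes L: "a < b" and f: "f integrable_on {a..b}" "(\<lambda>x. (f x)\<^sup>2) integrable_on {a..b}"
  shows "(integral {a..b} f)\<^sup>2 \<le> (b - a) * integral {a..b} (\<lambda>x. (f x)\<^sup>2)"
proof -
  define m where "m = integral {a..b} f / (b - a)"
  have "0 \<le> integral {a..b} (\<lambda>x. (f x)\<^sup>2 - 2 * m * f x + m\<^sup>2)"
  proof (rule integral_nonneg)
    fix x show "0 \<le> (f x)\<^sup>2 - 2 * m * f x + m\<^sup>2"
      using zero_le_power2[of "f x - m"] by (simp add: power2_eq_square algebra_simps)
  qed (intro integrable_add integrable_diff f integrable_on_mult_right integrable_const_ivl)
  also have "\<dots> = integral {a..b} (\<lambda>x. (f x)\<^sup>2) - 2 * m * integral {a..b} f + m\<^sup>2 * (b - a)"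
    using L integral_add[OF integrable_diff[OF f(2) integrable_on_mult_right[OF f(1), of "2 * m"]]
        integrable_const_ivl[of "m\<^sup>2" a b]]
      integral_diff[OF f(2) integrable_on_mult_right[OF f(1), of "2 * m"]]
    by simp
  also have "\<dots> = integral {a..b} (\<lambda>x. (f x)\<^sup>2) - (integral {a..b} f)\<^sup>2 / (b - a)"
  proof -
    have "2 * (X / d) * X - (X / d)\<^sup>2 * d = X\<^sup>2 / d" if "d \<noteq> 0" for X d :: real
      using that by (simp add: power2_eq_square)
    from this[of "b - a" "integral {a..b} f"] show ?thesis using L unfolding m_def by simp
  qed
  finally show ?thesis using L by (simp add: field_simps)
qed

text \<open>Truncation reduces the claim to bounded functions.\<close>
lemma continuous_L2_dense:
  fixes g :: "real \<Rightarrow> real"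
  assumes L: "L > 0" and g: "g \<in> borel_measurable (lebesgue_on {0..L})"
    and g2: "(\<lambda>x. (g x)\<^sup>2) integrable_on {0..L}" and \<epsilon>: "\<epsilon> > 0"
  shows "\<exists>h. continuous_on UNIV h \<and> (\<forall>x. x \<le> 0 \<or> L \<le> x \<longrightarrow> h x = 0) \<and>
    integral {0..L} (\<lambda>x. (h x - g x)\<^sup>2) < \<epsilon>"
proof -
  define c where "c n x = max (- real n) (min (real n) (g x))" for n x
  have cm: "c n \<in> borel_measurable (lebesgue_on {0..L})" for n
    unfolding c_def using g by (intro borel_measurable_max borel_measurable_min borel_measurable_const)
  have le: "(c n x)\<^sup>2 \<le> (g x)\<^sup>2" "(c n x - g x)\<^sup>2 \<le> (g x)\<^sup>2" for n x
    unfolding c_def by (auto simp: abs_le_square_iff[symmetric] min_def max_def)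
  have c2: "(\<lambda>x. (c n x)\<^sup>2) integrable_on {0..L}" for n
    by (rule measurable_bounded_by_integrable_imp_integrable[OF _ g2])
       (use cm le in \<open>auto intro!: borel_measurable_power\<close>)
  have cg2: "(\<lambda>x. (c n x - g x)\<^sup>2) integrable_on {0..L}" for n
    by (intro square_integrable_diff cm g c2 g2)
  have "(\<lambda>n. integral {0..L} (\<lambda>x. (c n x - g x)\<^sup>2)) \<longlonglongrightarrow> integral {0..L} (\<lambda>_. 0)"
  proof (rule dominated_convergence(2)[OF cg2 g2])
    show "norm ((c n x - g x)\<^sup>2) \<le> (g x)\<^sup>2" for n x using le by simp
    fix x
    have "\<forall>\<^sub>F n in sequentially. (c n x - g x)\<^sup>2 = 0"
    proof -
      obtain n0 :: nat where "\<bar>g x\<bar> < real n0" using reals_Archimedean2 by blast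
      then show ?thesis
        by (intro eventually_sequentiallyI[of n0]) (auto simp: c_def min_def max_def)
    qed
    then show "(\<lambda>n. (c n x - g x)\<^sup>2) \<longlonglongrightarrow> 0" by (rule tendsto_eventually)
  qed
  then have "\<forall>\<^sub>F n in sequentially. integral {0..L} (\<lambda>x. (c n x - g x)\<^sup>2) < \<epsilon> / 4"
    using \<epsilon> by (intro order_tendstoD) auto
  then obtain n where n: "integral {0..L} (\<lambda>x. (c n x - g x)\<^sup>2) < \<epsilon> / 4"
    by (auto dest: eventually_happens'[OF sequentially_bot])
  obtain h where h: "continuous_on UNIV h" "\<forall>x. x \<le> 0 \<or> L \<le> x \<longrightarrow> h x = 0"
      "integral {0..L} (\<lambda>x. (h x - c n x)\<^sup>2) < \<epsilon> / 4"
  proof -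
    have "\<bar>c n x\<bar> \<le> real n" for x by (auto simp: c_def)
    then have "\<exists>h. continuous_on UNIV h \<and> (\<forall>x. x \<le> 0 \<or> L \<le> x \<longrightarrow> h x = 0) \<and>
        integral {0..L} (\<lambda>x. (h x - c n x)\<^sup>2) < \<epsilon> / 4"
      using \<epsilon> by (intro continuous_L2_dense_bounded[OF L cm[of n]]) auto
    then show ?thesis using that by (elim exE conjE)
  qed
  have hm: "h \<in> borel_measurable (lebesgue_on {0..L})"
    by (intro continuous_imp_measurable_on_sets_lebesgue continuous_on_subset[OF h(1)]) auto
  have h2: "(\<lambda>x. (h x)\<^sup>2) integrable_on {0..L}"
    by (intro integrable_continuous_real continuous_intros continuous_on_subset[OF h(1)]) auto
  have "integral {0..L} (\<lambda>x. (h x - g x)\<^sup>2) < \<epsilon>"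
    using square_integral_sum_le[of h "c n" 0 L g] n h(3)
      square_integrable_diff[OF hm cm[of n] h2 c2] cg2[of n] square_integrable_diff[OF hm g h2 g2]
    by linarith
  then show ?thesis using h by blast
qed

text \<open>The mean of the approximation is small because the mean of \<open>g\<close> is zero; subtracting a
  small multiple of a fixed bump makes it vanish exactly.\<close>
lemma continuous_L2_dense_mean_zero:
  fixes g :: "real \<Rightarrow> real"
  assumes L: "L > 0" and g: "g integrable_on {0..L}"
    and g2: "(\<lambda>x. (g x)\<^sup>2) integrable_on {0..L}" and mean: "integral {0..L} g = 0" and \<epsilon>: "\<epsilon> > 0"
  shows "\<exists>h. continuous_on UNIV h \<and> (\<forall>x. x \<le> 0 \<or> L \<le> x \<longrightarrow> h x = 0) \<and> integral {0..L} h = 0 \<and>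
    integral {0..L} (\<lambda>x. (h x - g x)\<^sup>2) < \<epsilon>"
proof -
  \<comment> \<open>A continuous bump with the required support.\<close>
  define B where "B x = max 0 (x * (L - x))" for x
  have contB: "continuous_on A B" for A unfolding B_def by (intro continuous_intros)
  have B0: "B x = 0" if "x \<le> 0 \<or> L \<le> x" for x
    using that L by (auto simp: B_def max_def mult_le_0_iff zero_le_mult_iff)
  define I where "I = integral {0..L} B"
  have "I > 0"
    unfolding I_def
    by (rule integral_pos_continuous[of _ _ _ "L / 2"]) (use L contB in \<open>auto simp: B_def\<close>)
  define Q where "Q = integral {0..L} (\<lambda>x. (B x)\<^sup>2)"
  have "Q \<ge> 0" unfolding Q_def
    by (intro integral_nonneg integrable_continuous_real continuous_intros contB) auto
  define \<delta> where "\<delta> = \<epsilon> / (2 + 2 * L * Q / I\<^sup>2)"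
  have den: "2 + 2 * L * Q / I\<^sup>2 > 0" using L \<open>Q \<ge> 0\<close> \<open>I > 0\<close> by (smt (verit) divide_nonneg_nonneg mult_nonneg_nonneg zero_le_power2)
  then have "\<delta> > 0" using \<epsilon> by (simp add: \<delta>_def)
  have gm: "g \<in> borel_measurable (lebesgue_on {0..L})" using g by (rule integrable_imp_measurable)
  obtain h where h: "continuous_on UNIV h" "\<forall>x. x \<le> 0 \<or> L \<le> x \<longrightarrow> h x = 0"
      "integral {0..L} (\<lambda>x. (h x - g x)\<^sup>2) < \<delta>"
    using continuous_L2_dense[OF L gm g2 \<open>\<delta> > 0\<close>] by auto
  have conth: "continuous_on A h" for A using h(1) continuous_on_subset by blast
  have meas: "u \<in> borel_measurable (lebesgue_on {0..L})" if "continuous_on {0..L} u" for u :: "real \<Rightarrow> real"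
    using that by (intro continuous_imp_measurable_on_sets_lebesgue) auto
  have sq: "(\<lambda>x. (u x)\<^sup>2) integrable_on {0..L}" if "continuous_on {0..L} u" for u :: "real \<Rightarrow> real"
    using that by (intro integrable_continuous_real continuous_intros) auto
  define c where "c = integral {0..L} h / I"
  define k where "k x = h x - c * B x" for x
  have contk: "continuous_on A k" for A unfolding k_def by (intro continuous_intros conth contB)
  have "integral {0..L} h = integral {0..L} (\<lambda>x. h x - g x)"
    by (subst integral_diff) (auto intro!: integrable_continuous_real conth g simp: mean)
  then have "(integral {0..L} h)\<^sup>2 \<le> L * integral {0..L} (\<lambda>x. (h x - g x)\<^sup>2)"
    using square_integral_le_integral_square[of 0 L "\<lambda>x. h x - g x"] L
      square_integrable_diff[OF meas[OF conth] gm sq[OF conth] g2]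
      integrable_diff[OF integrable_continuous_real[OF conth] g]
    by simp
  also have "\<dots> \<le> L * \<delta>" using h(3) L by (intro mult_left_mono) auto
  finally have hh: "(integral {0..L} h)\<^sup>2 \<le> L * \<delta>" .
  have c2: "c\<^sup>2 \<le> L * \<delta> / I\<^sup>2"
    unfolding c_def power_divide by (intro divide_right_mono hh) auto
  have "integral {0..L} k = 0"
  proof -
    have "integral {0..L} k = integral {0..L} h - c * I"
      unfolding k_def I_def
      by (subst integral_diff) (auto intro!: integrable_continuous_real continuous_intros conth contB)
    then show ?thesis using \<open>I > 0\<close> by (simp add: c_def)
  qed
  moreover have "integral {0..L} (\<lambda>x. (k x - g x)\<^sup>2) < \<epsilon>"
  proof -
    have "integral {0..L} (\<lambda>x. (k x - g x)\<^sup>2) \<le>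
        2 * integral {0..L} (\<lambda>x. (k x - h x)\<^sup>2) + 2 * integral {0..L} (\<lambda>x. (h x - g x)\<^sup>2)"
      by (intro square_integral_sum_le square_integrable_diff meas sq conth contk gm g2)
    also have "integral {0..L} (\<lambda>x. (k x - h x)\<^sup>2) = c\<^sup>2 * Q"
      unfolding k_def Q_def by (simp add: power_mult_distrib)
    also have "2 * (c\<^sup>2 * Q) + 2 * integral {0..L} (\<lambda>x. (h x - g x)\<^sup>2) < 2 * (L * \<delta> / I\<^sup>2 * Q) + 2 * \<delta>"
      using h(3) mult_right_mono[OF c2 \<open>Q \<ge> 0\<close>] by linarith
    also have "\<dots> = \<delta> * (2 + 2 * L * Q / I\<^sup>2)" by (simp add: algebra_simps)
    also have "\<dots> = \<epsilon>" using den by (simp add: \<delta>_def)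
    finally show ?thesis .
  qed
  moreover have "\<forall>x. x \<le> 0 \<or> L \<le> x \<longrightarrow> k x = 0" using h(2) B0 by (simp add: k_def)
  ultimately show ?thesis using contk by blast
qed

section \<open>The energy inequality for cut-offs with square integrable slope\<close>

text \<open>Sobolev functions of one variable, described as primitives of square integrable functions. In this
  form gluing and reflecting them is additivity and substitution for integrals.\<close>
definition L2_derivative :: "real \<Rightarrow> real \<Rightarrow> (real \<Rightarrow> real) \<Rightarrow> (real \<Rightarrow> real) \<Rightarrow> bool"
  where "L2_derivative p q \<psi> g \<longleftrightarrow>
    (\<forall>x y. p \<le> x \<longrightarrow> x \<le> y \<longrightarrow> y \<le> q \<longrightarrow> (g has_integral (\<psi> y - \<psi> x)) {x..y}) \<and>
    (\<lambda>s. (g s)\<^sup>2) integrable_on {p..q}"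

lemma L2_derivativeD:
  assumes "L2_derivative p q \<psi> g"
  shows "p \<le> x \<Longrightarrow> x \<le> y \<Longrightarrow> y \<le> q \<Longrightarrow> (g has_integral (\<psi> y - \<psi> x)) {x..y}"
    and "(\<lambda>s. (g s)\<^sup>2) integrable_on {p..q}"
  using assms unfolding L2_derivative_def by auto

lemma L2_derivative_integrable:
  assumes "L2_derivative p q \<psi> g"
  shows "g integrable_on {p..q}"
proof (cases "p \<le> q")
  case True
  then show ?thesis using L2_derivativeD(1)[OF assms, of p q] by auto
qed auto

lemma L2_derivative_continuous:
  assumes "L2_derivative p q \<psi> g"
  shows "continuous_on {p..q} \<psi>"
proof -
  have eq: "\<psi> p + integral {p..y} g = \<psi> y" if "y \<in> {p..q}" for y
    using integral_unique[OF L2_derivativeD(1)[OF assms, of p y]] that by simp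
  have "continuous_on {p..q} (\<lambda>y. \<psi> p + integral {p..y} g)"
    by (intro continuous_on_add continuous_on_const indefinite_integral_continuous_1
        L2_derivative_integrable[OF assms])
  then show ?thesis by (rule continuous_on_eq) (rule eq)
qed

lemma L2_derivative_spike:
  assumes "L2_derivative p q \<psi> g" and N: "negligible N"
    and g: "\<And>x. x \<in> {p..q} - N \<Longrightarrow> g' x = g x"
  shows "L2_derivative p q \<psi> g'"
  unfolding L2_derivative_def
proof (intro conjI allI impI)
  fix x y assume "p \<le> x" "x \<le> y" "y \<le> q"
  then show "(g' has_integral (\<psi> y - \<psi> x)) {x..y}"
    by (intro has_integral_spike[OF N _ L2_derivativeD(1)[OF assms(1)]] g) auto
next
  show "(\<lambda>s. (g' s)\<^sup>2) integrable_on {p..q}"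
    by (rule integrable_spike[OF L2_derivativeD(2)[OF assms(1)] N]) (use g in auto)
qed

lemma L2_derivative_cong:
  assumes "L2_derivative p q \<psi> g"
    and \<psi>: "\<And>x. x \<in> {p..q} \<Longrightarrow> \<psi>' x = \<psi> x" and g: "\<And>x. x \<in> {p<..<q} \<Longrightarrow> g' x = g x"
  shows "L2_derivative p q \<psi>' g'"
proof -
  have "L2_derivative p q \<psi> g'"
    by (rule L2_derivative_spike[OF assms(1), of "{p, q}"]) (use g in auto)
  then show ?thesis unfolding L2_derivative_def by (simp add: \<psi>)
qed

lemma L2_derivative_combine:
  assumes 1: "L2_derivative p q \<psi> g" and 2: "L2_derivative q r \<psi> g" and pqr: "p \<le> q" "q \<le> r"
  shows "L2_derivative p r \<psi> g"
  unfolding L2_derivative_def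
proof (intro conjI allI impI)
  fix x y assume xy: "p \<le> x" "x \<le> y" "y \<le> r"
  consider "y \<le> q" | "q \<le> x" | "x \<le> q" "q \<le> y" by linarith
  then show "(g has_integral (\<psi> y - \<psi> x)) {x..y}"
  proof cases
    case 3
    then have "(g has_integral ((\<psi> q - \<psi> x) + (\<psi> y - \<psi> q))) {x..y}"
      using xy by (intro has_integral_combine[OF 3] L2_derivativeD(1)[OF 1] L2_derivativeD(1)[OF 2]) auto
    then show ?thesis by simp
  qed (use xy L2_derivativeD(1)[OF 1] L2_derivativeD(1)[OF 2] in auto)
next
  show "(\<lambda>s. (g s)\<^sup>2) integrable_on {p..r}"
    using L2_derivativeD(2)[OF 1] L2_derivativeD(2)[OF 2] pqr
    by (rule integrable_split[rotated 2])
qed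

lemma L2_derivative_C1:
  assumes d: "\<And>x. x \<in> {p..q} \<Longrightarrow> (\<psi> has_real_derivative g x) (at x within {p..q})"
    and g: "continuous_on {p..q} g"
  shows "L2_derivative p q \<psi> g"
  unfolding L2_derivative_def
proof (intro conjI allI impI)
  fix x y assume xy: "p \<le> x" "x \<le> y" "y \<le> q"
  show "(g has_integral (\<psi> y - \<psi> x)) {x..y}"
  proof (rule fundamental_theorem_of_calculus[OF xy(2)])
    fix s assume "s \<in> {x..y}"
    then have "(\<psi> has_real_derivative g s) (at s within {x..y})"
      using d[of s] xy by (auto intro: DERIV_subset)
    then show "(\<psi> has_vector_derivative g s) (at s within {x..y})"
      by (simp add: has_real_derivative_iff_has_vector_derivative)
  qed
next
  show "(\<lambda>s. (g s)\<^sup>2) integrable_on {p..q}"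
    by (intro integrable_continuous_real continuous_intros g)
qed

lemma has_integral_reflect_about:
  fixes f :: "real \<Rightarrow> real"
  assumes "(f has_integral I) {x..y}"
  shows "((\<lambda>s. f (t - s)) has_integral I) {t - y..t - x}"
proof -
  have "((\<lambda>s. f (- s)) has_integral I) {- y..- x}"
    using assms by simp
  from has_integral_shift_real_ivl[OF this, of "- t"] show ?thesis by simp
qed

lemma L2_derivative_scaled_reflection:
  assumes "L2_derivative 0 b \<theta> \<theta>'"
  shows "L2_derivative (t - b) t (\<lambda>s. c * \<theta> (t - s)) (\<lambda>s. - c * \<theta>' (t - s))"
  unfolding L2_derivative_def
proof (intro conjI allI impI)
  fix x y assume xy: "t - b \<le> x" "x \<le> y" "y \<le> t"
  then have "(\<theta>' has_integral (\<theta> (t - x) - \<theta> (t - y))) {t - y..t - x}"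
    by (intro L2_derivativeD(1)[OF assms]) auto
  from has_integral_mult_right[OF has_integral_reflect_about[OF this, of t], of "- c"]
  show "((\<lambda>s. - c * \<theta>' (t - s)) has_integral c * \<theta> (t - y) - c * \<theta> (t - x)) {x..y}"
    by (simp add: algebra_simps)
next
  have "((\<lambda>s. (\<theta>' s)\<^sup>2) has_integral integral {0..b} (\<lambda>s. (\<theta>' s)\<^sup>2)) {0..b}"
    using L2_derivativeD(2)[OF assms] by (rule integrable_integral)
  from has_integral_mult_right[OF has_integral_reflect_about[OF this, of t], of "c\<^sup>2"]
  show "(\<lambda>s. (- c * \<theta>' (t - s))\<^sup>2) integrable_on {t - b..t}"
    by (auto simp: power_mult_distrib)
qed

lemma integrable_continuous_mult:
  fixes W f :: "real \<Rightarrow> real"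
  assumes W: "continuous_on {p..q} W" and f: "f integrable_on {p..q}" "\<And>x. x \<in> {p..q} \<Longrightarrow> 0 \<le> f x"
  shows "(\<lambda>s. W s * f s) integrable_on {p..q}"
proof -
  have "(\<lambda>s. W s * f s) absolutely_integrable_on {p..q}"
  proof (rule absolutely_integrable_bounded_measurable_product_real)
    show "W \<in> borel_measurable (lebesgue_on {p..q})"
      by (intro continuous_imp_measurable_on_sets_lebesgue W) auto
    show "bounded (W ` {p..q})"
      by (intro compact_imp_bounded compact_continuous_image W) auto
    show "f absolutely_integrable_on {p..q}"
      by (intro nonnegative_absolutely_integrable_1 f)
  qed auto
  then show ?thesis by (rule set_lebesgue_integral_eq_integral(1))
qed

lemma L2_weighted_integrable:
  assumes "L2_derivative p q \<psi> g" and W: "continuous_on {p..q} W"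
  shows "(\<lambda>s. W s * (\<psi> s)\<^sup>2) integrable_on {p..q}"
    and "(\<lambda>s. W s * (g s)\<^sup>2) integrable_on {p..q}"
    and "(\<lambda>s. W s * ((\<psi> s)\<^sup>2 - (g s)\<^sup>2)) integrable_on {p..q}"
proof -
  show 1: "(\<lambda>s. W s * (\<psi> s)\<^sup>2) integrable_on {p..q}"
    by (intro integrable_continuous_real continuous_intros W L2_derivative_continuous[OF assms(1)])
  show 2: "(\<lambda>s. W s * (g s)\<^sup>2) integrable_on {p..q}"
    by (intro integrable_continuous_mult W L2_derivativeD(2)[OF assms(1)]) auto
  show "(\<lambda>s. W s * ((\<psi> s)\<^sup>2 - (g s)\<^sup>2)) integrable_on {p..q}"
    using integrable_diff[OF 1 2] by (simp add: right_diff_distrib)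
qed

text \<open>The primitive is taken from a point to the left of the support, so that its derivative exists at
  every real number, including \<open>a\<close> and \<open>b\<close>.\<close>
lemma compactly_supported_primitive:
  fixes k :: "real \<Rightarrow> real"
  assumes ab: "a < b" and k: "continuous_on UNIV k" and supp: "\<And>x. x \<le> a \<or> b \<le> x \<Longrightarrow> k x = 0"
    and mean: "integral {a..b} k = 0"
  obtains \<psi> where "\<And>s. (\<psi> has_real_derivative k s) (at s)" "\<And>s. s \<le> a \<or> b \<le> s \<Longrightarrow> \<psi> s = 0"
    "\<And>s. s \<in> {a..b} \<Longrightarrow> \<psi> s = integral {a..s} k"
proof
  define \<psi> where "\<psi> s = integral {a - 1..s} k" for s
  have int: "k integrable_on {x..y}" for x y
    by (intro integrable_continuous_real continuous_on_subset[OF k]) auto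
  have neg: "\<psi> s = 0" if "s \<le> a" for s
  proof -
    have "(k has_integral 0) {a - 1..s}" by (rule has_integral_is_0) (use that supp in auto)
    then show ?thesis by (simp add: \<psi>_def integral_unique)
  qed
  have pos: "\<psi> s = integral {a..s} k" if "a \<le> s" for s
    using integral_split[of "a - 1" a s k] int that neg[of a] by (simp add: \<psi>_def)
  then show "\<psi> s = integral {a..s} k" if "s \<in> {a..b}" for s using that by simp
  have large: "\<psi> s = 0" if "b \<le> s" for s
  proof -
    have "(k has_integral 0) {b..s}" by (rule has_integral_is_0) (use that supp in auto)
    then have "integral {b..s} k = 0" by (simp add: integral_unique)
    then show ?thesis
      using pos[of s] integral_split[of a b s k] int that ab mean by simp
  qed
  show out: "\<psi> s = 0" if "s \<le> a \<or> b \<le> s" for s using that neg large by auto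
  show "(\<psi> has_real_derivative k s) (at s)" for s
  proof (cases "s \<in> {a - 1<..<b + 1}")
    case True
    then have "(\<psi> has_real_derivative k s) (at s within {a - 1..b + 1})"
      unfolding \<psi>_def
      by (intro integral_has_real_derivative continuous_on_subset[OF k]) auto
    moreover have "at s within {a - 1..b + 1} = at s"
      by (rule at_within_interior) (use True in auto)
    ultimately show ?thesis by simp
  next
    case False
    define U where "U = (if s \<le> a - 1 then {..<a} else {b<..})"
    have "open U" "s \<in> U" "\<And>r. r \<in> U \<Longrightarrow> \<psi> r = 0"
      using False out ab by (auto simp: U_def)
    moreover have "k s = 0" using False supp ab by (cases "s \<le> a - 1") auto
    ultimately show ?thesis
      using has_field_derivative_transform_within_open[of "\<lambda>_. 0" 0 s U \<psi>] by auto
  qed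
qed

context contractive_resolvent
begin

text \<open>The integral is continuous under mean square approximation of the slope. The approximation is made
  with accuracy \<open>\<delta>\<^sup>2\<close> and compared with the inequality \<open>y\<^sup>2 \<le> (1 +
  \<delta>) z\<^sup>2 + (1 + 1 / \<delta>) (y - z)\<^sup>2\<close>, so that all errors vanish with
  \<open>\<delta>\<close>.\<close>
lemma weighted_energy:
  assumes L: "L > 0" and \<gamma>: "\<gamma> \<ge> 0" and \<psi>: "L2_derivative 0 L \<psi> g" "\<psi> 0 = 0" "\<psi> L = 0"
  shows "integral {0..L} (\<lambda>s. exp (- 2 * \<gamma> * s) * (norm (S s x))\<^sup>2 * ((\<psi> s)\<^sup>2 - (g s)\<^sup>2)) \<le> 0"
proof -
  define W where "W s = exp (- 2 * \<gamma> * s) * (norm (S s x))\<^sup>2" for s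
  have W: "continuous_on {0..L} W"
    unfolding W_def by (intro continuous_intros continuous_on_S_Icc) auto
  have W0: "W s \<ge> 0" for s by (simp add: W_def)
  obtain B where B: "\<And>s. s \<in> {0..L} \<Longrightarrow> W s \<le> B" "B > 0"
    using continuous_Icc_abs_bounded[OF W] by (metis abs_le_D1)
  have gi: "g integrable_on {0..L}" and g2: "(\<lambda>s. (g s)\<^sup>2) integrable_on {0..L}"
    using L2_derivative_integrable[OF \<psi>(1)] L2_derivativeD(2)[OF \<psi>(1)] by auto
  have mean: "integral {0..L} g = 0"
    using L2_derivativeD(1)[OF \<psi>(1), of 0 L] L \<psi>(2,3) by (simp add: integral_unique)
  note W\<psi> = L2_weighted_integrable[OF \<psi>(1) W]
  have split: "integral {0..L} (\<lambda>s. W s * ((f s)\<^sup>2 - (h s)\<^sup>2)) =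
      integral {0..L} (\<lambda>s. W s * (f s)\<^sup>2) - integral {0..L} (\<lambda>s. W s * (h s)\<^sup>2)"
    if "L2_derivative 0 L f h" for f h
    using integral_diff[OF L2_weighted_integrable(1,2)[OF that W]]
    by (simp add: right_diff_distrib)
  \<comment> \<open>Young's inequality with parameter \<open>\<delta>\<close>.\<close>
  have mixed: "a\<^sup>2 \<le> (1 + \<delta>) * b\<^sup>2 + (1 + 1 / \<delta>) * (a - b)\<^sup>2" if "\<delta> > 0" for a b \<delta> :: real
  proof -
    have "0 \<le> (\<delta> * b - (a - b))\<^sup>2 / \<delta>" using that by simp
    also have "\<dots> = \<delta> * b\<^sup>2 - 2 * b * (a - b) + (a - b)\<^sup>2 / \<delta>"
      using that by (simp add: power2_eq_square field_simps)
    finally have "0 \<le> \<delta> * b\<^sup>2 - 2 * b * (a - b) + (a - b)\<^sup>2 / \<delta>" .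
    moreover have "(1 + 1 / \<delta>) * (a - b)\<^sup>2 = (a - b)\<^sup>2 + (a - b)\<^sup>2 / \<delta>"
      by (simp add: distrib_right)
    moreover have "a\<^sup>2 = b\<^sup>2 + 2 * b * (a - b) + (a - b)\<^sup>2"
      by (simp add: power2_eq_square algebra_simps)
    ultimately show ?thesis by (simp add: distrib_right)
  qed
  have weighted_mixed: "integral {0..L} (\<lambda>s. W s * (f s)\<^sup>2) \<le>
      (1 + \<delta>) * integral {0..L} (\<lambda>s. W s * (h s)\<^sup>2) + (1 + 1 / \<delta>) * (B * integral {0..L} (\<lambda>s. (f s - h s)\<^sup>2))"
    if "\<delta> > 0" and i: "(\<lambda>s. W s * (f s)\<^sup>2) integrable_on {0..L}" "(\<lambda>s. W s * (h s)\<^sup>2) integrable_on {0..L}"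
      "(\<lambda>s. (f s - h s)\<^sup>2) integrable_on {0..L}" for f h \<delta>
  proof -
    have "integral {0..L} (\<lambda>s. W s * (f s)\<^sup>2) \<le>
        integral {0..L} (\<lambda>s. (1 + \<delta>) * (W s * (h s)\<^sup>2) + (1 + 1 / \<delta>) * (B * (f s - h s)\<^sup>2))"
    proof (rule integral_le)
      fix s assume s: "s \<in> {0..L}"
      have "W s * (f s)\<^sup>2 \<le> W s * ((1 + \<delta>) * (h s)\<^sup>2 + (1 + 1 / \<delta>) * (f s - h s)\<^sup>2)"
        by (intro mult_left_mono mixed that W0)
      also have "\<dots> = (1 + \<delta>) * (W s * (h s)\<^sup>2) + (1 + 1 / \<delta>) * (W s * (f s - h s)\<^sup>2)"
        by (simp add: algebra_simps)
      also have "\<dots> \<le> (1 + \<delta>) * (W s * (h s)\<^sup>2) + (1 + 1 / \<delta>) * (B * (f s - h s)\<^sup>2)"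
        using B(1)[OF s] \<open>\<delta> > 0\<close> by (intro add_left_mono mult_left_mono mult_right_mono) auto
      finally show "W s * (f s)\<^sup>2 \<le> \<dots>" .
    qed (intro integrable_add integrable_on_mult_right i)+
    also have "\<dots> = (1 + \<delta>) * integral {0..L} (\<lambda>s. W s * (h s)\<^sup>2) + (1 + 1 / \<delta>) * (B * integral {0..L} (\<lambda>s. (f s - h s)\<^sup>2))"
      by (subst integral_add) (auto intro!: integrable_on_mult_right i)
    finally show ?thesis .
  qed
  define X where "X = integral {0..L} (\<lambda>s. W s * (\<psi> s)\<^sup>2)"
  define Y where "Y = integral {0..L} (\<lambda>s. W s * (g s)\<^sup>2)"
  have bound: "X \<le> (1 + \<delta>) * ((1 + \<delta>) * Y + (\<delta>\<^sup>2 + \<delta>) * B) + (\<delta>\<^sup>2 + \<delta>) * (B * L\<^sup>2)" if \<delta>: "\<delta> > 0" for \<delta>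
  proof -
    obtain k where k: "continuous_on UNIV k" "\<forall>x. x \<le> 0 \<or> L \<le> x \<longrightarrow> k x = 0" "integral {0..L} k = 0"
        and kg: "integral {0..L} (\<lambda>x. (k x - g x)\<^sup>2) < \<delta>\<^sup>2"
      using continuous_L2_dense_mean_zero[OF L gi g2 mean, of "\<delta>\<^sup>2"] \<delta> by auto
    obtain \<phi> where \<phi>: "\<And>s. (\<phi> has_real_derivative k s) (at s)" "\<And>s. s \<le> 0 \<or> L \<le> s \<Longrightarrow> \<phi> s = 0"
        "\<And>s. s \<in> {0..L} \<Longrightarrow> \<phi> s = integral {0..s} k"
      using compactly_supported_primitive[OF L k(1) _ k(3)] k(2) by blast
    have contk: "continuous_on A k" for A using k(1) continuous_on_subset by blast
    have \<phi>k: "L2_derivative 0 L \<phi> k"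
      by (intro L2_derivative_C1 contk has_field_derivative_at_within[OF \<phi>(1)])
    have ki: "k integrable_on {0..L}" by (intro integrable_continuous_real contk)
    have kg2: "(\<lambda>x. (k x - g x)\<^sup>2) integrable_on {0..L}"
      by (intro square_integrable_diff integrable_imp_measurable ki gi g2 L2_derivativeD(2)[OF \<phi>k])
    have energy: "integral {0..L} (\<lambda>s. W s * (\<phi> s)\<^sup>2) \<le> integral {0..L} (\<lambda>s. W s * (k s)\<^sup>2)"
    proof -
      have "(\<lambda>s. W s * ((\<phi> s)\<^sup>2 - (k s)\<^sup>2)) =
          (\<lambda>s. exp (- 2 * \<gamma> * s) * ((\<phi> s)\<^sup>2 - (k s)\<^sup>2) * (norm (S s x))\<^sup>2)"
        by (simp add: W_def fun_eq_iff mult_ac)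
      then show ?thesis
        using weighted_energy_C1[OF L \<gamma> \<phi>(1) k(1) \<phi>(2), of x] split[OF \<phi>k] by simp
    qed
    have sup: "(\<psi> s - \<phi> s)\<^sup>2 \<le> L * \<delta>\<^sup>2" if s: "s \<in> {0..L}" for s
    proof (cases "s = 0")
      case True
      then show ?thesis using \<psi>(2) \<phi>(2)[of 0] L by simp
    next
      case False
      with s have s0: "0 < s" "s \<le> L" by auto
      have sub: "{0..s} \<subseteq> {0..L}" using s0 by auto
      have i: "k integrable_on {0..s}" "g integrable_on {0..s}"
        "(\<lambda>x. (k x - g x)\<^sup>2) integrable_on {0..s}"
        using integrable_on_subinterval[OF ki sub] integrable_on_subinterval[OF gi sub]
          integrable_on_subinterval[OF kg2 sub] by auto
      have "\<psi> s = integral {0..s} g"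
        using L2_derivativeD(1)[OF \<psi>(1), of 0 s] s0 \<psi>(2) by (simp add: integral_unique)
      then have "(\<psi> s - \<phi> s)\<^sup>2 = (integral {0..s} (\<lambda>x. k x - g x))\<^sup>2"
        using \<phi>(3)[OF s] integral_diff[OF i(1,2)] by (simp add: power2_commute)
      also have "\<dots> \<le> (s - 0) * integral {0..s} (\<lambda>x. (k x - g x)\<^sup>2)"
        by (intro square_integral_le_integral_square s0 integrable_diff i)
      also have "\<dots> \<le> L * integral {0..L} (\<lambda>x. (k x - g x)\<^sup>2)"
        using s0 by (intro mult_mono integral_subset_le sub i kg2 integral_nonneg) auto
      also have "\<dots> \<le> L * \<delta>\<^sup>2" using kg L by (intro mult_left_mono) auto
      finally show ?thesis .
    qed
    have cont\<phi>: "continuous_on {0..L} \<phi>" by (rule L2_derivative_continuous[OF \<phi>k])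
    have \<psi>\<phi>: "(\<lambda>s. (\<psi> s - \<phi> s)\<^sup>2) integrable_on {0..L}"
      by (intro integrable_continuous_real continuous_intros cont\<phi> L2_derivative_continuous[OF \<psi>(1)])
    have "integral {0..L} (\<lambda>s. (\<psi> s - \<phi> s)\<^sup>2) \<le> integral {0..L} (\<lambda>_. L * \<delta>\<^sup>2)"
      by (intro integral_le \<psi>\<phi> sup) auto
    then have sup_int: "integral {0..L} (\<lambda>s. (\<psi> s - \<phi> s)\<^sup>2) \<le> L\<^sup>2 * \<delta>\<^sup>2"
      using L by (simp add: power2_eq_square mult_ac)
    \<comment> \<open>Here the choice of \<open>\<delta>\<^sup>2\<close> as accuracy pays off.\<close>
    have cancel: "(1 + 1 / \<delta>) * \<delta>\<^sup>2 = \<delta>\<^sup>2 + \<delta>" using \<delta> by (simp add: field_simps power2_eq_square)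
    have "integral {0..L} (\<lambda>s. W s * (k s)\<^sup>2) \<le>
        (1 + \<delta>) * Y + (1 + 1 / \<delta>) * (B * integral {0..L} (\<lambda>s. (k s - g s)\<^sup>2))"
      unfolding Y_def
      by (intro weighted_mixed \<delta> W\<psi> kg2 L2_weighted_integrable(2)[OF \<phi>k W])
    also have "\<dots> \<le> (1 + \<delta>) * Y + (1 + 1 / \<delta>) * (B * \<delta>\<^sup>2)"
      using \<delta> B(2) kg by (intro add_left_mono mult_left_mono) auto
    also have "\<dots> = (1 + \<delta>) * Y + ((1 + 1 / \<delta>) * \<delta>\<^sup>2) * B" by (simp only: mult_ac)
    finally have kY: "integral {0..L} (\<lambda>s. W s * (k s)\<^sup>2) \<le> (1 + \<delta>) * Y + (\<delta>\<^sup>2 + \<delta>) * B"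
      unfolding cancel .
    have "X \<le> (1 + \<delta>) * integral {0..L} (\<lambda>s. W s * (\<phi> s)\<^sup>2) +
        (1 + 1 / \<delta>) * (B * integral {0..L} (\<lambda>s. (\<psi> s - \<phi> s)\<^sup>2))"
      unfolding X_def
      by (intro weighted_mixed \<delta> W\<psi> \<psi>\<phi> L2_weighted_integrable(1)[OF \<phi>k W])
    also have "\<dots> \<le> (1 + \<delta>) * ((1 + \<delta>) * Y + (\<delta>\<^sup>2 + \<delta>) * B) + (1 + 1 / \<delta>) * (B * (L\<^sup>2 * \<delta>\<^sup>2))"
      using \<delta> B(2) sup_int energy kY by (intro add_mono mult_left_mono) auto
    also have "(1 + 1 / \<delta>) * (B * (L\<^sup>2 * \<delta>\<^sup>2)) = ((1 + 1 / \<delta>) * \<delta>\<^sup>2) * (B * L\<^sup>2)"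
      by (simp only: mult_ac)
    finally show ?thesis unfolding cancel .
  qed
  define R where "R \<delta> = (1 + \<delta>) * ((1 + \<delta>) * Y + (\<delta>\<^sup>2 + \<delta>) * B) + (\<delta>\<^sup>2 + \<delta>) * (B * L\<^sup>2)" for \<delta>
  have "(R \<longlongrightarrow> R 0) (at_right 0)"
    unfolding R_def by (intro tendsto_intros)
  moreover have "\<forall>\<^sub>F \<delta> in at_right 0. X \<le> R \<delta>"
    using eventually_at_right_less[of "0::real"] by (rule eventually_mono) (use bound in \<open>auto simp: R_def\<close>)
  ultimately have "X \<le> R 0"
    by (intro tendsto_lowerbound[of R _ "at_right 0"]) auto
  then show ?thesis using split[OF \<psi>(1)] by (simp add: R_def X_def Y_def W_def)
qed

end

section \<open>Boundedness of orbits\<close>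

context contractive_resolvent
begin

lemma weighted_orbit_le:
  assumes "norm (S s x) \<le> C * exp (\<gamma> * s)"
  shows "exp (- 2 * \<gamma> * s) * (norm (S s x))\<^sup>2 \<le> C\<^sup>2"
proof -
  have "exp (- 2 * \<gamma> * s) * (norm (S s x))\<^sup>2 = (exp (- \<gamma> * s) * norm (S s x))\<^sup>2"
    by (simp add: power_mult_distrib exp_double[symmetric] mult.assoc)
  also have "\<dots> \<le> (exp (- \<gamma> * s) * (C * exp (\<gamma> * s)))\<^sup>2"
    by (intro power_mono mult_left_mono assms) auto
  also have "\<dots> = C\<^sup>2" by (simp add: exp_minus field_simps)
  finally show ?thesis .
qed

text \<open>The cut-off need not vanish at \<open>T\<close>: it is continued by a decaying exponential, which
  contributes nothing since \<open>\<psi>\<^sup>2 = \<psi>'\<^sup>2\<close>, and brought to zero linearly on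
  \<open>[M, M + 1]\<close>. The cost of that last piece tends to \<open>0\<close> as \<open>M\<close> grows.\<close>
lemma weighted_energy_bounded_orbit:
  assumes T: "T > 0" and \<gamma>: "\<gamma> \<ge> 0" and \<psi>: "L2_derivative 0 T \<psi> g" "\<psi> 0 = 0"
    and bd: "\<And>s. s \<ge> 0 \<Longrightarrow> norm (S s x) \<le> C * exp (\<gamma> * s)"
  shows "integral {0..T} (\<lambda>s. exp (- 2 * \<gamma> * s) * (norm (S s x))\<^sup>2 * ((\<psi> s)\<^sup>2 - (g s)\<^sup>2)) \<le> 0"
proof -
  define W where "W s = exp (- 2 * \<gamma> * s) * (norm (S s x))\<^sup>2" for s
  have W: "0 \<le> W s" "W s \<le> C\<^sup>2" if "s \<ge> 0" for s
    using weighted_orbit_le[OF bd[OF that]] by (auto simp: W_def)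
  have contW: "continuous_on {a..b} W" if "0 \<le> a" for a b
    unfolding W_def by (intro continuous_intros continuous_on_S_Icc that)
  define c where "c = \<psi> T"
  have bound: "integral {0..T} (\<lambda>s. W s * ((\<psi> s)\<^sup>2 - (g s)\<^sup>2)) \<le> C\<^sup>2 * (c * exp (- (M - T)))\<^sup>2"
    if M: "M \<ge> T" for M
  proof -
    define d where "d = c * exp (- (M - T))"
    define \<phi> where "\<phi> s = (if s \<le> T then \<psi> s else if s \<le> M then c * exp (- (s - T)) else d * (M + 1 - s))" for s
    define h where "h s = (if s < T then g s else if s < M then - (c * exp (- (s - T))) else - d)" for s
    have 1: "L2_derivative 0 T \<phi> h"
      by (rule L2_derivative_cong[OF \<psi>(1)]) (auto simp: \<phi>_def h_def)
    have 2: "L2_derivative T M \<phi> h"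
    proof (rule L2_derivative_cong)
      show "L2_derivative T M (\<lambda>s. c * exp (- (s - T))) (\<lambda>s. - (c * exp (- (s - T))))"
        by (intro L2_derivative_C1) (auto intro!: derivative_eq_intros continuous_intros)
    qed (auto simp: \<phi>_def h_def c_def)
    have 3: "L2_derivative M (M + 1) \<phi> h"
    proof (rule L2_derivative_cong)
      show "L2_derivative M (M + 1) (\<lambda>s. d * (M + 1 - s)) (\<lambda>s. - d)"
        by (intro L2_derivative_C1) (auto intro!: derivative_eq_intros continuous_intros)
    qed (use M in \<open>auto simp: \<phi>_def h_def c_def d_def\<close>)
    have 12: "L2_derivative 0 M \<phi> h"
      using T M by (intro L2_derivative_combine[OF 1 2]) auto
    have 123: "L2_derivative 0 (M + 1) \<phi> h"
      using T M by (intro L2_derivative_combine[OF 12 3]) auto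
    define q where "q s = W s * ((\<phi> s)\<^sup>2 - (h s)\<^sup>2)" for s
    have int: "q integrable_on {0..M + 1}" "q integrable_on {0..M}" "q integrable_on {M..M + 1}"
      unfolding q_def using T M
      by (intro L2_weighted_integrable(3)[OF 123]
          L2_weighted_integrable(3)[OF 12]
          L2_weighted_integrable(3)[OF 3] contW; simp)+
    have "integral {0..M + 1} q \<le> 0"
      unfolding q_def W_def
      by (rule weighted_energy[OF _ \<gamma> 123]) (use T M \<psi>(2) in \<open>auto simp: \<phi>_def\<close>)
    moreover have "integral {0..M + 1} q = integral {0..T} q + integral {T..M} q + integral {M..M + 1} q"
      using integral_split[OF _ _ int(1), of M]
        integral_split[OF _ _ int(2), of T] T M by auto
    moreover have "integral {0..T} q = integral {0..T} (\<lambda>s. W s * ((\<psi> s)\<^sup>2 - (g s)\<^sup>2))"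
      by (rule integral_spike[of "{T}"]) (auto simp: q_def \<phi>_def h_def)
    moreover have "integral {T..M} q = integral {T..M} (\<lambda>_. 0)"
      by (rule integral_spike[of "{T, M}"]) (auto simp: q_def \<phi>_def h_def)
    moreover have "- (C\<^sup>2 * d\<^sup>2) \<le> integral {M..M + 1} q"
    proof -
      have "integral {M..M + 1} (\<lambda>_. - (C\<^sup>2 * d\<^sup>2)) \<le> integral {M..M + 1} q"
      proof (rule integral_le)
        fix s assume s: "s \<in> {M..M + 1}"
        have "W s * d\<^sup>2 \<le> C\<^sup>2 * d\<^sup>2" using W[of s] s T M by (intro mult_right_mono) auto
        moreover have "q s \<ge> - (W s * d\<^sup>2)"
        proof -
          have "(h s)\<^sup>2 = d\<^sup>2" using s M by (simp add: h_def)
          then have "(\<phi> s)\<^sup>2 - (h s)\<^sup>2 \<ge> - d\<^sup>2" by simp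
          then have "W s * (- d\<^sup>2) \<le> q s" unfolding q_def using W(1)[of s] s T M
            by (intro mult_left_mono) auto
          then show ?thesis by simp
        qed
        ultimately show "- (C\<^sup>2 * d\<^sup>2) \<le> q s" by linarith
      qed (use int in auto)
      then show ?thesis by simp
    qed
    ultimately show ?thesis unfolding d_def[symmetric] by simp
  qed
  have "((\<lambda>M. C\<^sup>2 * (c * exp (- (M - T)))\<^sup>2) \<longlongrightarrow> C\<^sup>2 * (c * 0)\<^sup>2) at_top"
  proof (intro tendsto_intros)
    have "filterlim (\<lambda>M. - T + M) at_top at_top"
      by (rule filterlim_tendsto_add_at_top[OF tendsto_const filterlim_ident])
    then have "((\<lambda>M. exp (- (- T + M))) \<longlongrightarrow> 0) at_top"
      by (intro filterlim_compose[OF exp_at_bot] filterlim_compose[OF filterlim_uminus_at_bot_at_top])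
    then show "((\<lambda>M. exp (- (M - T))) \<longlongrightarrow> 0) at_top" by (simp add: algebra_simps)
  qed
  then have "integral {0..T} (\<lambda>s. W s * ((\<psi> s)\<^sup>2 - (g s)\<^sup>2)) \<le> C\<^sup>2 * (c * 0)\<^sup>2"
    by (rule tendsto_lowerbound)
       (use bound in \<open>auto intro: eventually_mono[OF eventually_ge_at_top[of T]]\<close>)
  then show ?thesis by (simp add: W_def)
qed

text \<open>For a cut-off growing like \<open>exp (s / 2)\<close> the factor \<open>\<psi>\<^sup>2 -
  \<psi>'\<^sup>2\<close> is \<open>3/4\<close> of \<open>exp (s - 1)\<close>. The energy inequality therefore
  bounds the integral of \<open>exp (s - 2 \<gamma> s) f s\<close> over the last unit of time uniformly in
  \<open>t\<close>, and on a unit interval \<open>f\<close> is bounded below by a multiple of \<open>f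
  t\<close>.\<close>
lemma growth_improvement:
  assumes \<gamma>: "\<gamma> \<ge> 0" and bd: "\<And>s. s \<ge> 0 \<Longrightarrow> norm (S s x) \<le> C * exp (\<gamma> * s)"
    and loc: "\<And>s y. s \<in> {0..1} \<Longrightarrow> norm (S s y) \<le> B * norm y" and B: "B > 0"
  shows "\<exists>C'. \<forall>s\<ge>0. norm (S s x) \<le> C' * exp ((\<gamma> - 1/2) * s)"
proof -
  have "C \<ge> 0" using bd[of 0] order_trans[OF norm_ge_zero] by fastforce
  define W where "W s = exp (- 2 * \<gamma> * s) * (norm (S s x))\<^sup>2" for s
  have W: "0 \<le> W s" "W s \<le> C\<^sup>2" if "s \<ge> 0" for s
    using weighted_orbit_le[OF bd[OF that]] by (auto simp: W_def)
  have contW: "continuous_on {a..b} W" if "0 \<le> a" for a b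
    unfolding W_def by (intro continuous_intros continuous_on_S_Icc that)
  have large: "norm (S t x) \<le> 2 * exp 1 * B * C * exp ((\<gamma> - 1/2) * t)" if t: "t \<ge> 2" for t
  proof -
    define \<phi> where "\<phi> s = (if s \<le> 1 then s else exp ((s - 1) / 2))" for s :: real
    define h where "h s = (if s < 1 then 1 else exp ((s - 1) / 2) / 2)" for s :: real
    have 1: "L2_derivative 0 1 \<phi> h"
    proof (rule L2_derivative_cong)
      show "L2_derivative 0 1 (\<lambda>s. s) (\<lambda>s. 1)"
        by (intro L2_derivative_C1) (auto intro!: derivative_eq_intros continuous_intros)
    qed (auto simp: \<phi>_def h_def)
    have 2: "L2_derivative 1 t \<phi> h"
    proof (rule L2_derivative_cong)
      show "L2_derivative 1 t (\<lambda>s. exp ((s - 1) / 2)) (\<lambda>s. exp ((s - 1) / 2) / 2)"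
        by (intro L2_derivative_C1) (auto intro!: derivative_eq_intros continuous_intros)
    qed (auto simp: \<phi>_def h_def)
    have 12: "L2_derivative 0 t \<phi> h"
      using t by (intro L2_derivative_combine[OF 1 2]) auto
    define q where "q s = W s * ((\<phi> s)\<^sup>2 - (h s)\<^sup>2)" for s
    have int: "q integrable_on {0..t}" unfolding q_def
      by (intro L2_weighted_integrable(3)[OF 12] contW) simp
    then have ints: "q integrable_on {a..b}" if "0 \<le> a" "b \<le> t" for a b
      using that integrable_on_subinterval by (metis atLeastatMost_subset_iff)
    have "integral {0..t} q \<le> 0"
      unfolding q_def W_def
      by (rule weighted_energy_bounded_orbit[OF _ \<gamma> 12 _ bd]) (use t in \<open>auto simp: \<phi>_def\<close>)
    moreover have "integral {0..t} q = integral {0..1} q + integral {1..t - 1} q + integral {t - 1..t} q"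
      using integral_split[of 0 1 t q]
        integral_split[of 1 "t - 1" t q] ints t by auto
    moreover have "- (C\<^sup>2) \<le> integral {0..1} q"
    proof -
      have "integral {0..1} (\<lambda>_::real. - (C\<^sup>2)) \<le> integral {0..1} q"
      proof (rule integral_le)
        fix s :: real assume s: "s \<in> {0..1}"
        have "h s ^ 2 \<le> 1" using s by (auto simp: h_def power_divide)
        then have "- 1 \<le> (\<phi> s)\<^sup>2 - (h s)\<^sup>2" using zero_le_power2[of "\<phi> s"] by linarith
        then have "W s * (- 1) \<le> q s" unfolding q_def using W(1)[of s] s by (intro mult_left_mono) auto
        then show "- (C\<^sup>2) \<le> q s" using W(2)[of s] s by auto
      qed (use ints t in auto)
      then show ?thesis by simp
    qed
    \<comment> \<open>The slope of the cut-off is half of its value, so \<open>3/4\<close> of the square remains.\<close>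
    moreover have q_large: "q s = 3 / 4 * exp (s - 1) * W s" if "s > 1" for s
    proof -
      have "(exp ((s - 1) / 2))\<^sup>2 = exp (s - 1)"
        by (simp add: exp_double[symmetric])
      then show ?thesis using that by (simp add: q_def \<phi>_def h_def power_divide)
    qed
    moreover have "0 \<le> integral {1..t - 1} q"
    proof (rule integral_nonneg)
      fix s assume s: "s \<in> {1..t - 1}"
      have "0 \<le> (\<phi> s)\<^sup>2 - (h s)\<^sup>2"
        using s by (auto simp: \<phi>_def h_def power_divide)
      then show "0 \<le> q s" unfolding q_def using W(1)[of s] s by auto
    qed (use ints t in auto)
    moreover have "3 / 4 * exp (- 2) / B\<^sup>2 * exp ((1 - 2 * \<gamma>) * t) * (norm (S t x))\<^sup>2 \<le> integral {t - 1..t} q"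
    proof -
      have "integral {t - 1..t} (\<lambda>_. 3 / 4 * exp (- 2) / B\<^sup>2 * exp ((1 - 2 * \<gamma>) * t) * (norm (S t x))\<^sup>2)
          \<le> integral {t - 1..t} (\<lambda>s. 3 / 4 * exp (s - 1) * W s)"
      proof (rule integral_le)
        show "(\<lambda>s. 3 / 4 * exp (s - 1) * W s) integrable_on {t - 1..t}"
          using t by (intro integrable_continuous_real continuous_intros contW) auto
        fix s assume s: "s \<in> {t - 1..t}"
        have "S t x = S (t - s) (S s x)" using S_add[of "t - s" s x] s t by simp
        then have "norm (S t x) \<le> B * norm (S s x)" using loc[of "t - s" "S s x"] s by simp
        then have "(norm (S t x))\<^sup>2 \<le> (B * norm (S s x))\<^sup>2" by (intro power_mono) auto
        then have f: "(norm (S t x))\<^sup>2 / B\<^sup>2 \<le> (norm (S s x))\<^sup>2"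
          using B by (simp add: power_mult_distrib field_simps)
        \<comment> \<open>At most one unit is lost by going from \<open>t\<close> back to \<open>s\<close>, and one by the shift in \<open>exp (s - 1)\<close>.\<close>
        have "(1 - 2 * \<gamma>) * t - 2 \<le> (s - 1) + (- 2 * \<gamma> * s)"
        proof -
          have "0 \<le> 2 * \<gamma> * (t - s)" using s \<gamma> by auto
          then show ?thesis using s by (simp add: algebra_simps)
        qed
        then have e: "exp (- 2) * exp ((1 - 2 * \<gamma>) * t) \<le> exp (s - 1) * exp (- 2 * \<gamma> * s)"
          by (simp flip: exp_add)
        have "(exp (- 2) * exp ((1 - 2 * \<gamma>) * t)) * ((norm (S t x))\<^sup>2 / B\<^sup>2)
            \<le> (exp (s - 1) * exp (- 2 * \<gamma> * s)) * (norm (S s x))\<^sup>2"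
          by (intro mult_mono e f) auto
        then show "3 / 4 * exp (- 2) / B\<^sup>2 * exp ((1 - 2 * \<gamma>) * t) * (norm (S t x))\<^sup>2
            \<le> 3 / 4 * exp (s - 1) * W s"
          by (simp add: W_def field_simps)
      qed auto
      also have "integral {t - 1..t} (\<lambda>s. 3 / 4 * exp (s - 1) * W s) = integral {t - 1..t} q"
        by (rule integral_spike[of "{t - 1}"]) (use q_large t in auto)
      finally show ?thesis by simp
    qed
    ultimately have "3 / 4 * exp (- 2) / B\<^sup>2 * exp ((1 - 2 * \<gamma>) * t) * (norm (S t x))\<^sup>2 \<le> C\<^sup>2"
      by linarith
    then have "(norm (S t x))\<^sup>2 \<le> 4 / 3 * (exp 2 * B\<^sup>2 * C\<^sup>2 * exp ((2 * \<gamma> - 1) * t))"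
    proof -
      have "exp ((1 - 2 * \<gamma>) * t) = 1 / exp ((2 * \<gamma> - 1) * t)"
        by (simp add: exp_minus[symmetric] inverse_eq_divide[symmetric] algebra_simps)
      moreover have "exp (- 2) = 1 / exp (2::real)" by (simp add: exp_minus inverse_eq_divide)
      moreover have "N \<le> 4 / 3 * (e * d * K * u)"
        if "3 / 4 * (1 / e) / d * (1 / u) * N \<le> K" "0 < e" "0 < d" "0 < u" for N K e d u :: real
        using that by (simp add: field_simps)
      moreover assume "3 / 4 * exp (- 2) / B\<^sup>2 * exp ((1 - 2 * \<gamma>) * t) * (norm (S t x))\<^sup>2 \<le> C\<^sup>2"
      ultimately show ?thesis using B by simp
    qed
    also have "\<dots> \<le> 4 * (exp 2 * B\<^sup>2 * C\<^sup>2 * exp ((2 * \<gamma> - 1) * t))"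
      by (intro mult_right_mono) auto
    also have "\<dots> = (2 * exp 1 * B * C * exp ((\<gamma> - 1/2) * t))\<^sup>2"
      by (simp add: power_mult_distrib exp_double[symmetric] algebra_simps)
    finally show ?thesis
      by (rule power2_le_imp_le) (use B \<open>C \<ge> 0\<close> in auto)
  qed
  define C' where "C' = max (2 * exp 1 * B * C) (C * exp 1)"
  have "norm (S s x) \<le> C' * exp ((\<gamma> - 1/2) * s)" if s: "s \<ge> 0" for s
  proof (cases "s \<ge> 2")
    case True
    have "2 * exp 1 * B * C * exp ((\<gamma> - 1/2) * s) \<le> C' * exp ((\<gamma> - 1/2) * s)"
      unfolding C'_def by (intro mult_right_mono) auto
    then show ?thesis using large[OF True] by linarith
  next
    case False
    have "exp (\<gamma> * s) \<le> exp (1 + (\<gamma> - 1/2) * s)" using False by (simp add: algebra_simps)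
    then have "C * exp (\<gamma> * s) \<le> C * exp 1 * exp ((\<gamma> - 1/2) * s)"
      using \<open>C \<ge> 0\<close> by (simp add: exp_add mult.assoc mult_left_mono)
    also have "\<dots> \<le> C' * exp ((\<gamma> - 1/2) * s)"
      unfolding C'_def by (intro mult_right_mono) auto
    finally show ?thesis using bd[OF s] by linarith
  qed
  then show ?thesis by blast
qed

lemma exponential_growth:
  assumes loc: "\<And>s y. s \<in> {0..1} \<Longrightarrow> norm (S s y) \<le> B * norm y" and B: "B \<ge> 1"
    and s: "s \<ge> 0"
  shows "norm (S s x) \<le> B * norm x * exp (ln B * s)"
proof -
  have step: "norm (S (real n + r) x) \<le> B ^ n * (B * norm x)" if "r \<in> {0..1}" for n r
  proof (induction n)
    case 0
    then show ?case using loc[OF that] by simp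
  next
    case (Suc n)
    have "norm (S (1 + (real n + r)) x) \<le> B * norm (S (real n + r) x)"
      using loc[of 1] that by (subst S_add) auto
    also have "\<dots> \<le> B * (B ^ n * (B * norm x))" using Suc B by (intro mult_left_mono) auto
    finally show ?case by (simp add: algebra_simps)
  qed
  define n where "n = nat \<lfloor>s\<rfloor>"
  have n: "real n \<le> s" "s \<le> real n + 1" using s unfolding n_def by linarith+
  have "B ^ n = exp (ln B * real n)" using B by (simp add: exp_of_nat_mult mult.commute)
  also have "\<dots> \<le> exp (ln B * s)" using B n by (simp add: mult_left_mono)
  finally have "B ^ n * (B * norm x) \<le> exp (ln B * s) * (B * norm x)"
    using B by (intro mult_right_mono) auto
  then show ?thesis using step[of "s - real n" n] n by (simp add: mult_ac)
qed

text \<open>Starting from any growth rate \<open>n / 2\<close>, the rate is lowered in steps of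
  \<open>1/2\<close> down to \<open>0\<close>.\<close>
lemma orbit_bounded:
  assumes loc: "\<And>s y. s \<in> {0..1} \<Longrightarrow> norm (S s y) \<le> B * norm y" and B: "B \<ge> 1"
  shows "\<exists>C. \<forall>s\<ge>0. norm (S s x) \<le> C"
proof -
  have descent: "(\<exists>C. \<forall>s\<ge>0. norm (S s x) \<le> C * exp (real n / 2 * s)) \<Longrightarrow> \<exists>C. \<forall>s\<ge>0. norm (S s x) \<le> C" for n
  proof (induction n)
    case 0
    then show ?case by simp
  next
    case (Suc n)
    then obtain C where "\<And>s. s \<ge> 0 \<Longrightarrow> norm (S s x) \<le> C * exp (real (Suc n) / 2 * s)" by blast
    from growth_improvement[OF _ this loc] B
    have "\<exists>C'. \<forall>s\<ge>0. norm (S s x) \<le> C' * exp ((real (Suc n) / 2 - 1/2) * s)" by simp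
    then show ?case using Suc.IH by (simp add: add_divide_distrib)
  qed
  obtain n :: nat where n: "2 * ln B \<le> real n" using real_arch_simple by blast
  have "norm (S s x) \<le> B * norm x * exp (real n / 2 * s)" if "s \<ge> 0" for s
  proof -
    have "norm (S s x) \<le> B * norm x * exp (ln B * s)"
      by (rule exponential_growth[OF loc B that])
    also have "\<dots> \<le> B * norm x * exp (real n / 2 * s)"
    proof -
      have "ln B * s \<le> real n / 2 * s" using n that by (intro mult_right_mono) auto
      then show ?thesis using B by (intro mult_left_mono) auto
    qed
    finally show ?thesis .
  qed
  then show ?thesis using descent by blast
qed

end

section \<open>Smooth test functions\<close>

lemma exp_minus_inverse_le:
  fixes d :: real
  assumes "d > 0"
  shows "exp (- 1 / d) \<le> (real (Suc k) * d) ^ Suc k"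
proof -
  have "(1 / (real (Suc k) * d)) ^ Suc k \<le> (1 + (1 / d) / real (Suc k)) ^ Suc k"
    using assms by (intro power_mono) (auto simp: field_simps)
  also have "\<dots> \<le> exp (1 / d)"
  proof (rule exp_ge_one_plus_x_over_n_power_n)
    have "1 / d > 0" using assms by simp
    then show "- real (Suc k) \<le> 1 / d" by linarith
  qed simp
  finally have "inverse (exp (1 / d)) \<le> inverse ((1 / (real (Suc k) * d)) ^ Suc k)"
    using assms by (intro le_imp_inverse_le) auto
  moreover have "inverse (exp (1 / d)) = exp (- 1 / d)" by (simp add: exp_minus[symmetric])
  moreover have "inverse ((1 / (real (Suc k) * d)) ^ Suc k) = (real (Suc k) * d) ^ Suc k"
    by (simp only: power_one_over inverse_eq_divide) simp
  ultimately show ?thesis by simp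
qed

lemma has_real_derivative_zero_if_quadratic:
  fixes f :: "real \<Rightarrow> real"
  assumes "\<And>x. \<bar>f x\<bar> \<le> K * (x - e)\<^sup>2"
  shows "(f has_real_derivative 0) (at e)"
proof -
  have f0: "f e = 0" using assms[of e] by simp
  have "((\<lambda>x. (f x - f e) / (x - e)) \<longlongrightarrow> 0) (at e)"
  proof (rule Lim_null_comparison)
    have "norm ((f x - f e) / (x - e)) \<le> K * \<bar>x - e\<bar>" if "x \<noteq> e" for x
    proof -
      have "\<bar>f x\<bar> \<le> K * \<bar>x - e\<bar> * \<bar>x - e\<bar>" using assms[of x] by (simp add: power2_eq_square)
      then show ?thesis using that f0 by (simp add: field_simps)
    qed
    then show "\<forall>\<^sub>F x in at e. norm ((f x - f e) / (x - e)) \<le> K * \<bar>x - e\<bar>"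
      by (auto simp: eventually_at_filter)
    have "((\<lambda>x. K * \<bar>x - e\<bar>) \<longlongrightarrow> K * \<bar>e - e\<bar>) (at e)" by (intro tendsto_intros)
    then show "((\<lambda>x. K * \<bar>x - e\<bar>) \<longlongrightarrow> 0) (at e)" by simp
  qed
  then show ?thesis by (simp add: has_field_derivative_iff)
qed

text \<open>With a polynomial \<open>P\<close> and a pole order \<open>n\<close> as parameters the family is
  closed under differentiation.\<close>
definition bump :: "real \<Rightarrow> real \<Rightarrow> real poly \<Rightarrow> nat \<Rightarrow> real \<Rightarrow> real"
  where "bump p q P n x =
    (if p < x \<and> x < q then poly P x / ((x - p) * (q - x)) ^ n * exp (- 1 / ((x - p) * (q - x))) else 0)"

text \<open>The exponential factor beats the pole of order \<open>n\<close> at both ends of the interval, with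
  two powers to spare.\<close>
lemma bump_quadratic:
  assumes pq: "p < q"
  shows "\<exists>K. \<forall>x. \<bar>bump p q P n x\<bar> \<le> K * (x - p)\<^sup>2 \<and> \<bar>bump p q P n x\<bar> \<le> K * (x - q)\<^sup>2"
proof -
  obtain M where M: "\<And>x. x \<in> {p..q} \<Longrightarrow> \<bar>poly P x\<bar> \<le> M"
  proof -
    have "bounded (poly P ` {p..q})"
      by (intro compact_imp_bounded compact_continuous_image continuous_intros) auto
    then obtain M where "\<forall>y\<in>poly P ` {p..q}. norm y \<le> M" unfolding bounded_iff by blast
    then show ?thesis by (intro that[of M]) simp
  qed
  have "M \<ge> 0" using M[of p] pq by auto
  define k where "k = real (Suc (Suc n)) ^ Suc (Suc n)"
  have k: "k \<ge> 0" by (simp add: k_def)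
  define K where "K = M * k * (q - p)\<^sup>2"
  have D: "\<bar>bump p q P n x\<bar> \<le> M * k * ((x - p) * (q - x))\<^sup>2" if x: "p < x" "x < q" for x
  proof -
    define d where "d = (x - p) * (q - x)"
    have d: "d > 0" using x by (simp add: d_def)
    have "\<bar>bump p q P n x\<bar> = \<bar>poly P x\<bar> / d ^ n * exp (- 1 / d)"
      using x d by (simp add: bump_def d_def[symmetric] abs_mult)
    also have "\<dots> \<le> M / d ^ n * (real (Suc (Suc n)) * d) ^ Suc (Suc n)"
      using M[of x] x d \<open>M \<ge> 0\<close>
      by (intro mult_mono divide_right_mono exp_minus_inverse_le) auto
    also have "(real (Suc (Suc n)) * d) ^ Suc (Suc n) = k * (d ^ n * d\<^sup>2)"
      unfolding k_def power_mult_distrib by (simp add: power2_eq_square)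
    also have "M / d ^ n * (k * (d ^ n * d\<^sup>2)) = M * k * d\<^sup>2"
      using d by simp
    finally show ?thesis by (simp add: d_def)
  qed
  have "\<bar>bump p q P n x\<bar> \<le> K * (x - p)\<^sup>2 \<and> \<bar>bump p q P n x\<bar> \<le> K * (x - q)\<^sup>2" for x
  proof (cases "p < x \<and> x < q")
    case False
    then have "bump p q P n x = 0" by (auto simp: bump_def)
    then show ?thesis using \<open>M \<ge> 0\<close> k by (simp add: K_def)
  next
    case True
    have "M * k * ((x - p) * (q - x))\<^sup>2 \<le> M * k * ((x - p) * (q - p))\<^sup>2"
      using True \<open>M \<ge> 0\<close> k by (intro mult_left_mono power_mono) auto
    moreover have "M * k * ((x - p) * (q - x))\<^sup>2 \<le> M * k * ((q - p) * (q - x))\<^sup>2"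
      using True \<open>M \<ge> 0\<close> k by (intro mult_left_mono power_mono mult_right_mono) auto
    ultimately show ?thesis using D[of x] True
      by (simp add: K_def power_mult_distrib mult_ac power2_commute[of q x])
  qed
  then show ?thesis by blast
qed

text \<open>Inside the interval the derivative is again of the same shape, with a new polynomial and a pole of
  order \<open>n + 2\<close>; at the end points it is zero by \<open>bump_quadratic\<close>.\<close>
lemma bump_derivative:
  assumes pq: "p < q"
  shows "\<exists>Q k. \<forall>x. (bump p q P n has_real_derivative bump p q Q k x) (at x)"
proof -
  define D where "D = [:- p, 1:] * [:q, - 1:]"
  have D: "poly D x = (x - p) * (q - x)" for x by (simp add: D_def algebra_simps)
  define Q where "Q = pderiv P * D\<^sup>2 - smult (real n) (P * pderiv D * D) + P * pderiv D"
  have "(bump p q P n has_real_derivative bump p q Q (n + 2) x) (at x)" for x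
  proof (cases "p < x \<and> x < q")
    case True
    define d where "d = poly D x"
    have d: "d > 0" using True by (simp add: d_def D)
    have "((\<lambda>x. poly P x * inverse (poly D x ^ n) * exp (- inverse (poly D x))) has_real_derivative
        (poly (pderiv P) x * inverse (d ^ n) + poly P x * (- (real n * d ^ (n - 1) * poly (pderiv D) x) / (d ^ n)\<^sup>2)) * exp (- inverse d)
        + poly P x * inverse (d ^ n) * (exp (- inverse d) * (poly (pderiv D) x / d\<^sup>2))) (at x)"
      unfolding d_def using d unfolding d_def
      by (auto intro!: derivative_eq_intros simp: power2_eq_square field_simps)
    moreover have "(poly (pderiv P) x * inverse (d ^ n) + poly P x * (- (real n * d ^ (n - 1) * poly (pderiv D) x) / (d ^ n)\<^sup>2)) * exp (- inverse d)
        + poly P x * inverse (d ^ n) * (exp (- inverse d) * (poly (pderiv D) x / d\<^sup>2)) = bump p q Q (n + 2) x"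
    proof -
      have "real n * d ^ (n - 1) / (d ^ n)\<^sup>2 = real n * d / (d ^ n * d\<^sup>2)"
        using d by (cases n) (auto simp: power2_eq_square field_simps)
      moreover have "poly P x * (- (real n * d ^ (n - 1) * poly (pderiv D) x) / (d ^ n)\<^sup>2) =
          - (poly P x * poly (pderiv D) x * (real n * d ^ (n - 1) / (d ^ n)\<^sup>2))"
        by simp
      moreover have "bump p q Q (n + 2) x = poly Q x / (d ^ n * d\<^sup>2) * exp (- inverse d)"
        using True by (simp add: bump_def d_def D[symmetric] power_add inverse_eq_divide power2_eq_square)
      moreover have "poly Q x = poly (pderiv P) x * d\<^sup>2 - real n * (poly P x * poly (pderiv D) x * d) + poly P x * poly (pderiv D) x"
        by (simp add: Q_def d_def mult_ac)
      ultimately show ?thesis using d by (simp only:) (simp add: field_simps)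
    qed
    ultimately have "((\<lambda>x. poly P x * inverse (poly D x ^ n) * exp (- inverse (poly D x))) has_real_derivative
        bump p q Q (n + 2) x) (at x)" by simp
    then show ?thesis
      by (rule has_field_derivative_transform_within_open[of _ _ _ "{p<..<q}"])
         (use True in \<open>auto simp: bump_def D inverse_eq_divide\<close>)
  next
    case False
    then consider "x = p \<or> x = q" | "x < p \<or> q < x" by linarith
    then show ?thesis
    proof cases
      case 1
      obtain K where "\<forall>y. \<bar>bump p q P n y\<bar> \<le> K * (y - p)\<^sup>2 \<and> \<bar>bump p q P n y\<bar> \<le> K * (y - q)\<^sup>2"
        using bump_quadratic[OF pq] by blast
      then have "(bump p q P n has_real_derivative 0) (at x)"
        using 1 by (intro has_real_derivative_zero_if_quadratic[of _ K]) auto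
      then show ?thesis using False by (auto simp: bump_def)
    next
      case 2
      define U where "U = (if x < p then {..<p} else {q<..})"
      have U: "open U" "x \<in> U" "\<And>r. r \<in> U \<Longrightarrow> bump p q P n r = 0"
        using 2 pq by (auto simp: U_def bump_def)
      have "(bump p q P n has_real_derivative 0) (at x)"
        using has_field_derivative_transform_within_open[of "\<lambda>_. 0" 0 x U] U by auto
      then show ?thesis using False by (auto simp: bump_def)
    qed
  qed
  then show ?thesis by blast
qed

lemma continuous_on_bump: "p < q \<Longrightarrow> continuous_on A (bump p q P n)"
  using bump_derivative by (metis DERIV_isCont continuous_at_imp_continuous_on)

lemma iterated_deriv_in:
  assumes "\<And>f. f \<in> F \<Longrightarrow> deriv f \<in> F" "f \<in> F"
  shows "(deriv ^^ k) f \<in> F"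
  by (induction k) (use assms in auto)

text \<open>Differences of bumps form a class that is closed under differentiation, so no explicit formula for
  higher derivatives is needed.\<close>
lemma iterated_deriv_bump_diff:
  assumes "p < q" "p' < q'"
  shows "(deriv ^^ k) (\<lambda>x. bump p q P n x - bump p' q' P' n' x) differentiable at x"
proof -
  define F where "F = {f. \<exists>P n P' n'. f = (\<lambda>x. bump p q P n x - bump p' q' P' n' x)}"
  have F: "\<exists>g\<in>F. \<forall>x. (f has_real_derivative g x) (at x)" if f: "f \<in> F" for f
  proof -
    obtain P n P' n' where f: "f = (\<lambda>x. bump p q P n x - bump p' q' P' n' x)"
      using f by (auto simp: F_def)
    obtain Q m where 1: "\<And>x. (bump p q P n has_real_derivative bump p q Q m x) (at x)"
      using bump_derivative[OF assms(1)] by blast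
    obtain Q' m' where 2: "\<And>x. (bump p' q' P' n' has_real_derivative bump p' q' Q' m' x) (at x)"
      using bump_derivative[OF assms(2)] by blast
    have "(f has_real_derivative bump p q Q m x - bump p' q' Q' m' x) (at x)" for x
      unfolding f by (intro DERIV_diff 1 2)
    then show ?thesis by (intro bexI[of _ "\<lambda>x. bump p q Q m x - bump p' q' Q' m' x"]) (auto simp: F_def)
  qed
  have "deriv f \<in> F" if f: "f \<in> F" for f
  proof -
    obtain g where "g \<in> F" "\<forall>x. (f has_real_derivative g x) (at x)" using F[OF f] by blast
    moreover from this have "deriv f = g" by (intro ext DERIV_imp_deriv) simp
    ultimately show ?thesis by simp
  qed
  then have "(deriv ^^ k) (\<lambda>x. bump p q P n x - bump p' q' P' n' x) \<in> F"
    by (rule iterated_deriv_in) (auto simp: F_def)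
  then show ?thesis using F real_differentiable_def by blast
qed

definition mollifier :: "real \<Rightarrow> real \<Rightarrow> real \<Rightarrow> real"
  where "mollifier \<epsilon> p =
    bump (p - \<epsilon>) (p + \<epsilon>) [:1 / integral {p - \<epsilon>..p + \<epsilon>} (bump (p - \<epsilon>) (p + \<epsilon>) 1 0):] 0"

lemma mollifier:
  assumes \<epsilon>: "\<epsilon> > 0"
  shows "continuous_on A (mollifier \<epsilon> p)" and "0 \<le> mollifier \<epsilon> p x"
    and "x \<le> p - \<epsilon> \<or> p + \<epsilon> \<le> x \<Longrightarrow> mollifier \<epsilon> p x = 0"
    and "integral {p - \<epsilon>..p + \<epsilon>} (mollifier \<epsilon> p) = 1"
proof -
  let ?b = "bump (p - \<epsilon>) (p + \<epsilon>) 1 0"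
  define I where "I = integral {p - \<epsilon>..p + \<epsilon>} ?b"
  have lt: "p - \<epsilon> < p + \<epsilon>" using \<epsilon> by simp
  have cont: "continuous_on A ?b" for A by (rule continuous_on_bump[OF lt])
  have b0: "0 \<le> ?b x" for x by (simp add: bump_def)
  have "I > 0"
    unfolding I_def
    by (rule integral_pos_continuous[of _ _ _ p]) (use \<epsilon> b0 cont in \<open>auto simp: bump_def\<close>)
  have eq: "mollifier \<epsilon> p x = ?b x / I" for x by (simp add: mollifier_def bump_def I_def)
  show "continuous_on A (mollifier \<epsilon> p)" unfolding mollifier_def by (rule continuous_on_bump[OF lt])
  show "0 \<le> mollifier \<epsilon> p x" using b0 \<open>I > 0\<close> by (simp add: eq)
  show "mollifier \<epsilon> p x = 0" if "x \<le> p - \<epsilon> \<or> p + \<epsilon> \<le> x" using that by (auto simp: eq bump_def)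
  show "integral {p - \<epsilon>..p + \<epsilon>} (mollifier \<epsilon> p) = 1"
    using \<open>I > 0\<close> by (simp add: eq[abs_def] I_def)
qed

lemma mollifier_integral:
  assumes \<epsilon>: "\<epsilon> > 0" and u: "continuous_on {a..b} u" and sub: "a \<le> p - \<epsilon>" "p + \<epsilon> \<le> b"
    and osc: "\<And>x. x \<in> {p - \<epsilon>..p + \<epsilon>} \<Longrightarrow> \<bar>u x - u p\<bar> \<le> \<delta>"
  shows "\<bar>integral {a..b} (\<lambda>x. u x * mollifier \<epsilon> p x) - u p\<bar> \<le> \<delta>"
proof -
  let ?m = "mollifier \<epsilon> p" and ?I = "{p - \<epsilon>..p + \<epsilon>}"
  have "continuous_on ?I u" by (rule continuous_on_subset[OF u]) (use sub in auto)
  then have c: "continuous_on ?I (\<lambda>x. u x * ?m x)" "continuous_on ?I ?m"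
    by (intro continuous_on_mult mollifier(1)[OF \<epsilon>]; assumption)+
  have i: "(\<lambda>x. u x * ?m x) integrable_on ?I" "?m integrable_on ?I"
    by (intro integrable_continuous_real c)+
  have "((\<lambda>x. u x * ?m x) has_integral integral ?I (\<lambda>x. u x * ?m x)) {a..b}"
    using integrable_integral[OF i(1)]
    by (rule has_integral_on_superset) (use sub mollifier(3)[OF \<epsilon>] in auto)
  then have eq: "integral {a..b} (\<lambda>x. u x * ?m x) = integral ?I (\<lambda>x. u x * ?m x)"
    by (rule integral_unique)
  have "integral ?I (\<lambda>x. u x * ?m x) \<le> integral ?I (\<lambda>x. (u p + \<delta>) * ?m x)"
    by (intro integral_le i integrable_on_mult_right mult_right_mono mollifier(2)[OF \<epsilon>])
       (use osc in \<open>force simp: abs_le_iff\<close>)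
  moreover have "integral ?I (\<lambda>x. (u p - \<delta>) * ?m x) \<le> integral ?I (\<lambda>x. u x * ?m x)"
    by (intro integral_le i integrable_on_mult_right mult_right_mono mollifier(2)[OF \<epsilon>])
       (use osc in \<open>force simp: abs_le_iff\<close>)
  ultimately show ?thesis unfolding eq using mollifier(4)[OF \<epsilon>, of p] by (simp add: abs_le_iff)
qed

text \<open>A smoothed indicator function of \<open>[p, q]\<close>, obtained as the primitive of the difference
  of two mollifiers.\<close>
lemma smooth_plateau:
  assumes \<epsilon>: "\<epsilon> > 0" "p + \<epsilon> < q - \<epsilon>" and sub: "a < p - \<epsilon>" "q + \<epsilon> < b"
  obtains \<phi> where "test_function {a<..<b} \<phi>"
    "\<And>x. (\<phi> has_real_derivative (mollifier \<epsilon> p x - mollifier \<epsilon> q x)) (at x)"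
    "\<And>x. 0 \<le> \<phi> x \<and> \<phi> x \<le> 1" "\<And>x. x \<in> {p + \<epsilon>..q - \<epsilon>} \<Longrightarrow> \<phi> x = 1"
    "\<And>x. x \<le> p - \<epsilon> \<or> q + \<epsilon> \<le> x \<Longrightarrow> \<phi> x = 0"
proof -
  define k where "k x = mollifier \<epsilon> p x - mollifier \<epsilon> q x" for x
  have contm: "continuous_on A (mollifier \<epsilon> r)" for A r by (rule mollifier(1)[OF \<epsilon>(1)])
  have int: "mollifier \<epsilon> r integrable_on {x..y}" for r x y
    by (intro integrable_continuous_real contm)
  have contk: "continuous_on UNIV k" unfolding k_def by (intro continuous_intros contm)
  have full: "integral {x..y} (mollifier \<epsilon> r) = 1" if "x \<le> r - \<epsilon>" "r + \<epsilon> \<le> y" for r x y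
  proof -
    have "(mollifier \<epsilon> r has_integral 1) {r - \<epsilon>..r + \<epsilon>}"
      using integrable_integral[OF int, of r "r - \<epsilon>" "r + \<epsilon>"] mollifier(4)[OF \<epsilon>(1), of r] by simp
    then have "(mollifier \<epsilon> r has_integral 1) {x..y}"
      by (rule has_integral_on_superset) (use that mollifier(3)[OF \<epsilon>(1)] in auto)
    then show ?thesis by (rule integral_unique)
  qed
  have zero: "integral {x..y} (mollifier \<epsilon> r) = 0" if "y \<le> r - \<epsilon>" for r x y
    by (rule integral_unique, rule has_integral_is_0) (use that mollifier(3)[OF \<epsilon>(1)] in auto)
  have between: "0 \<le> integral {x..y} (mollifier \<epsilon> r)" "integral {x..y} (mollifier \<epsilon> r) \<le> 1" if "x \<le> r - \<epsilon>" for r x y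
  proof -
    show "0 \<le> integral {x..y} (mollifier \<epsilon> r)"
      by (intro integral_nonneg int mollifier(2)[OF \<epsilon>(1)])
    have "integral {x..y} (mollifier \<epsilon> r) \<le> integral {x..max y (r + \<epsilon>)} (mollifier \<epsilon> r)"
      by (intro integral_subset_le int ballI mollifier(2)[OF \<epsilon>(1)]) auto
    then show "integral {x..y} (mollifier \<epsilon> r) \<le> 1" using full[of x r "max y (r + \<epsilon>)"] that by simp
  qed
  let ?l = "p - \<epsilon>" and ?r = "q + \<epsilon>"
  have k_int: "integral {?l..x} k = integral {?l..x} (mollifier \<epsilon> p) - integral {?l..x} (mollifier \<epsilon> q)" for x
    unfolding k_def by (intro integral_diff int)
  have k0: "k x = 0" if "x \<le> ?l \<or> ?r \<le> x" for x
    using that mollifier(3)[OF \<epsilon>(1), of x p] mollifier(3)[OF \<epsilon>(1), of x q] \<epsilon> by (auto simp: k_def)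
  obtain \<phi> where \<phi>: "\<And>x. (\<phi> has_real_derivative k x) (at x)" "\<And>x. x \<le> ?l \<or> ?r \<le> x \<Longrightarrow> \<phi> x = 0"
      "\<And>x. x \<in> {?l..?r} \<Longrightarrow> \<phi> x = integral {?l..x} k"
  proof (rule compactly_supported_primitive[OF _ contk k0])
    show "integral {?l..?r} k = 0" using \<epsilon> by (simp add: k_int full)
  qed (use \<epsilon> in auto)
  have one: "\<phi> x = 1" if "x \<in> {p + \<epsilon>..q - \<epsilon>}" for x
    using that \<epsilon> by (simp add: \<phi>(3) k_int full zero)
  have range: "0 \<le> \<phi> x \<and> \<phi> x \<le> 1" for x
  proof -
    consider "x \<le> ?l \<or> ?r \<le> x" | "x \<in> {?l..q - \<epsilon>}" | "x \<in> {p + \<epsilon>..?r}" using \<epsilon> by force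
    then show ?thesis
    proof cases
      case 1
      then show ?thesis by (simp add: \<phi>(2))
    next
      case 2
      then show ?thesis using \<epsilon> between[of ?l p x] by (simp add: \<phi>(3) k_int zero)
    next
      case 3
      then show ?thesis using \<epsilon> between[of ?l q x] by (simp add: \<phi>(3) k_int full)
    qed
  qed
  have "test_function {a<..<b} \<phi>"
    unfolding test_function_def
  proof (intro conjI allI)
    fix j x
    have deriv: "deriv \<phi> = k" using \<phi>(1) by (intro ext DERIV_imp_deriv)
    show "(deriv ^^ j) \<phi> differentiable at x"
    proof (cases j)
      case 0
      then show ?thesis using \<phi>(1) real_differentiable_def by auto
    next
      case (Suc i)
      have "(deriv ^^ j) \<phi> = (deriv ^^ i) k" by (simp add: Suc funpow_Suc_right deriv del: funpow.simps)
      then show ?thesis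
        unfolding k_def[abs_def] mollifier_def using \<epsilon> by (simp add: iterated_deriv_bump_diff)
    qed
  next
    show "\<exists>K. compact K \<and> K \<subseteq> {a<..<b} \<and> (\<forall>x. x \<notin> K \<longrightarrow> \<phi> x = 0)"
      by (rule exI[of _ "{?l..?r}"]) (use \<phi>(2) sub in auto)
  qed
  then show ?thesis using that \<phi> one range unfolding k_def by blast
qed

section \<open>Sobolev functions as primitives\<close>

lemma set_integral_open_interval:
  fixes f :: "real \<Rightarrow> real"
  assumes "set_integrable lborel {a<..<b} f"
  shows "f integrable_on {a..b}" and "(LINT x:{a<..<b}|lborel. f x) = integral {a..b} f"
  using set_borel_integral_eq_integral[OF assms]
  by (simp_all add: integrable_on_open_interval_real integral_open_interval_real)

lemma set_borel_measurable_continuous_Icc: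
  fixes w :: "real \<Rightarrow> real"
  assumes "continuous_on {a..b} w"
  shows "set_borel_measurable lborel {a<..<b} w"
proof -
  have "continuous_on {a<..<b} w" by (rule continuous_on_subset[OF assms]) auto
  then show ?thesis
    using borel_measurable_continuous_on_indicator[of "{a<..<b}" w]
    unfolding set_borel_measurable_def by simp
qed

lemma set_integrable_continuous_mult:
  fixes w f :: "real \<Rightarrow> real"
  assumes w: "continuous_on {a..b} w" and f: "set_integrable lborel {a<..<b} f"
  shows "set_integrable lborel {a<..<b} (\<lambda>x. w x * f x)"
proof -
  let ?\<Omega> = "{a<..<b}"
  obtain C where C: "\<And>x. x \<in> {a..b} \<Longrightarrow> \<bar>w x\<bar> \<le> C"
    using continuous_Icc_abs_bounded[OF w] by metis
  show ?thesis
    unfolding set_integrable_def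
  proof (rule Bochner_Integration.integrable_bound)
    show "integrable lborel (\<lambda>x. C * (indicator ?\<Omega> x *\<^sub>R f x))"
      using f unfolding set_integrable_def by (rule integrable_mult_right)
    have "(\<lambda>x. (indicator ?\<Omega> x *\<^sub>R w x) * (indicator ?\<Omega> x *\<^sub>R f x)) \<in> borel_measurable lborel"
      using set_borel_measurable_continuous_Icc[OF w] borel_measurable_integrable[OF f[unfolded set_integrable_def]]
      unfolding set_borel_measurable_def by (rule borel_measurable_times)
    also have "(\<lambda>x. (indicator ?\<Omega> x *\<^sub>R w x) * (indicator ?\<Omega> x *\<^sub>R f x)) = (\<lambda>x. indicator ?\<Omega> x *\<^sub>R (w x * f x))"
      by (auto simp: fun_eq_iff indicator_def)
    finally show "(\<lambda>x. indicator ?\<Omega> x *\<^sub>R (w x * f x)) \<in> borel_measurable lborel" .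
    show "AE x in lborel. norm (indicator ?\<Omega> x *\<^sub>R (w x * f x)) \<le> norm (C * (indicator ?\<Omega> x *\<^sub>R f x))"
    proof (intro AE_I2)
      fix x
      show "norm (indicator ?\<Omega> x *\<^sub>R (w x * f x)) \<le> norm (C * (indicator ?\<Omega> x *\<^sub>R f x))"
        using C[of x] by (auto simp: indicator_def abs_mult intro!: mult_right_mono)
    qed
  qed
qed

lemma set_integrable_one: "set_integrable lborel {a<..<b::real} (\<lambda>x. 1 :: real)"
  unfolding set_integrable_def by (cases "a \<le> b") (auto simp: integrable_real_indicator)

lemma set_integrable_continuous:
  fixes w :: "real \<Rightarrow> real"
  assumes "continuous_on {a..b} w"
  shows "set_integrable lborel {a<..<b} w"
  using set_integrable_continuous_mult[OF assms set_integrable_one] by simp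

lemma square_integrable_imp_set_integrable:
  assumes "square_integrable_on f {a<..<b}"
  shows "set_integrable lborel {a<..<b} f"
  unfolding set_integrable_def
proof (rule Bochner_Integration.integrable_bound)
  show "integrable lborel (\<lambda>x. indicator {a<..<b} x *\<^sub>R (1 + (f x)\<^sup>2))"
    using set_integral_add(1)[OF set_integrable_one[of a b], of "\<lambda>x. (f x)\<^sup>2"] assms
    unfolding square_integrable_on_def set_integrable_def by simp
  show "(\<lambda>x. indicator {a<..<b} x *\<^sub>R f x) \<in> borel_measurable lborel"
    using assms unfolding square_integrable_on_def set_borel_measurable_def by simp
  have "\<bar>y\<bar> \<le> 1 + y\<^sup>2" for y :: real
    using sum_squares_bound[of 1 "\<bar>y\<bar>"] by simp
  then show "AE x in lborel. norm (indicator {a<..<b} x *\<^sub>R f x) \<le> norm (indicator {a<..<b} x *\<^sub>R (1 + (f x)\<^sup>2))"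
    by (intro AE_I2) (auto simp: indicator_def)
qed

lemma mollifier_integral_tendsto:
  fixes u :: "real \<Rightarrow> real"
  assumes u: "continuous_on {a..b} u" and p: "a < p" "p < b" and e: "\<And>n. e n > 0" "e \<longlonglongrightarrow> 0"
  shows "(\<lambda>n. integral {a..b} (\<lambda>x. u x * mollifier (e n) p x)) \<longlonglongrightarrow> u p"
proof (rule LIMSEQ_I)
  fix r :: real assume "r > 0"
  have "isCont u p" using u p by (intro continuous_on_interior[OF u]) auto
  then obtain d where d: "d > 0" "\<And>x. \<bar>x - p\<bar> < d \<Longrightarrow> \<bar>u x - u p\<bar> < r / 2"
    using \<open>r > 0\<close> unfolding continuous_at_eps_delta by (metis dist_real_def half_gt_zero)
  have "\<forall>\<^sub>F n in sequentially. e n < Min {d, p - a, b - p}"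
    using d p by (intro order_tendstoD(2)[OF e(2)]) auto
  then obtain n0 where n0: "\<And>n. n \<ge> n0 \<Longrightarrow> e n < d \<and> e n < p - a \<and> e n < b - p"
    unfolding eventually_sequentially by auto
  show "\<exists>no. \<forall>n\<ge>no. norm (integral {a..b} (\<lambda>x. u x * mollifier (e n) p x) - u p) < r"
  proof (intro exI allI impI)
    fix n assume "n0 \<le> n"
    from n0[OF this] have n: "e n < d" "e n < p - a" "e n < b - p" by auto
    have "\<bar>integral {a..b} (\<lambda>x. u x * mollifier (e n) p x) - u p\<bar> \<le> r / 2"
    proof (rule mollifier_integral[OF e(1) u])
      fix x assume "x \<in> {p - e n..p + e n}"
      then have "\<bar>x - p\<bar> < d" using n by (auto simp: abs_if)
      then show "\<bar>u x - u p\<bar> \<le> r / 2" using d(2) less_imp_le by blast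
    qed (use n in auto)
    then show "norm (integral {a..b} (\<lambda>x. u x * mollifier (e n) p x) - u p) < r"
      using \<open>r > 0\<close> by simp
  qed
qed

text \<open>The weak derivative is tested against smoothed indicator functions of \<open>[p, q]\<close>. The
  left-hand side then tends to \<open>u p - u q\<close> by continuity, and the right-hand side to minus the
  integral of \<open>u'\<close> by dominated convergence.\<close>
lemma H1_deriv_interior:
  assumes H: "H1_deriv c u u'" and pq: "0 < p" "p < q" "q < c"
  shows "integral {p..q} u' = u q - u p"
proof -
  have u: "continuous_on {0..c} u" and weak: "weak_derivative_on {0<..<c} u u'"
    and u': "set_integrable lborel {0<..<c} u'"
    using H square_integrable_imp_set_integrable unfolding H1_deriv_def by auto
  \<comment> \<open>Small enough for the two mollifiers to have disjoint supports inside \<open>(0, c)\<close>.\<close>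
  define e0 where "e0 = Min {p, c - q, (q - p) / 2} / 2"
  have e0: "e0 > 0" "e0 < p" "e0 < c - q" "e0 < (q - p) / 2"
    using pq by (auto simp: e0_def min_def)
  define e where "e n = e0 / real (Suc n)" for n
  have e: "e n > 0" "e n \<le> e0" for n
    using e0(1) by (auto simp: e_def divide_simps mult_le_cancel_left1)
  have e_lim: "e \<longlonglongrightarrow> 0"
    unfolding e_def using LIMSEQ_Suc[OF lim_const_over_n[of e0]] by simp
  have "\<exists>\<phi>. test_function {0<..<c} \<phi> \<and>
      (\<forall>x. (\<phi> has_real_derivative (mollifier (e n) p x - mollifier (e n) q x)) (at x)) \<and>
      (\<forall>x. 0 \<le> \<phi> x \<and> \<phi> x \<le> 1) \<and> (\<forall>x\<in>{p + e n..q - e n}. \<phi> x = 1) \<and>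
      (\<forall>x. x \<le> p - e n \<or> q + e n \<le> x \<longrightarrow> \<phi> x = 0)" for n
  proof -
    have "p + e n < q - e n" "0 < p - e n" "q + e n < c" using e[of n] e0 by (auto simp: field_simps)
    then show ?thesis by (rule smooth_plateau[OF e(1)]) blast
  qed
  then obtain \<phi> where test: "\<And>n. test_function {0<..<c} (\<phi> n)"
    and d\<phi>: "\<And>n x. (\<phi> n has_real_derivative (mollifier (e n) p x - mollifier (e n) q x)) (at x)"
    and range: "\<And>n x. 0 \<le> \<phi> n x \<and> \<phi> n x \<le> 1"
    and one: "\<And>n x. x \<in> {p + e n..q - e n} \<Longrightarrow> \<phi> n x = 1"
    and zero: "\<And>n x. x \<le> p - e n \<or> q + e n \<le> x \<Longrightarrow> \<phi> n x = 0"
    by metis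
  have cont\<phi>: "continuous_on A (\<phi> n)" for A n
    by (rule DERIV_continuous_on[OF has_field_derivative_at_within[OF d\<phi>]])
  have int_u': "u' integrable_on {0..c}" "(\<lambda>x. \<bar>u' x\<bar>) integrable_on {0..c}"
    using set_integral_open_interval(1)[OF u'] set_integral_open_interval(1)[OF set_integrable_abs[OF u']] by auto
  have int_\<phi>: "set_integrable lborel {0<..<c} (\<lambda>x. u' x * \<phi> n x)" for n
    using set_integrable_continuous_mult[OF cont\<phi>[of "{0..c}" n] u'] by (simp add: mult.commute)
  have ibp: "integral {0..c} (\<lambda>x. u' x * \<phi> n x) =
      integral {0..c} (\<lambda>x. u x * mollifier (e n) q x) - integral {0..c} (\<lambda>x. u x * mollifier (e n) p x)" for n
  proof -
    have d: "deriv (\<phi> n) = (\<lambda>x. mollifier (e n) p x - mollifier (e n) q x)"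
      using d\<phi> by (intro ext DERIV_imp_deriv)
    have m: "(\<lambda>x. u x * mollifier (e n) r x) integrable_on {0..c}" for r
      by (intro integrable_continuous_real continuous_on_mult u mollifier(1) e)
    have "set_integrable lborel {0<..<c} (\<lambda>x. u x * deriv (\<phi> n) x)"
      unfolding d by (intro set_integrable_continuous continuous_on_mult continuous_on_diff u mollifier(1) e)
    then have "integral {0..c} (\<lambda>x. u x * deriv (\<phi> n) x) = - integral {0..c} (\<lambda>x. u' x * \<phi> n x)"
      using weak test[of n] set_integral_open_interval(2)[OF int_\<phi>[of n]]
        set_integral_open_interval(2) unfolding weak_derivative_on_def by force
    moreover have "integral {0..c} (\<lambda>x. u x * deriv (\<phi> n) x) =
        integral {0..c} (\<lambda>x. u x * mollifier (e n) p x) - integral {0..c} (\<lambda>x. u x * mollifier (e n) q x)"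
      unfolding d right_diff_distrib by (intro integral_diff m)
    ultimately show ?thesis by simp
  qed
  have "(\<lambda>n. integral {0..c} (\<lambda>x. u' x * \<phi> n x)) \<longlonglongrightarrow> u q - u p"
    unfolding ibp using pq by (intro tendsto_diff mollifier_integral_tendsto u e e_lim) auto
  moreover have "(\<lambda>n. integral {0..c} (\<lambda>x. u' x * \<phi> n x)) \<longlonglongrightarrow> integral {p..q} u'"
  proof -
    define f where "f n x = (if x \<in> {p, q} then 0 else u' x * \<phi> n x)" for n x
    define g where "g x = (if x \<in> {p<..<q} then u' x else 0)" for x
    have f_int: "f n integrable_on {0..c}" for n
      by (rule integrable_spike_finite[of "{p, q}" _ _ "\<lambda>x. u' x * \<phi> n x"])
         (use set_integral_open_interval(1)[OF int_\<phi>] in \<open>auto simp: f_def\<close>)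
    have "(\<lambda>n. integral {0..c} (f n)) \<longlonglongrightarrow> integral {0..c} g"
    proof (rule dominated_convergence(2)[OF f_int int_u'(2)])
      fix n x
      have "\<bar>u' x * \<phi> n x\<bar> \<le> \<bar>u' x\<bar> * 1"
        unfolding abs_mult using range[of n x] by (intro mult_left_mono) auto
      then show "norm (f n x) \<le> \<bar>u' x\<bar>" by (simp add: f_def)
    next
      fix x
      have "\<forall>\<^sub>F n in sequentially. f n x = g x"
      proof (cases "x \<in> {p, q}")
        case True
        then show ?thesis by (auto simp: f_def g_def)
      next
        case False
        have "\<forall>\<^sub>F n in sequentially. e n < min \<bar>x - p\<bar> \<bar>x - q\<bar>"
          using False by (intro order_tendstoD(2)[OF e_lim]) auto
        then show ?thesis
        proof (rule eventually_mono)
          fix n assume n: "e n < min \<bar>x - p\<bar> \<bar>x - q\<bar>"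
          show "f n x = g x"
          proof (cases "x \<in> {p<..<q}")
            case True
            then show ?thesis using False one[of x n] n by (auto simp: f_def g_def)
          next
            case out: False
            then show ?thesis using False zero[of x n] n by (auto simp: f_def g_def)
          qed
        qed
      qed
      then show "(\<lambda>n. f n x) \<longlonglongrightarrow> g x" by (rule tendsto_eventually)
    qed
    moreover have "integral {0..c} (f n) = integral {0..c} (\<lambda>x. u' x * \<phi> n x)" for n
      by (rule integral_spike[of "{p, q}"]) (auto simp: f_def)
    moreover have "integral {0..c} g = integral {p..q} u'"
    proof -
      have "integral {0..c} g = integral {p<..<q} u'"
        using pq unfolding g_def integral_restrict_Int
        by (intro arg_cong2[where f = integral] refl) auto
      then show ?thesis by (simp add: integral_open_interval_real)
    qed
    ultimately show ?thesis by simp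
  qed
  ultimately show ?thesis by (metis LIMSEQ_unique)
qed

lemma H1_deriv_imp_L2_derivative:
  assumes H: "H1_deriv c u u'" and c: "c > 0"
  shows "L2_derivative 0 c u u'"
proof -
  have u: "continuous_on {0..c} u" and u': "set_integrable lborel {0<..<c} u'"
    and sq: "set_integrable lborel {0<..<c} (\<lambda>x. (u' x)\<^sup>2)"
    using H square_integrable_imp_set_integrable unfolding H1_deriv_def square_integrable_on_def by auto
  have int: "u' integrable_on {0..c}" by (rule set_integral_open_interval(1)[OF u'])
  define \<Delta> where "\<Delta> x = u x - integral {0..x} u'" for x
  have cont: "continuous_on {0..c} \<Delta>"
    unfolding \<Delta>_def by (intro continuous_on_diff u indefinite_integral_continuous_1 int)
  have sub: "u' integrable_on {x..y}" if "0 \<le> x" "y \<le> c" for x y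
    using integrable_on_subinterval[OF int, of x y] that by auto
  have eq: "integral {0..y} u' - integral {0..x} u' = integral {x..y} u'" if "0 \<le> x" "x \<le> y" "y \<le> c" for x y
    using integral_split[of 0 x y u'] sub[of 0 y] that by simp
  have const: "\<Delta> x = \<Delta> y" if "x \<in> {0<..<c}" "y \<in> {0<..<c}" "x < y" for x y
    using H1_deriv_interior[OF H, of x y] eq[of x y] that by (simp add: \<Delta>_def)
  have mid: "\<Delta> x = \<Delta> (c / 2)" if "x \<in> {0<..<c}" for x
  proof -
    have "c / 2 \<in> {0<..<c}" using c by auto
    then show ?thesis
      using const[OF that, of "c / 2"] const[of "c / 2" x] that
      by (cases x "c / 2" rule: linorder_cases) metis+
  qed
  have cl: "closure {0<..<c} = {0..c}" using c by simp
  have all: "\<Delta> x = \<Delta> (c / 2)" if "x \<in> {0..c}" for x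
    by (rule continuous_constant_on_closure[of "{0<..<c}"]) (use cont that cl mid in \<open>simp_all only:\<close>)
  show ?thesis
    unfolding L2_derivative_def
  proof (intro conjI allI impI)
    fix x y assume xy: "0 \<le> x" "x \<le> y" "y \<le> c"
    have "u y - u x = integral {x..y} u'"
      using all[of x] all[of y] eq[OF xy] xy by (simp add: \<Delta>_def)
    then show "(u' has_integral (u y - u x)) {x..y}"
      using integrable_integral[OF sub[of x y]] xy by simp
  qed (rule set_integral_open_interval(1)[OF sq])
qed

text \<open>Integration by parts. It provides the members of the two families of the theorem that show that
  neither of them is empty.\<close>
lemma C1_imp_H1_deriv:
  assumes f: "\<And>x. (f has_real_derivative g x) (at x)" and g: "continuous_on UNIV g" and c: "c > 0"
  shows "H1_deriv c f g"
proof -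
  have contf: "continuous_on A f" for A
    by (rule DERIV_continuous_on[OF has_field_derivative_at_within[OF f]])
  have contg: "continuous_on A g" for A using g continuous_on_subset by blast
  have sq: "square_integrable_on h {0<..<c}" if "continuous_on {0..c} h" for h
    unfolding square_integrable_on_def
    by (intro conjI set_borel_measurable_continuous_Icc set_integrable_continuous that continuous_intros)
  have "weak_derivative_on {0<..<c} f g"
    unfolding weak_derivative_on_def
  proof (intro allI impI)
    fix \<phi> assume test: "test_function {0<..<c} \<phi>"
    have "(deriv ^^ 0) \<phi> differentiable at x" "(deriv ^^ 1) \<phi> differentiable at x" for x
      using test unfolding test_function_def by blast+
    then have d: "(\<phi> has_real_derivative deriv \<phi> x) (at x)" and d2: "deriv \<phi> differentiable at x" for x
      by (auto simp: DERIV_deriv_iff_real_differentiable)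
    have cont\<phi>: "continuous_on A \<phi>" for A
      by (rule DERIV_continuous_on[OF has_field_derivative_at_within[OF d]])
    have contd: "continuous_on A (deriv \<phi>)" for A
      using d2 by (meson continuous_at_imp_continuous_on differentiable_imp_continuous_within)
    have ends: "\<phi> 0 = 0" "\<phi> c = 0"
      using test unfolding test_function_def by (meson greaterThanLessThan_iff less_irrefl subsetD)+
    have "((\<lambda>x. f x * deriv \<phi> x + g x * \<phi> x) has_integral (f c * \<phi> c - f 0 * \<phi> 0)) {0..c}"
    proof (rule fundamental_theorem_of_calculus)
      fix x
      have "((\<lambda>x. f x * \<phi> x) has_real_derivative (f x * deriv \<phi> x + g x * \<phi> x)) (at x)"
        using DERIV_mult[OF f d] by (simp add: algebra_simps)
      then show "((\<lambda>x. f x * \<phi> x) has_vector_derivative (f x * deriv \<phi> x + g x * \<phi> x)) (at x within {0..c})"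
        unfolding has_real_derivative_iff_has_vector_derivative
        by (rule has_vector_derivative_at_within)
    qed (use c in simp)
    then have "integral {0..c} (\<lambda>x. f x * deriv \<phi> x + g x * \<phi> x) = 0"
      using ends by (simp add: integral_unique)
    moreover have "integral {0..c} (\<lambda>x. f x * deriv \<phi> x + g x * \<phi> x) =
        integral {0..c} (\<lambda>x. f x * deriv \<phi> x) + integral {0..c} (\<lambda>x. g x * \<phi> x)"
      by (intro integral_add integrable_continuous_real continuous_intros contf contg cont\<phi> contd)
    moreover have "(LINT x:{0<..<c}|lborel. f x * deriv \<phi> x) = integral {0..c} (\<lambda>x. f x * deriv \<phi> x)"
      "(LINT x:{0<..<c}|lborel. g x * \<phi> x) = integral {0..c} (\<lambda>x. g x * \<phi> x)"
      by (intro set_integral_open_interval set_integrable_continuous continuous_intros contf contg cont\<phi> contd)+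
    ultimately show "(LINT x:{0<..<c}|lborel. f x * deriv \<phi> x) = - (LINT x:{0<..<c}|lborel. g x * \<phi> x)"
      by simp
  qed
  then show ?thesis
    unfolding H1_deriv_def using contf contg sq by blast
qed

section \<open>The norm estimate\<close>

text \<open>Gronwall's inequality backwards in time: \<open>abs (\<theta> r)\<close> is at most \<open>1\<close>
  plus its integral from \<open>r\<close> to \<open>b\<close>, and \<open>exp r\<close> times that bound is
  increasing in \<open>r\<close>. This makes the supremum of the theorem a supremum of a bounded set.\<close>
lemma abs_le_exp_of_L2_derivative_le:
  assumes \<theta>: "L2_derivative 0 b \<theta> \<theta>'" and b: "b > 0" and end1: "\<theta> b = 1"
    and le: "\<And>s. s \<in> {0..b} \<Longrightarrow> \<bar>\<theta>' s\<bar> \<le> \<bar>\<theta> s\<bar>" and s: "s \<in> {0..b}"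
  shows "\<bar>\<theta> s\<bar> \<le> exp b"
proof -
  have cont: "continuous_on {0..b} (\<lambda>r. \<bar>\<theta> r\<bar>)"
    by (intro continuous_intros L2_derivative_continuous[OF \<theta>])
  define F where "F r = integral {0..r} (\<lambda>r. \<bar>\<theta> r\<bar>)" for r
  define P where "P r = exp r * (1 + F b - F r)" for r
  have int: "(\<lambda>r. \<bar>\<theta> r\<bar>) integrable_on {x..y}" if "0 \<le> x" "y \<le> b" for x y
    by (intro integrable_continuous_real continuous_on_subset[OF cont]) (use that in auto)
  have bound: "\<bar>\<theta> r\<bar> \<le> 1 + F b - F r" if r: "r \<in> {0..b}" for r
  proof -
    have I: "(\<theta>' has_integral (\<theta> b - \<theta> r)) {r..b}"
      using L2_derivativeD(1)[OF \<theta>, of r b] r by simp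
    have "norm (integral {r..b} \<theta>') \<le> integral {r..b} (\<lambda>r. \<bar>\<theta> r\<bar>)"
      by (rule integral_norm_bound_integral) (use I int r le in auto)
    also have "integral {r..b} (\<lambda>r. \<bar>\<theta> r\<bar>) = F b - F r"
      unfolding F_def using integral_split[of 0 r b "\<lambda>r. \<bar>\<theta> r\<bar>"] int r by simp
    finally show ?thesis using integral_unique[OF I] end1 by (simp add: abs_if split: if_splits)
  qed
  have dF: "(F has_real_derivative \<bar>\<theta> r\<bar>) (at r within {0..b})" if "r \<in> {0..b}" for r
    unfolding F_def by (rule integral_has_real_derivative[OF cont that])
  have "((\<lambda>r. exp r * (1 + F b - F r - \<bar>\<theta> r\<bar>)) has_integral (P b - P s)) {s..b}"
  proof (rule fundamental_theorem_of_calculus)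
    fix r assume r: "r \<in> {s..b}"
    have "(P has_real_derivative (exp r * (1 + F b - F r - \<bar>\<theta> r\<bar>))) (at r within {0..b})"
      unfolding P_def using r s
      by (auto intro!: derivative_eq_intros dF simp: algebra_simps)
    then have "(P has_real_derivative (exp r * (1 + F b - F r - \<bar>\<theta> r\<bar>))) (at r within {s..b})"
      by (rule DERIV_subset) (use s in auto)
    then show "(P has_vector_derivative (exp r * (1 + F b - F r - \<bar>\<theta> r\<bar>))) (at r within {s..b})"
      by (simp add: has_real_derivative_iff_has_vector_derivative)
  qed (use s in auto)
  then have "0 \<le> P b - P s"
  proof (rule has_integral_nonneg)
    fix r assume "r \<in> {s..b}"
    then show "0 \<le> exp r * (1 + F b - F r - \<bar>\<theta> r\<bar>)"
      using bound[of r] s by (intro mult_nonneg_nonneg) auto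
  qed
  then have "exp s * (1 + F b - F s) \<le> exp b" by (simp add: P_def)
  have "\<bar>\<theta> s\<bar> \<le> 1 * (1 + F b - F s)" using bound[OF s] by simp
  also have "\<dots> \<le> exp s * (1 + F b - F s)"
    using bound[OF s] s by (intro mult_right_mono) auto
  also have "\<dots> \<le> exp b" by fact
  finally show ?thesis .
qed

lemma AE_lborel_negligible:
  assumes "AE s in lborel. P s"
  obtains N where "negligible N" "\<And>s. s \<notin> N \<Longrightarrow> P s"
proof -
  obtain N where N: "{s \<in> space lborel. \<not> P s} \<subseteq> N" "N \<in> null_sets lborel"
    using assms by (auto elim: AE_E3 simp: eventually_ae_filter)
  then have "negligible N"
    by (simp add: negligible_iff_null_sets null_sets_completionI)
  then show ?thesis using that N(1) by auto
qed

context contractive_resolvent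
begin

text \<open>The energy inequality for the cut-off that follows \<open>u\<close>, an exponential, and the time
  reversal of \<open>\<theta>\<close>.\<close>
lemma rising_and_falling_energy:
  fixes a b t :: real and m :: "real \<Rightarrow> real"
  assumes m: "continuous_on {0..} m" "\<And>s. s \<ge> 0 \<Longrightarrow> m s > 0" "\<And>s. s \<ge> 0 \<Longrightarrow> onorm (S s) \<le> m s"
    and ab: "a > 0" "b > 0" "t \<ge> a + b"
    and u: "L2_derivative 0 a u u'" "u 0 = 0" "u a = 1"
    and \<theta>: "L2_derivative 0 b \<theta> \<theta>'" "\<theta> b = 1"
    and slope: "\<And>s. s \<in> {0..b} \<Longrightarrow> \<bar>\<theta>' s\<bar> \<le> \<bar>\<theta> s\<bar>"
  shows "(exp (t - a - b) * norm (S t x))\<^sup>2 * integral {0..b} (\<lambda>s. 1 / (m s)\<^sup>2 * ((\<theta> s)\<^sup>2 - (\<theta>' s)\<^sup>2))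
    \<le> integral {0..a} (\<lambda>s. (m s)\<^sup>2 * max ((u' s)\<^sup>2 - (u s)\<^sup>2) 0) * (norm x)\<^sup>2"
proof -
  have Sm: "norm (S s y) \<le> m s * norm y" if "s \<ge> 0" for s y
    using onorm[OF bounded_linear_S[OF that], of y] m(3)[OF that]
    by (meson mult_right_mono norm_ge_zero order_trans)
  have contm: "continuous_on {0..c} m" for c by (rule continuous_on_subset[OF m(1)]) auto
  obtain B where B: "B > 0" "\<And>s. s \<in> {0..1} \<Longrightarrow> \<bar>m s\<bar> \<le> B"
    using continuous_Icc_abs_bounded[OF contm[of 1]] by metis
  have loc: "norm (S s y) \<le> (B + 1) * norm y" if "s \<in> {0..1}" for s y
  proof -
    have "m s \<le> B + 1" using B(2)[OF that] by linarith
    then show ?thesis using Sm[of s y] that by (meson atLeastAtMost_iff mult_right_mono norm_ge_zero order_trans)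
  qed
  obtain C where C: "\<forall>s\<ge>0. norm (S s x) \<le> C"
    using orbit_bounded[OF loc] B(1) by auto
  define f where "f s = (norm (S s x))\<^sup>2" for s
  have contf: "continuous_on {p..q} f" if "p \<ge> 0" for p q
    unfolding f_def by (intro continuous_intros continuous_on_S_Icc that)
  \<comment> \<open>The value of the exponential piece at time \<open>t - b\<close>, where it meets \<open>c * \<theta> b = c\<close>.\<close>
  define c where "c = exp (t - a - b)"
  define \<psi> where "\<psi> s = (if s \<le> a then u s else if s \<le> t - b then exp (s - a) else c * \<theta> (t - s))" for s
  define g where "g s = (if s < a then u' s else if s < t - b then exp (s - a) else - c * \<theta>' (t - s))" for s
  have 1: "L2_derivative 0 a \<psi> g"
    by (rule L2_derivative_cong[OF u(1)]) (auto simp: \<psi>_def g_def)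
  have 2: "L2_derivative a (t - b) \<psi> g"
  proof (rule L2_derivative_cong)
    show "L2_derivative a (t - b) (\<lambda>s. exp (s - a)) (\<lambda>s. exp (s - a))"
      by (intro L2_derivative_C1) (auto intro!: derivative_eq_intros continuous_intros)
  qed (auto simp: \<psi>_def g_def u)
  have 3: "L2_derivative (t - b) t \<psi> g"
  proof (rule L2_derivative_cong[OF L2_derivative_scaled_reflection[OF \<theta>(1), of t c]])
    fix s assume "s \<in> {t - b..t}"
    then show "\<psi> s = c * \<theta> (t - s)"
      using ab \<theta>(2) u(3) by (cases "s = t - b") (auto simp: \<psi>_def c_def algebra_simps)
  qed (use ab in \<open>auto simp: g_def\<close>)
  have 12: "L2_derivative 0 (t - b) \<psi> g" using ab by (intro L2_derivative_combine[OF 1 2]) auto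
  have 123: "L2_derivative 0 t \<psi> g" using ab by (intro L2_derivative_combine[OF 12 3]) auto
  define q where "q s = f s * ((\<psi> s)\<^sup>2 - (g s)\<^sup>2)" for s
  have int: "q integrable_on {0..t}" "q integrable_on {0..t - b}" "q integrable_on {0..a}" "q integrable_on {t - b..t}"
    unfolding q_def using ab
    by (intro L2_weighted_integrable(3)[OF 123]
        L2_weighted_integrable(3)[OF 12] L2_weighted_integrable(3)[OF 1]
        L2_weighted_integrable(3)[OF 3] contf; simp)+
  have "integral {0..t} q \<le> 0"
  proof -
    have "\<psi> 0 = 0" using u(2) ab by (simp add: \<psi>_def)
    then show ?thesis
      using weighted_energy_bounded_orbit[of t 0 \<psi> g x C] 123 C ab by (simp add: q_def[abs_def] f_def)
  qed
  moreover have "integral {0..t} q = integral {0..a} q + integral {a..t - b} q + integral {t - b..t} q"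
    using integral_split[of 0 "t - b" t q]
      integral_split[of 0 a "t - b" q] int ab by auto
  moreover have "integral {a..t - b} q = integral {a..t - b} (\<lambda>_. 0)"
    by (rule integral_spike[of "{a, t - b}"]) (auto simp: q_def \<psi>_def g_def)
  moreover have "- (integral {0..a} (\<lambda>s. (m s)\<^sup>2 * max ((u' s)\<^sup>2 - (u s)\<^sup>2) 0) * (norm x)\<^sup>2) \<le> integral {0..a} q"
  proof -
    define M where "M s = max ((u' s)\<^sup>2 - (u s)\<^sup>2) 0" for s
    have M_int: "M integrable_on {0..a}"
    proof (rule measurable_bounded_by_integrable_imp_integrable[OF _ L2_derivativeD(2)[OF u(1)]])
      have "u \<in> borel_measurable (lebesgue_on {0..a})"
        by (intro continuous_imp_measurable_on_sets_lebesgue L2_derivative_continuous[OF u(1)]) auto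
      moreover have "u' \<in> borel_measurable (lebesgue_on {0..a})"
        by (rule integrable_imp_measurable[OF L2_derivative_integrable[OF u(1)]])
      ultimately show "M \<in> borel_measurable (lebesgue_on {0..a})"
        unfolding M_def
        by (intro borel_measurable_max borel_measurable_diff borel_measurable_power borel_measurable_const)
      show "norm (M s) \<le> (u' s)\<^sup>2" for s by (simp add: M_def)
    qed auto
    have mM: "(\<lambda>s. (m s)\<^sup>2 * M s) integrable_on {0..a}"
      by (intro integrable_continuous_mult continuous_intros contm M_int) (auto simp: M_def)
    have "integral {0..a} (\<lambda>s. - ((norm x)\<^sup>2 * ((m s)\<^sup>2 * M s))) \<le> integral {0..a} (\<lambda>s. f s * ((u s)\<^sup>2 - (u' s)\<^sup>2))"
    proof (rule integral_le)
      show "(\<lambda>s. - ((norm x)\<^sup>2 * ((m s)\<^sup>2 * M s))) integrable_on {0..a}"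
        by (intro integrable_neg integrable_on_mult_right mM)
      show "(\<lambda>s. f s * ((u s)\<^sup>2 - (u' s)\<^sup>2)) integrable_on {0..a}"
        by (intro L2_weighted_integrable(3)[OF u(1)] contf) simp
      fix s assume s: "s \<in> {0..a}"
      have "f s \<le> (m s * norm x)\<^sup>2" unfolding f_def using Sm[of s x] s by (intro power_mono) auto
      then have "f s * M s \<le> (m s * norm x)\<^sup>2 * M s" by (intro mult_right_mono) (auto simp: M_def)
      moreover have "f s * - M s \<le> f s * ((u s)\<^sup>2 - (u' s)\<^sup>2)"
        by (intro mult_left_mono) (auto simp: M_def f_def)
      ultimately show "- ((norm x)\<^sup>2 * ((m s)\<^sup>2 * M s)) \<le> f s * ((u s)\<^sup>2 - (u' s)\<^sup>2)"
        by (simp add: power_mult_distrib mult_ac)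
    qed
    also have "\<dots> = integral {0..a} q"
      by (rule integral_spike[of "{a}"]) (auto simp: q_def \<psi>_def g_def)
    finally show ?thesis by (simp add: M_def[symmetric] mult.commute)
  qed
  moreover have "(c * norm (S t x))\<^sup>2 * integral {0..b} (\<lambda>s. 1 / (m s)\<^sup>2 * ((\<theta> s)\<^sup>2 - (\<theta>' s)\<^sup>2)) \<le> integral {t - b..t} q"
  proof -
    define J where "J s = 1 / (m s)\<^sup>2 * ((\<theta> s)\<^sup>2 - (\<theta>' s)\<^sup>2)" for s
    have J_int: "J integrable_on {0..b}"
      unfolding J_def
      by (intro L2_weighted_integrable(3)[OF \<theta>(1)] continuous_intros contm)
         (use m(2) in \<open>force dest: order.strict_implies_not_eq\<close>)
    have "((\<lambda>s. J (t - s)) has_integral integral {0..b} J) {t - b..t - 0}"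
      by (rule has_integral_reflect_about[OF integrable_integral[OF J_int]])
    then have Jr: "((\<lambda>s. (c * norm (S t x))\<^sup>2 * J (t - s)) has_integral (c * norm (S t x))\<^sup>2 * integral {0..b} J) {t - b..t}"
      by (intro has_integral_mult_right) simp
    have qr: "(q has_integral integral {t - b..t} q) {t - b..t}" using int(4) by (rule integrable_integral)
    have q': "((\<lambda>s. c\<^sup>2 * (f s * ((\<theta> (t - s))\<^sup>2 - (\<theta>' (t - s))\<^sup>2))) has_integral integral {t - b..t} q) {t - b..t}"
      by (rule has_integral_spike_finite[OF _ _ qr, of "{t - b}"])
         (use ab in \<open>auto simp: q_def \<psi>_def g_def power_mult_distrib algebra_simps\<close>)
    have "(c * norm (S t x))\<^sup>2 * integral {0..b} J \<le> integral {t - b..t} q"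
    proof (rule has_integral_le[OF Jr q'])
      fix s assume s: "s \<in> {t - b..t}"
      have m_pos: "m (t - s) > 0" using m(2)[of "t - s"] s by simp
      have "S t x = S (t - s) (S s x)" using S_add[of "t - s" s x] s ab by simp
      then have "norm (S t x) \<le> m (t - s) * norm (S s x)" using Sm[of "t - s" "S s x"] s by simp
      then have "(norm (S t x))\<^sup>2 \<le> (m (t - s) * norm (S s x))\<^sup>2" by (intro power_mono) auto
      then have *: "(norm (S t x))\<^sup>2 * (1 / (m (t - s))\<^sup>2) \<le> f s"
        using m_pos by (simp add: f_def power_mult_distrib field_simps)
      have "(\<theta>' (t - s))\<^sup>2 \<le> (\<theta> (t - s))\<^sup>2" using slope[of "t - s"] s by (simp add: abs_le_square_iff)
      then have "c\<^sup>2 * (((norm (S t x))\<^sup>2 * (1 / (m (t - s))\<^sup>2)) * ((\<theta> (t - s))\<^sup>2 - (\<theta>' (t - s))\<^sup>2))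
          \<le> c\<^sup>2 * (f s * ((\<theta> (t - s))\<^sup>2 - (\<theta>' (t - s))\<^sup>2))"
        by (intro mult_left_mono mult_right_mono *) auto
      then show "(c * norm (S t x))\<^sup>2 * J (t - s) \<le> c\<^sup>2 * (f s * ((\<theta> (t - s))\<^sup>2 - (\<theta>' (t - s))\<^sup>2))"
        by (simp add: J_def power_mult_distrib mult.assoc)
    qed
    then show ?thesis unfolding J_def[abs_def] .
  qed
  ultimately show ?thesis unfolding c_def by simp
qed

end

lemma rising_cost_eq:
  assumes H: "H1_deriv a u u'" and m: "continuous_on {0..} m"
  shows "(LINT s:{0<..<a}|lborel. (m s)\<^sup>2 * max ((u' s)\<^sup>2 - (u s)\<^sup>2) 0) =
    integral {0..a} (\<lambda>s. (m s)\<^sup>2 * max ((u' s)\<^sup>2 - (u s)\<^sup>2) 0)"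
proof (intro set_integral_open_interval(2) set_integrable_continuous_mult)
  show "continuous_on {0..a} (\<lambda>s. (m s)\<^sup>2)"
    by (intro continuous_intros continuous_on_subset[OF m]) auto
  have d: "set_integrable lborel {0<..<a} (\<lambda>s. (u' s)\<^sup>2 - (u s)\<^sup>2)"
    using H unfolding H1_deriv_def square_integrable_on_def by (intro set_integral_diff) auto
  have "(\<lambda>s. indicator {0<..<a} s *\<^sub>R max ((u' s)\<^sup>2 - (u s)\<^sup>2) 0) =
      (\<lambda>s. max (indicator {0<..<a} s *\<^sub>R ((u' s)\<^sup>2 - (u s)\<^sup>2)) 0)"
    by (auto simp: fun_eq_iff indicator_def)
  then show "set_integrable lborel {0<..<a} (\<lambda>s. max ((u' s)\<^sup>2 - (u s)\<^sup>2) 0)"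
    using d unfolding set_integrable_def by (simp only:) (intro integrable_max integrable_zero)
qed

lemma falling_gain_eq:
  assumes H: "H1_deriv b \<theta> \<theta>'" and m: "continuous_on {0..} m" "\<And>s. s \<ge> 0 \<Longrightarrow> m s > 0"
  shows "(LINT s:{0<..<b}|lborel. 1 / (m s)\<^sup>2 * ((\<theta> s)\<^sup>2 - (\<theta>' s)\<^sup>2)) =
    integral {0..b} (\<lambda>s. 1 / (m s)\<^sup>2 * ((\<theta> s)\<^sup>2 - (\<theta>' s)\<^sup>2))"
proof (intro set_integral_open_interval(2) set_integrable_continuous_mult)
  show "continuous_on {0..b} (\<lambda>s. 1 / (m s)\<^sup>2)"
    by (intro continuous_intros continuous_on_subset[OF m(1)])
       (use m(2) in \<open>force dest: order.strict_implies_not_eq\<close>)+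
  show "set_integrable lborel {0<..<b} (\<lambda>s. (\<theta> s)\<^sup>2 - (\<theta>' s)\<^sup>2)"
    using H unfolding H1_deriv_def square_integrable_on_def by (intro set_integral_diff) auto
qed

text \<open>Changing the weak derivative on a null set makes the bound on the slope hold everywhere.\<close>
lemma slope_bound_representative:
  assumes \<theta>: "H1_deriv b \<theta> \<theta>'" and b: "b > 0"
    and slope: "AE s in lborel. s \<in> {0<..<b} \<longrightarrow> \<bar>\<theta>' s\<bar> \<le> \<theta> s"
  obtains \<eta> where "L2_derivative 0 b \<theta> \<eta>" "\<forall>s. \<bar>\<eta> s\<bar> \<le> \<bar>\<theta> s\<bar>"
    "\<forall>w. integral {0..b} (\<lambda>s. w s * ((\<theta> s)\<^sup>2 - (\<theta>' s)\<^sup>2)) = integral {0..b} (\<lambda>s. w s * ((\<theta> s)\<^sup>2 - (\<eta> s)\<^sup>2))"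
proof -
  obtain N where N: "negligible N" "\<And>s. s \<notin> N \<Longrightarrow> s \<in> {0<..<b} \<longrightarrow> \<bar>\<theta>' s\<bar> \<le> \<theta> s"
    using AE_lborel_negligible[OF slope] by metis
  \<comment> \<open>The value \<open>0\<close> on the null set satisfies any bound on the slope.\<close>
  define \<eta> where "\<eta> s = (if s \<in> {0<..<b} - N then \<theta>' s else 0)" for s
  have neg: "negligible (N \<union> {0, b})" using N(1) by simp
  have "L2_derivative 0 b \<theta> \<eta>"
    by (rule L2_derivative_spike[OF H1_deriv_imp_L2_derivative[OF \<theta> b] neg])
       (auto simp: \<eta>_def)
  moreover have "\<bar>\<eta> s\<bar> \<le> \<bar>\<theta> s\<bar>" for s using N(2)[of s] by (auto simp: \<eta>_def)
  moreover have "integral {0..b} (\<lambda>s. w s * ((\<theta> s)\<^sup>2 - (\<theta>' s)\<^sup>2)) = integral {0..b} (\<lambda>s. w s * ((\<theta> s)\<^sup>2 - (\<eta> s)\<^sup>2))" for w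
    by (rule integral_spike[OF neg]) (auto simp: \<eta>_def)
  ultimately show ?thesis using that by blast
qed

lemma falling_gain_le:
  assumes \<theta>: "L2_derivative 0 b \<theta> \<theta>'" "\<theta> b = 1" and b: "b > 0"
    and slope: "\<And>s. \<bar>\<theta>' s\<bar> \<le> \<bar>\<theta> s\<bar>"
    and w: "continuous_on {0..b} w" "\<And>s. s \<in> {0..b} \<Longrightarrow> 0 \<le> w s"
  shows "integral {0..b} (\<lambda>s. w s * ((\<theta> s)\<^sup>2 - (\<theta>' s)\<^sup>2)) \<le> integral {0..b} (\<lambda>s. w s * (exp b)\<^sup>2)"
proof (rule integral_le)
  show "(\<lambda>s. w s * ((\<theta> s)\<^sup>2 - (\<theta>' s)\<^sup>2)) integrable_on {0..b}"
    by (rule L2_weighted_integrable(3)[OF \<theta>(1) w(1)])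
  show "(\<lambda>s. w s * (exp b)\<^sup>2) integrable_on {0..b}"
    by (intro integrable_continuous_real continuous_intros w)
  fix s assume s: "s \<in> {0..b}"
  have "\<bar>\<theta> s\<bar>\<^sup>2 \<le> (exp b)\<^sup>2"
    using abs_le_exp_of_L2_derivative_le[OF \<theta>(1) b \<theta>(2) slope s] by (intro power_mono) auto
  then have "(\<theta> s)\<^sup>2 \<le> (exp b)\<^sup>2" by simp
  then have "(\<theta> s)\<^sup>2 - (\<theta>' s)\<^sup>2 \<le> (exp b)\<^sup>2" using zero_le_power2[of "\<theta>' s"] by linarith
  then show "w s * ((\<theta> s)\<^sup>2 - (\<theta>' s)\<^sup>2) \<le> w s * (exp b)\<^sup>2"
    by (rule mult_left_mono) (rule w(2)[OF s])
qed

text \<open>The element \<open>y0\<close> and the boundedness of \<open>J\<close> make \<open>Sup J\<close> a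
  positive number, so the division is meaningful.\<close>
lemma le_sqrt_Inf_div_sqrt_Sup:
  fixes I J :: "real set"
  assumes I: "I \<noteq> {}" "\<And>x. x \<in> I \<Longrightarrow> 0 \<le> x" and J: "bdd_above J" "y0 \<in> J" "y0 > 0"
    and le: "\<And>x y. x \<in> I \<Longrightarrow> y \<in> J \<Longrightarrow> k\<^sup>2 * y \<le> x" and k: "k \<ge> 0"
  shows "k \<le> sqrt (Inf I) / sqrt (Sup J)"
proof -
  have Sup_pos: "Sup J > 0" using cSup_upper[OF J(2,1)] J(3) by linarith
  have Inf_nonneg: "Inf I \<ge> 0" using I by (intro cInf_greatest) auto
  have "k\<^sup>2 * Sup J \<le> Inf I"
  proof (cases "k = 0")
    case True
    then show ?thesis using Inf_nonneg by simp
  next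
    case False
    have "Sup J \<le> Inf I / k\<^sup>2"
    proof (rule cSup_least)
      fix y assume y: "y \<in> J"
      have "k\<^sup>2 * y \<le> Inf I" using I(1) le[OF _ y] by (intro cInf_greatest) auto
      then show "y \<le> Inf I / k\<^sup>2" using False by (simp add: field_simps)
    qed (use J in auto)
    then show ?thesis using False by (simp add: field_simps)
  qed
  then have "sqrt (k\<^sup>2 * Sup J) \<le> sqrt (Inf I)" by simp
  then have "k * sqrt (Sup J) \<le> sqrt (Inf I)" using k by (simp add: real_sqrt_mult)
  then show ?thesis using Sup_pos by (simp add: field_simps)
qed

theorem proposition1p8:
  fixes S :: "real \<Rightarrow> 'a::complex_hilbert \<Rightarrow> 'a"
    and m :: "real \<Rightarrow> real"
    and a b t :: real
  assumes "strongly_continuous_semigroup S"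
    and "{z. Re z \<ge> 0} \<subseteq> resolvent_set (generator_dom S) (generator S)"
    and "bdd_above ((\<lambda>z. onorm (resolvent (generator_dom S) (generator S) z)) ` {z. Re z \<ge> 0})"
    and "(SUP z\<in>{z. Re z > 0}. onorm (resolvent (generator_dom S) (generator S) z)) = 1"
    and "\<And>s. s \<ge> 0 \<Longrightarrow> m s > 0"
    and "C1_halfline m"
    and "\<And>s. s \<ge> 0 \<Longrightarrow> onorm (S s) \<le> m s"
    and "a > 0" and "b > 0" and "t \<ge> a + b"
  shows "onorm (S t) \<le> exp (- (t - a - b)) *
    (sqrt (Inf {LINT s:{0<..<a}|lborel. (m s)\<^sup>2 * max ((u' s)\<^sup>2 - (u s)\<^sup>2) 0 | u u'.
        H1_deriv a u u' \<and> u 0 = 0 \<and> u a = 1})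
     / sqrt (Sup {LINT s:{0<..<b}|lborel. 1 / (m s)\<^sup>2 * ((\<theta> s)\<^sup>2 - (\<theta>' s)\<^sup>2) | \<theta> \<theta>'.
        H1_deriv b \<theta> \<theta>' \<and> \<theta> b = 1 \<and>
        (AE s in lborel. s \<in> {0<..<b} \<longrightarrow> \<bar>\<theta>' s\<bar> \<le> \<theta> s)}))"
proof -
  let ?R = "\<lambda>z. onorm (resolvent (generator_dom S) (generator S) z)"
  have res_le: "?R z \<le> 1" if "Re z > 0" for z
  proof -
    have "?R ` {z. Re z > 0} \<subseteq> ?R ` {z. Re z \<ge> 0}" by auto
    then have "bdd_above (?R ` {z. Re z > 0})" by (rule bdd_above_mono[OF assms(3)])
    then have "?R z \<le> (SUP z\<in>{z. Re z > 0}. ?R z)" by (rule cSUP_upper[rotated]) (use that in simp)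
    then show ?thesis using assms(4) by simp
  qed
  interpret contractive_resolvent S
  proof
    show "strongly_continuous_semigroup S" by (rule assms(1))
    fix z :: complex assume z: "Re z > 0"
    then show "z \<in> resolvent_set (generator_dom S) (generator S)" using assms(2) by force
    show "?R z \<le> 1" by (rule res_le[OF z])
  qed
  have m: "continuous_on {0..} m"
    using assms(6) unfolding C1_halfline_def
    by (meson DERIV_continuous continuous_on_eq_continuous_within atLeast_iff)
  have contw: "continuous_on {0..b} (\<lambda>s. 1 / (m s)\<^sup>2)"
    by (intro continuous_intros continuous_on_subset[OF m])
       (use assms(5) in \<open>force dest: order.strict_implies_not_eq\<close>)+
  define I where "I = {LINT s:{0<..<a}|lborel. (m s)\<^sup>2 * max ((u' s)\<^sup>2 - (u s)\<^sup>2) 0 | u u'.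
        H1_deriv a u u' \<and> u 0 = 0 \<and> u a = 1}"
  define J where "J = {LINT s:{0<..<b}|lborel. 1 / (m s)\<^sup>2 * ((\<theta> s)\<^sup>2 - (\<theta>' s)\<^sup>2) | \<theta> \<theta>'.
        H1_deriv b \<theta> \<theta>' \<and> \<theta> b = 1 \<and>
        (AE s in lborel. s \<in> {0<..<b} \<longrightarrow> \<bar>\<theta>' s\<bar> \<le> \<theta> s)}"
  have I_nonneg: "0 \<le> x" if x: "x \<in> I" for x
  proof -
    obtain u u' where "x = (LINT s:{0<..<a}|lborel. (m s)\<^sup>2 * max ((u' s)\<^sup>2 - (u s)\<^sup>2) 0)"
      using x unfolding I_def by blast
    then show ?thesis
      unfolding set_lebesgue_integral_def by (auto intro!: Bochner_Integration.integral_nonneg)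
  qed
  have I_ne: "I \<noteq> {}"
  proof -
    have "H1_deriv a (\<lambda>s. s / a) (\<lambda>s. 1 / a)"
      by (rule C1_imp_H1_deriv) (use assms(8) in \<open>auto intro!: derivative_eq_intros continuous_intros\<close>)
    then have "(LINT s:{0<..<a}|lborel. (m s)\<^sup>2 * max ((1 / a)\<^sup>2 - (s / a)\<^sup>2) 0) \<in> I"
      unfolding I_def using assms(8)
      by (intro CollectI exI[of _ "\<lambda>s. s / a"] exI[of _ "\<lambda>s. 1 / a"]) simp
    then show ?thesis by auto
  qed
  have J_elem: "\<exists>\<theta> \<eta>. L2_derivative 0 b \<theta> \<eta> \<and> \<theta> b = 1 \<and> (\<forall>s. \<bar>\<eta> s\<bar> \<le> \<bar>\<theta> s\<bar>) \<and>
      y = integral {0..b} (\<lambda>s. 1 / (m s)\<^sup>2 * ((\<theta> s)\<^sup>2 - (\<eta> s)\<^sup>2))" if y: "y \<in> J" for y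
  proof -
    obtain \<theta> \<theta>' where \<theta>: "H1_deriv b \<theta> \<theta>'" "\<theta> b = 1"
        "AE s in lborel. s \<in> {0<..<b} \<longrightarrow> \<bar>\<theta>' s\<bar> \<le> \<theta> s"
      and yeq: "y = (LINT s:{0<..<b}|lborel. 1 / (m s)\<^sup>2 * ((\<theta> s)\<^sup>2 - (\<theta>' s)\<^sup>2))"
      using y unfolding J_def by blast
    obtain \<eta> where \<eta>: "L2_derivative 0 b \<theta> \<eta>" "\<forall>s. \<bar>\<eta> s\<bar> \<le> \<bar>\<theta> s\<bar>"
        "\<forall>w. integral {0..b} (\<lambda>s. w s * ((\<theta> s)\<^sup>2 - (\<theta>' s)\<^sup>2)) = integral {0..b} (\<lambda>s. w s * ((\<theta> s)\<^sup>2 - (\<eta> s)\<^sup>2))"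
      by (rule slope_bound_representative[OF \<theta>(1) assms(9) \<theta>(3)])
    have "y = integral {0..b} (\<lambda>s. 1 / (m s)\<^sup>2 * ((\<theta> s)\<^sup>2 - (\<theta>' s)\<^sup>2))"
      unfolding yeq by (rule falling_gain_eq[OF \<theta>(1) m assms(5)])
    also have "\<dots> = integral {0..b} (\<lambda>s. 1 / (m s)\<^sup>2 * ((\<theta> s)\<^sup>2 - (\<eta> s)\<^sup>2))"
      using \<eta>(3) by (rule spec[of _ "\<lambda>s. 1 / (m s)\<^sup>2"])
    finally show ?thesis using \<eta>(1,2) \<theta>(2) by (intro exI conjI)
  qed
  have J_bdd: "bdd_above J"
  proof (rule bdd_aboveI)
    fix y assume "y \<in> J"
    then obtain \<theta> \<eta> where "L2_derivative 0 b \<theta> \<eta>" "\<theta> b = 1" "\<And>s. \<bar>\<eta> s\<bar> \<le> \<bar>\<theta> s\<bar>"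
      "y = integral {0..b} (\<lambda>s. 1 / (m s)\<^sup>2 * ((\<theta> s)\<^sup>2 - (\<eta> s)\<^sup>2))"
      using J_elem by blast
    then show "y \<le> integral {0..b} (\<lambda>s. 1 / (m s)\<^sup>2 * (exp b)\<^sup>2)"
      using falling_gain_le[of b \<theta> \<eta> "\<lambda>s. 1 / (m s)\<^sup>2"] contw assms(9) by simp
  qed
  define y0 where "y0 = integral {0..b} (\<lambda>s. 1 / (m s)\<^sup>2)"
  have y0_J: "y0 \<in> J"
  proof -
    have H: "H1_deriv b (\<lambda>s. 1) (\<lambda>s. 0)"
      by (rule C1_imp_H1_deriv) (use assms(9) in auto)
    have "y0 = (LINT s:{0<..<b}|lborel. 1 / (m s)\<^sup>2 * (1\<^sup>2 - 0\<^sup>2))"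
      using falling_gain_eq[OF H m assms(5)] unfolding y0_def by simp
    then show ?thesis
      unfolding J_def using H by (intro CollectI exI[of _ "\<lambda>s. 1"] exI[of _ "\<lambda>s. 0"]) simp
  qed
  have y0_pos: "y0 > 0"
  proof -
    have contm: "continuous_on {0..b} m" by (rule continuous_on_subset[OF m]) auto
    obtain B where B: "B > 0" "\<And>s. s \<in> {0..b} \<Longrightarrow> \<bar>m s\<bar> \<le> B"
      using continuous_Icc_abs_bounded[OF contm] by metis
    have "integral {0..b} (\<lambda>_. 1 / B\<^sup>2) \<le> y0"
      unfolding y0_def
    proof (rule integral_le)
      show "(\<lambda>s. 1 / (m s)\<^sup>2) integrable_on {0..b}" by (rule integrable_continuous_real[OF contw])
      fix s assume s: "s \<in> {0..b}"
      have "(m s)\<^sup>2 \<le> B\<^sup>2" using B(2)[OF s] B(1) by (simp add: abs_le_square_iff[symmetric])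
      then show "1 / B\<^sup>2 \<le> 1 / (m s)\<^sup>2" using assms(5)[of s] s B(1) by (intro divide_left_mono mult_pos_pos) auto
    qed auto
    moreover have "integral {0..b} (\<lambda>_. 1 / B\<^sup>2) > 0" using B(1) assms(9) by simp
    ultimately show ?thesis by linarith
  qed
  have lin: "bounded_linear (S t)" using assms(8-10) by (intro bounded_linear_S) auto
  have "(exp (t - a - b) * onorm (S t))\<^sup>2 * y \<le> x" if x: "x \<in> I" and y: "y \<in> J" for x y
  proof -
    obtain u u' where u: "H1_deriv a u u'" "u 0 = 0" "u a = 1"
      and xeq: "x = (LINT s:{0<..<a}|lborel. (m s)\<^sup>2 * max ((u' s)\<^sup>2 - (u s)\<^sup>2) 0)"
      using x unfolding I_def by blast
    obtain \<theta> \<eta> where \<theta>: "L2_derivative 0 b \<theta> \<eta>" "\<theta> b = 1" "\<And>s. \<bar>\<eta> s\<bar> \<le> \<bar>\<theta> s\<bar>"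
      and yeq: "y = integral {0..b} (\<lambda>s. 1 / (m s)\<^sup>2 * ((\<theta> s)\<^sup>2 - (\<eta> s)\<^sup>2))"
      using J_elem[OF y] by blast
    have xeq': "x = integral {0..a} (\<lambda>s. (m s)\<^sup>2 * max ((u' s)\<^sup>2 - (u s)\<^sup>2) 0)"
      unfolding xeq by (rule rising_cost_eq[OF u(1) m])
    have key: "(exp (t - a - b) * norm (S t v))\<^sup>2 * y \<le> x * (norm v)\<^sup>2" for v
      unfolding xeq' yeq
      by (rule rising_and_falling_energy[OF m assms(5,7,8,9,10)
            H1_deriv_imp_L2_derivative[OF u(1) assms(8)] u(2,3) \<theta>])
    show ?thesis
    proof (cases "y \<le> 0")
      case True
      then have "(exp (t - a - b) * onorm (S t))\<^sup>2 * y \<le> 0" by (intro mult_nonneg_nonpos) auto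
      then show ?thesis using I_nonneg[OF x] by linarith
    next
      case False
      \<comment> \<open>The bound on \<open>S t\<close> for which the claimed inequality becomes an equality.\<close>
      define \<beta> where "\<beta> = sqrt (x / y) / exp (t - a - b)"
      have \<beta>: "\<beta> \<ge> 0" "(exp (t - a - b) * \<beta>)\<^sup>2 * y = x"
        using False I_nonneg[OF x] by (auto simp: \<beta>_def)
      have "norm (S t v) \<le> \<beta> * norm v" for v
      proof (rule power2_le_imp_le)
        have "(exp (t - a - b))\<^sup>2 * y * (norm (S t v))\<^sup>2 \<le> (exp (t - a - b))\<^sup>2 * y * (\<beta> * norm v)\<^sup>2"
          using key[of v] unfolding \<beta>(2)[symmetric] by (simp add: power_mult_distrib mult_ac)
        then show "(norm (S t v))\<^sup>2 \<le> (\<beta> * norm v)\<^sup>2" using False by (subst (asm) mult_le_cancel_left_pos) auto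
      qed (use \<beta>(1) in simp)
      then have "onorm (S t) \<le> \<beta>" by (intro onorm_bound \<beta>(1))
      then have "(exp (t - a - b) * onorm (S t))\<^sup>2 * y \<le> (exp (t - a - b) * \<beta>)\<^sup>2 * y"
        using False onorm_pos_le[OF lin] by (intro mult_right_mono power_mono mult_left_mono) auto
      then show ?thesis unfolding \<beta>(2) .
    qed
  qed
  then have "exp (t - a - b) * onorm (S t) \<le> sqrt (Inf I) / sqrt (Sup J)"
    using I_ne I_nonneg J_bdd y0_J y0_pos onorm_pos_le[OF lin]
    by (intro le_sqrt_Inf_div_sqrt_Sup[of I J y0]) auto
  then have "exp (- (t - a - b)) * (exp (t - a - b) * onorm (S t)) \<le> exp (- (t - a - b)) * (sqrt (Inf I) / sqrt (Sup J))"
    by (rule mult_left_mono) simp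
  also have "exp (- (t - a - b)) * (exp (t - a - b) * onorm (S t)) = onorm (S t)"
    by (simp only: mult.assoc[symmetric] exp_add[symmetric]) simp
  finally show ?thesis unfolding I_def J_def .
qed

end
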